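(* Let $X_1,\dots,X_n$ be i.i.d. observations from a density $g_0\in\mathcal D_k$, with empirical distribution function $\mathbb G_n$, where $k\in\{1,2,\dots\}\cup\{\infty\}$. Then the maximum likelihood estimator $\hat g_{n,k}$ in the class $\mathcal D_k$ (a maximizer of $l_n(g)=\int_0^\infty\log g(x)\,d\mathbb G_n(x)$ over $g\in\mathcal D_k$) exists. Furthermore, $\hat g_{n,k}$ is the maximizer of $$\psi_n(g)=\int_0^\infty \log g(x)\,d\mathbb G_n(x)-\int_0^\infty g(x)\,dx$$ over $\mathcal M_k\cap L_1(\lambda)$. Moreover, for $k\in\{1,2,\dots\}$ the density $\hat g_{n,k}$ is of the form $$\hat g_{n,k}(x)=\hat w_1\frac{k(\hat a_1-x)_+^{k-1}}{\hat a_1^k}+\cdots+\hat w_m\frac{k(\hat a_m-x)_+^{k-1}}{\hat a_m^k}$$ for some $m=\hat m_k$, while for $k=\infty$, $\hat g_{n,\infty}$ is of the form $$\hat g_{n,\infty}(x)=\frac{\hat w_1}{\hat a_1}\exp(-x/\hat a_1)+\cdots+\frac{\hat w_m}{\hat a_m}\exp(-x/\hat a_m)$$ for some $m=\hat m_\infty$, where $\hat w_1,\dots,\hat w_m$ and $\hat a_1,\dots,\hat a_m$ are respectively the weights and the support points of the maximizing mixing distribution $\hat F_{n,k}$.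
   Context: For an integer $k\ge2$, a function $g$ on $(0,\infty)$ is $k$-monotone if $(-1)^l g^{(l)}$ is nonnegative, nonincreasing and convex for $l=0,\dots,k-2$; for $k=1$, if it is nonnegative and nonincreasing; for $k=\infty$ ("completely monotone"), if $(-1)^lg^{(l)}(x)\ge0$ for all $x>0$ and all $l\ge0$. $\mathcal M_k$ is the class of $k$-monotone functions on $(0,\infty)$ and $\mathcal D_k$ the subclass of $k$-monotone probability densities on $(0,\infty)$. $\lambda$ is Lebesgue measure on $(0,\infty)$. $\mathbb G_n(x)=n^{-1}\sum_{i=1}^n1\{X_i\le x\}$. Notation $y_+=\max(y,0)$, and for $k=1$, $(a-x)_+^0$ is the indicator of $\{x\le a\}$. Every $g\in\mathcal D_k$ corresponds to a mixing distribution function $F$ on $(0,\infty)$ via $g(x)=\int_0^\infty \frac{k(t-x)_+^{k-1}}{t^k}dF(t)$ for $k<\infty$, and $g(x)=\int_0^\infty t^{-1}e^{-x/t}dF(t)$ for $k=\infty$; $\hat F_{n,k}$ is the mixing distribution function corresponding to $\hat g_{n,k}$. *)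

theory Defs
  imports "HOL-Probability.Probability"
begin

text \<open>
  Functions on \<open>(0, \<infinity>)\<close> are represented by functions on the reals whose values outside
  \<open>(0, \<infinity>)\<close> are ignored throughout.
\<close>

definition lebesgue_pos :: "real measure" where
  "lebesgue_pos = restrict_space lborel {0<..}"

text \<open>
  The iterated derivatives have to exist for the sign and shape conditions on them to make
  sense; since \<^const>\<open>deriv\<close> is total, this existence is stated explicitly. For \<open>k = 1\<close> no
  derivative and no convexity is involved. The value \<open>k = 0\<close> is never used.
\<close>

definition k_monotone :: "enat \<Rightarrow> (real \<Rightarrow> real) \<Rightarrow> bool" where
  "k_monotone k g = (case k of
      enat j \<Rightarrow>
        if j \<le> 1 then (\<forall>x>0. 0 \<le> g x) \<and> antimono_on {0<..} g
        else (\<forall>l<j - 2. (deriv ^^ l) g differentiable_on {0<..}) \<and>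
             (\<forall>l\<le>j - 2. (\<forall>x>0. 0 \<le> (-1) ^ l * (deriv ^^ l) g x) \<and>
                         antimono_on {0<..} (\<lambda>x. (-1) ^ l * (deriv ^^ l) g x) \<and>
                         convex_on {0<..} (\<lambda>x. (-1) ^ l * (deriv ^^ l) g x))
    | \<infinity> \<Rightarrow>
        (\<forall>l. (deriv ^^ l) g differentiable_on {0<..}) \<and>
        (\<forall>l. \<forall>x>0. 0 \<le> (-1) ^ l * (deriv ^^ l) g x))"

definition k_monotone_class :: "enat \<Rightarrow> (real \<Rightarrow> real) set" where
  "k_monotone_class k = {g. k_monotone k g}"

definition k_monotone_L1 :: "enat \<Rightarrow> (real \<Rightarrow> real) set" where
  "k_monotone_L1 k = {g \<in> k_monotone_class k. integrable lebesgue_pos g}"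

definition k_monotone_densities :: "enat \<Rightarrow> (real \<Rightarrow> real) set" where
  "k_monotone_densities k =
     {g \<in> k_monotone_class k. integrable lebesgue_pos g \<and> (LINT x|lebesgue_pos. g x) = 1}"

definition ecdf :: "nat \<Rightarrow> (nat \<Rightarrow> real) \<Rightarrow> real \<Rightarrow> real" where
  "ecdf n X x = (\<Sum>i=1..n. of_bool (X i \<le> x)) / real n"

text \<open>
  The logarithm takes the value \<open>-\<infinity>\<close> at 0 (whereas \<^term>\<open>ln (0 :: real) = 0\<close>), so that
  functions vanishing at an observation have log-likelihood \<open>-\<infinity>\<close>. This requires
  integrals of extended-real functions, taken as positive part minus negative part. They are
  only applied to empirical measures and functions \<open>log g\<close> that are never \<open>+\<infinity>\<close>, so that
  \<open>\<infinity> - \<infinity>\<close> does not occur.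
\<close>

definition ext_ln :: "real \<Rightarrow> ereal" where
  "ext_ln x = (if 0 < x then ereal (ln x) else -\<infinity>)"

definition ext_integral :: "'a measure \<Rightarrow> ('a \<Rightarrow> ereal) \<Rightarrow> ereal" where
  "ext_integral M f =
     enn2ereal (\<integral>\<^sup>+x. e2ennreal (max 0 (f x)) \<partial>M) -
     enn2ereal (\<integral>\<^sup>+x. e2ennreal (max 0 (- f x)) \<partial>M)"

definition log_lik :: "nat \<Rightarrow> (nat \<Rightarrow> real) \<Rightarrow> (real \<Rightarrow> real) \<Rightarrow> ereal" where
  "log_lik n X g =
     ext_integral (restrict_space (interval_measure (ecdf n X)) {0<..}) (\<lambda>x. ext_ln (g x))"

definition psi :: "nat \<Rightarrow> (nat \<Rightarrow> real) \<Rightarrow> (real \<Rightarrow> real) \<Rightarrow> ereal" where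
  "psi n X g = log_lik n X g - ereal (LINT x|lebesgue_pos. g x)"

definition is_mle :: "enat \<Rightarrow> nat \<Rightarrow> (nat \<Rightarrow> real) \<Rightarrow> (real \<Rightarrow> real) \<Rightarrow> bool" where
  "is_mle k n X g \<longleftrightarrow> is_arg_max (log_lik n X) (\<lambda>h. h \<in> k_monotone_densities k) g"

text \<open>
  The truncated power \<open>y\<^sub>+\<^sup>j\<close>. For \<open>j = 0\<close> it is the indicator of \<open>0 \<le> y\<close>, which makes
  \<open>(a - x)\<^sub>+\<^sup>0\<close> the indicator of \<open>x \<le> a\<close>.
\<close>

definition trunc_pow :: "real \<Rightarrow> nat \<Rightarrow> real" where
  "trunc_pow y j = (if j = 0 then of_bool (0 \<le> y) else (max y 0) ^ j)"

definition mix_kernel :: "enat \<Rightarrow> real \<Rightarrow> real \<Rightarrow> real" where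
  "mix_kernel k t x = (case k of
      enat j \<Rightarrow> real j * trunc_pow (t - x) (j - 1) / t ^ j
    | \<infinity> \<Rightarrow> exp (- x / t) / t)"

definition pos_distribution_function :: "(real \<Rightarrow> real) \<Rightarrow> bool" where
  "pos_distribution_function F \<longleftrightarrow>
     mono F \<and> (\<forall>t. continuous (at_right t) F) \<and> (\<forall>t\<le>0. F t = 0) \<and> (F \<longlongrightarrow> 1) at_top"

definition mixing_df :: "enat \<Rightarrow> (real \<Rightarrow> real) \<Rightarrow> (real \<Rightarrow> real) \<Rightarrow> bool" where
  "mixing_df k F g \<longleftrightarrow>
     pos_distribution_function F \<and>
     (\<forall>x>0. g x = (LINT t:{0<..}|interval_measure F. mix_kernel k t x))"

definition discrete_df ::
    "nat \<Rightarrow> (nat \<Rightarrow> real) \<Rightarrow> (nat \<Rightarrow> real) \<Rightarrow> (real \<Rightarrow> real) \<Rightarrow> bool" where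
  "discrete_df m w a F \<longleftrightarrow>
     inj_on a {1..m} \<and> (\<forall>j\<in>{1..m}. 0 < a j \<and> 0 < w j) \<and> (\<Sum>j=1..m. w j) = 1 \<and>
     (\<forall>t. F t = (\<Sum>j=1..m. w j * of_bool (a j \<le> t)))"

end

theory Submission
  imports Defs "HOL-Complex_Analysis.Conformal_Mappings"
begin

text \<open>
  Write \<open>K t x\<close> for \<^term>\<open>mix_kernel k t x\<close>. Suppose that positive numbers \<open>L i\<close> satisfy
  \<open>D t = (\<Sum>i. K t (x i) / L i) \<le> n\<close> for every \<open>t > 0\<close> and that some mixture of kernels of total
  mass at most one takes values at least \<open>L i\<close> at the observations \<open>x i\<close>. Integrating \<open>D\<close>
  against the mixing measure shows that its mass is one, that the values are exactly \<open>L i\<close>, and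
  that the measure sits on the contact set \<open>D = n\<close> (\<open>stationary_support\<close>). The contact set is
  finite: for finite \<open>k\<close> it is cut out by finitely many nonzero polynomials, and for \<open>k = \<infinity>\<close> by
  a nonzero entire function whose positive zeros are bounded (\<open>finite_contact_set\<close>). So the mixture is a finite
  one, hence a genuine \<open>k\<close>-monotone density.

  Every integrable \<open>k\<close>-monotone \<open>h\<close> is a mixture of kernels whose mixing measure has mass
  \<open>\<integral> h\<close>: Williamson's theorem for finite \<open>k\<close>, Bernstein's for \<open>k = \<infinity>\<close> (for \<open>k = 1\<close>, where
  nothing fixes the value at a jump, \<open>h\<close> is only bounded by the mixture). Integrating \<open>D\<close> again
  gives \<open>(\<Sum>i. h (x i) / L i) \<le> n * \<integral> h\<close>, and \<open>ln r \<le> r - 1\<close> turns this into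
  \<open>psi h \<le> (\<Sum>i. ln (L i)) / n - 1\<close>, with equality only if \<open>h (x i) = L i\<close> for all \<open>i\<close> and
  \<open>\<integral> h = 1\<close> (\<open>sum_ln_le\<close>). Both maximization problems therefore have the same solutions:
  the densities with \<open>h (x i) = L i\<close> (\<open>maximizers_iff\<close>). Applying \<open>stationary_support\<close> to any
  mixing distribution of such a density shows that it is finitely supported. For \<open>k = 1\<close> such a
  density is itself a mixture because it can jump only at contact points, and these are
  observations (\<open>contact_points_are_observations\<close>), where its value is known.

  What remains is to produce \<open>L\<close>. Among discrete mixtures take a sequence whose likelihoods tend
  to the supremum. Along a subsequence its vectors of values at the observations converge to some
  \<open>L\<close>, and moving an infinitesimal mass to a point \<open>t\<close> cannot increase the limiting likelihood,
  which is \<open>D t \<le> n\<close> (\<open>limiting_stationarity\<close>). Along a further subsequence the mixing measures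
  converge vaguely on \<open>(0, \<infinity>)\<close>; mass may escape to \<open>0\<close> or \<open>\<infinity>\<close>, where the kernels vanish,
  and this is harmless because \<open>stationary_support\<close> only asks for mass at most one. The same
  compactness yields Bernstein's theorem from Williamson's by letting \<open>k\<close> tend to infinity.
\<close>

section \<open>Stieltjes measures of monotone functions on the half-line\<close>

lemma borel_measurable_antimono_on_pos:
  fixes p :: "real \<Rightarrow> real"
  assumes "antimono_on {0<..} p"
  shows "(\<lambda>y. indicator {0<..} y * p y) \<in> borel_measurable borel"
proof -
  have "mono_on {0<..} (\<lambda>x. - p x)"
    using assms by (auto simp: monotone_on_def)
  then have "(\<lambda>x. - p x) \<in> borel_measurable (restrict_space borel {0<..})"
    by (rule borel_measurable_mono_on_fnc)
  then have "(\<lambda>x. - (- p x)) \<in> borel_measurable (restrict_space borel {0<..})"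
    by measurable
  then show ?thesis
    by (simp add: borel_measurable_restrict_space_iff)
qed

text \<open>
  Cutting \<open>[a, b]\<close> into \<open>N\<close> equal pieces, the total error telescopes to
  \<open>(p a - p b) * (b - a) / N\<close>. This replaces differentiation in the next lemma, where \<open>p\<close> need
  not be continuous.
\<close>
lemma constant_if_increments_small:
  fixes H p :: "real \<Rightarrow> real"
  assumes "a \<le> b"
    and incr: "\<And>c d. a \<le> c \<Longrightarrow> c \<le> d \<Longrightarrow> d \<le> b \<Longrightarrow> \<bar>H c - H d\<bar> \<le> (p c - p d) * (d - c)"
  shows "H a = H b"
proof -
  have bound: "\<bar>H a - H b\<bar> \<le> (p a - p b) * (b - a) * inverse (real (Suc N))" for N
  proof -
    define c where "c i = a + real i * (b - a) / real (Suc N)" for i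
    have c_step: "c (Suc i) - c i = (b - a) / real (Suc N)" for i
    proof -
      define M where "M = real (Suc N)"
      then have "M > 0" by simp
      then show ?thesis unfolding c_def M_def[symmetric] by (simp add: field_simps)
    qed
    have c0: "c 0 = a" by (simp add: c_def)
    have "real (Suc N) * (b - a) / real (Suc N) = b - a"
      by (rule nonzero_mult_div_cancel_left) simp
    then have cN: "c (Suc N) = b"
      unfolding c_def by linarith
    have c_range: "a \<le> c i" "c i \<le> c (Suc i)" for i
      using \<open>a \<le> b\<close> by (auto simp: c_def divide_right_mono mult_right_mono)
    have c_le: "c (Suc i) \<le> b" if "i < Suc N" for i
    proof -
      have "real (Suc i) * (b - a) \<le> real (Suc N) * (b - a)"
        using that \<open>a \<le> b\<close> by (intro mult_right_mono) auto
      then have "real (Suc i) * (b - a) / real (Suc N) \<le> b - a"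
        by (subst pos_divide_le_eq) (simp_all only: of_nat_0_less_iff zero_less_Suc mult.commute)
      then show ?thesis unfolding c_def by linarith
    qed
    have "H a - H b = (\<Sum>i<Suc N. H (c i) - H (c (Suc i)))"
      using sum_lessThan_telescope'[of "\<lambda>i. H (c i)" "Suc N"] unfolding c0 cN by (rule sym)
    also have "\<bar>\<dots>\<bar> \<le> (\<Sum>i<Suc N. \<bar>H (c i) - H (c (Suc i))\<bar>)"
      by (rule sum_abs)
    also have "\<dots> \<le> (\<Sum>i<Suc N. (p (c i) - p (c (Suc i))) * ((b - a) / real (Suc N)))"
      using incr[OF c_range(1) c_range(2) c_le] c_step by (intro sum_mono) simp
    also have "\<dots> = (\<Sum>i<Suc N. p (c i) - p (c (Suc i))) * ((b - a) / real (Suc N))"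
      by (rule sum_distrib_right[symmetric])
    also have "(\<Sum>i<Suc N. p (c i) - p (c (Suc i))) = p a - p b"
      using sum_lessThan_telescope'[of "\<lambda>i. p (c i)" "Suc N"] unfolding c0 cN .
    finally show ?thesis by (simp add: field_simps)
  qed
  have "(\<lambda>N. (p a - p b) * (b - a) * inverse (real (Suc N))) \<longlonglongrightarrow> (p a - p b) * (b - a) * 0"
    by (intro tendsto_intros LIMSEQ_inverse_real_of_nat)
  then have "\<bar>H a - H b\<bar> \<le> (p a - p b) * (b - a) * 0"
    by (rule LIMSEQ_le_const) (use bound in auto)
  then show ?thesis by simp
qed

text \<open>
  Both \<open>g\<close> and the integral of \<open>p\<close> over \<open>{y..}\<close> have increments over \<open>[c, d]\<close> between
  \<open>p d * (d - c)\<close> and \<open>p c * (d - c)\<close>, so they differ by a constant, which vanishes at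
  infinity. No derivative of \<open>g\<close> occurs, so the lemma covers convex functions with kinks as well
  as smooth ones.
\<close>
lemma integral_of_slope_bound:
  fixes g p :: "real \<Rightarrow> real"
  assumes nonneg: "\<And>y. 0 < y \<Longrightarrow> 0 \<le> p y" and anti: "antimono_on {0<..} p"
    and slope: "\<And>a b. 0 < a \<Longrightarrow> a \<le> b \<Longrightarrow> p b * (b - a) \<le> g a - g b \<and> g a - g b \<le> p a * (b - a)"
    and lim: "(g \<longlongrightarrow> 0) at_top" and "0 < x"
  shows "ennreal (g x) = (\<integral>\<^sup>+y. ennreal (p y) * indicator {x<..} y \<partial>lborel)"
proof -
  let ?J = "\<integral>\<^sup>+y. ennreal (p y) * indicator {x<..} y \<partial>lborel"
  define \<Phi> where "\<Phi> c d = (\<integral>\<^sup>+y. ennreal (p y) * indicator {c<..d} y \<partial>lborel)" for c d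
  have meas: "(\<lambda>y. ennreal (p y) * indicator A y) \<in> borel_measurable borel"
    if "A \<in> sets borel" "A \<subseteq> {0<..}" for A
  proof -
    have "(\<lambda>y. ennreal (indicator {0<..} y * p y) * indicator A y) \<in> borel_measurable borel"
      using borel_measurable_antimono_on_pos[OF anti] that(1) by measurable
    also have "(\<lambda>y. ennreal (indicator {0<..} y * p y) * indicator A y) = (\<lambda>y. ennreal (p y) * indicator A y)"
      using that(2) by (intro ext) (auto split: split_indicator)
    finally show ?thesis .
  qed
  have p_le: "p d \<le> p c" if "0 < c" "c \<le> d" for c d
    using anti that by (auto simp: monotone_on_def)
  have \<Phi>_upper: "\<Phi> c d \<le> ennreal (p c * (d - c))" if "0 < c" "c \<le> d" for c d
  proof -
    have "\<Phi> c d \<le> (\<integral>\<^sup>+y. ennreal (p c) * indicator {c<..d} y \<partial>lborel)"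
      unfolding \<Phi>_def using that
      by (intro nn_integral_mono) (auto split: split_indicator intro!: ennreal_leI p_le)
    also have "\<dots> = ennreal (p c * (d - c))"
      using that nonneg by (simp add: nn_integral_cmult_indicator ennreal_mult)
    finally show ?thesis .
  qed
  have \<Phi>_lower: "ennreal (p d * (d - c)) \<le> \<Phi> c d" if "0 < c" "c \<le> d" for c d
  proof -
    have "ennreal (p d * (d - c)) = (\<integral>\<^sup>+y. ennreal (p d) * indicator {c<..d} y \<partial>lborel)"
      using that nonneg by (simp add: nn_integral_cmult_indicator ennreal_mult)
    also have "\<dots> \<le> \<Phi> c d"
      unfolding \<Phi>_def using that
      by (intro nn_integral_mono) (auto split: split_indicator intro!: ennreal_leI p_le)
    finally show ?thesis .
  qed
  have \<Phi>_add: "\<Phi> x d = \<Phi> x c + \<Phi> c d" if "x \<le> c" "c \<le> d" for c d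
    unfolding \<Phi>_def using that \<open>0 < x\<close>
    by (subst nn_integral_add[symmetric])
       (auto intro!: meas nn_integral_cong simp flip: distrib_left split: split_indicator)
  have \<Phi>_real: "\<Phi> c d = ennreal (enn2real (\<Phi> c d))" if "0 < c" "c \<le> d" for c d
    using \<Phi>_upper[OF that] by (metis ennreal_enn2real ennreal_less_top infinity_ennreal_def le_less_trans)
  have g_diff: "\<Phi> x b = ennreal (g x - g b)" if "x \<le> b" for b
  proof -
    define H where "H c = g c + enn2real (\<Phi> x c)" for c
    have "H x = H b"
    proof (rule constant_if_increments_small[where H=H and p=p])
      fix c d assume cd: "x \<le> c" "c \<le> d" "d \<le> b"
      then have "0 < c" using \<open>0 < x\<close> by simp
      have "enn2real (\<Phi> x d) = enn2real (\<Phi> x c) + enn2real (\<Phi> c d)"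
        using \<Phi>_add[of c d] \<Phi>_real[of x c] \<Phi>_real[of c d] cd \<open>0 < x\<close>
        by (metis enn2real_plus ennreal_less_top le_less_trans less_le_trans order_refl)
      then have "H c - H d = (g c - g d) - enn2real (\<Phi> c d)"
        by (simp add: H_def)
      moreover have "enn2real (\<Phi> c d) \<le> p c * (d - c)"
        using \<Phi>_upper[of c d] cd \<open>0 < c\<close> nonneg[of c] by (intro enn2real_leI) auto
      moreover have "p d * (d - c) \<le> enn2real (\<Phi> c d)"
        using \<Phi>_lower[of c d] \<Phi>_real[of c d] cd \<open>0 < c\<close>
        by (metis enn2real_nonneg ennreal_le_iff)
      ultimately show "\<bar>H c - H d\<bar> \<le> (p c - p d) * (d - c)"
        using slope[of c d] cd \<open>0 < c\<close> by (auto simp: algebra_simps abs_le_iff)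
    qed (use that in auto)
    moreover have "\<Phi> x x = 0" by (simp add: \<Phi>_def)
    ultimately have "enn2real (\<Phi> x b) = g x - g b"
      by (simp add: H_def)
    then show ?thesis
      using \<Phi>_real[of x b] that \<open>0 < x\<close> by simp
  qed
  have "(\<lambda>n. ennreal (g x - g (x + real n))) \<longlonglongrightarrow> ennreal (g x - 0)"
    by (intro tendsto_intros filterlim_compose[OF lim]
        filterlim_tendsto_add_at_top[OF tendsto_const filterlim_real_sequentially])
  then have 1: "(\<lambda>n. \<Phi> x (x + real n)) \<longlonglongrightarrow> ennreal (g x)"
    by (simp add: g_diff)
  have "?J
      = (\<integral>\<^sup>+y. (SUP n. ennreal (p y) * indicator {x<..x + real n} y) \<partial>lborel)"
  proof (intro nn_integral_cong antisym)
    fix y :: real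
    obtain n where "y \<le> x + real n"
      by (metis add.commute diff_le_eq real_arch_simple)
    then show "ennreal (p y) * indicator {x<..} y \<le> (SUP n. ennreal (p y) * indicator {x<..x + real n} y)"
      by (intro SUP_upper2[of n]) (auto split: split_indicator)
  qed (auto intro!: SUP_least split: split_indicator)
  also have "\<dots> = (SUP n. \<Phi> x (x + real n))"
    unfolding \<Phi>_def using \<open>0 < x\<close>
    by (intro nn_integral_monotone_convergence_SUP)
       (auto intro!: meas simp: incseq_def le_fun_def split: split_indicator)
  finally have 2: "?J = (SUP n. \<Phi> x (x + real n))" .
  have "incseq (\<lambda>n. \<Phi> x (x + real n))"
    unfolding \<Phi>_def by (auto simp: incseq_def split: split_indicator intro!: nn_integral_mono)
  then have "(\<lambda>n. \<Phi> x (x + real n)) \<longlonglongrightarrow> (SUP n. \<Phi> x (x + real n))"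
    by (rule LIMSEQ_SUP)
  with 1 2 show ?thesis
    using LIMSEQ_unique by metis
qed

text \<open>
  The tail of \<open>\<nu>\<close> should be \<open>p\<close>. As \<open>p\<close> may jump without being one-sided continuous, its
  values are only caught between the open and the closed tails. Since \<open>p\<close> may be unbounded
  near \<open>0\<close>, the Stieltjes measure is built on the whole line in the variable \<open>ln t\<close> and then
  transported to \<open>(0, \<infinity>)\<close> by \<^const>\<open>exp\<close>.
\<close>
lemma tail_measure_exists:
  fixes p :: "real \<Rightarrow> real"
  assumes nonneg: "\<And>y. 0 < y \<Longrightarrow> 0 \<le> p y" and anti: "antimono_on {0<..} p"
    and lim: "(p \<longlongrightarrow> 0) at_top"
  obtains \<nu> where "sets \<nu> = sets borel" "sigma_finite_measure \<nu>" "emeasure \<nu> {..0} = 0"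
    "\<And>y. 0 < y \<Longrightarrow> emeasure \<nu> {y<..} \<le> ennreal (p y) \<and> ennreal (p y) \<le> emeasure \<nu> {y..}"
proof -
  define q where "q s = p (exp s)" for s
  \<comment> \<open>The right-continuous version of \<open>q\<close>.\<close>
  define Q where "Q s = (SUP z\<in>{s<..}. q z)" for s
  have q0: "0 \<le> q s" for s by (simp add: q_def nonneg)
  have q_anti: "q t \<le> q s" if "s \<le> t" for s t
    using anti that by (auto simp: q_def monotone_on_def)
  have q_lim: "(q \<longlongrightarrow> 0) at_top"
    unfolding q_def by (rule filterlim_compose[OF lim exp_at_top])
  have bdd: "bdd_above (q ` {s<..})" for s
    by (rule bdd_aboveI[of _ "q s"]) (auto intro: q_anti)
  have ne: "{s<..} \<noteq> {}" for s :: real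
    by (metis greaterThan_iff gt_ex empty_iff)
  have Qq: "Q s \<le> q s" for s
    unfolding Q_def by (rule cSUP_least[OF ne]) (auto intro: q_anti)
  have qQ: "q t \<le> Q s" if "s < t" for s t
    unfolding Q_def by (rule cSUP_upper[OF _ bdd]) (use that in auto)
  have Q_anti: "Q t \<le> Q s" if "s \<le> t" for s t
    unfolding Q_def by (rule cSUP_subset_mono[OF ne bdd]) (use that in auto)
  have Q0: "0 \<le> Q s" for s
    using qQ[of s "s+1"] q0[of "s+1"] by linarith
  have Q_lim: "(Q \<longlongrightarrow> 0) at_top"
    by (rule tendsto_sandwich[OF _ _ tendsto_const q_lim]) (auto simp: Q0 Qq)
  have Q_cont: "continuous (at_right s) (\<lambda>s. - Q s)" for s
    unfolding continuous_within
  proof (intro tendsto_minus order_tendstoI)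
    fix a assume "a < Q s"
    then obtain z where z: "s < z" "a < q z"
      unfolding Q_def using less_cSUP_iff[OF ne bdd] by auto
    have "a < Q t" if "t \<in> {s<..<z}" for t
      using qQ[of t z] that z by simp
    then show "eventually (\<lambda>t. a < Q t) (at_right s)"
      by (rule eventually_at_rightI[OF _ z(1)])
  next
    fix a assume "Q s < a"
    then show "eventually (\<lambda>t. Q t < a) (at_right s)"
      using Q_anti by (intro eventually_at_rightI[of s "s+1"]) (auto intro: le_less_trans less_imp_le)
  qed
  define N where "N = interval_measure (\<lambda>s. - Q s)"
  have N_Ioc: "emeasure N {a<..b} = ennreal (Q a - Q b)" if "a \<le> b" for a b
    unfolding N_def using that Q_anti Q_cont by (subst emeasure_interval_measure_Ioc) auto
  have setsN[measurable_cong]: "sets N = sets borel" and spaceN: "space N = UNIV"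
    by (auto simp: N_def)
  have N_Ioi: "emeasure N {s<..} = ennreal (Q s)" for s
  proof -
    have "(\<lambda>n. emeasure N {s<..s + real n}) \<longlonglongrightarrow> emeasure N (\<Union>n. {s<..s + real n})"
      by (rule Lim_emeasure_incseq) (auto simp: incseq_def setsN)
    also have "(\<Union>n. {s<..s + real n}) = {s<..}"
      by auto (metis add.commute diff_le_eq real_arch_simple)
    finally have "(\<lambda>n. ennreal (Q s - Q (s + real n))) \<longlonglongrightarrow> emeasure N {s<..}"
      by (simp add: N_Ioc)
    moreover have "(\<lambda>n. ennreal (Q s - Q (s + real n))) \<longlonglongrightarrow> ennreal (Q s - 0)"
      by (intro tendsto_intros filterlim_compose[OF Q_lim]
          filterlim_tendsto_add_at_top[OF tendsto_const filterlim_real_sequentially])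
    ultimately show ?thesis
      using LIMSEQ_unique by fastforce
  qed
  have N_Ici: "ennreal (q s) \<le> emeasure N {s..}" for s
  proof -
    have "(\<lambda>n. emeasure N {s - inverse (real (Suc n))<..})
        \<longlonglongrightarrow> emeasure N (\<Inter>n. {s - inverse (real (Suc n))<..})"
    proof (rule Lim_emeasure_decseq)
      show "decseq (\<lambda>n. {s - inverse (real (Suc n))<..})"
        by (auto simp: decseq_def simp: field_simps)
      show "emeasure N {s - inverse (real (Suc n))<..} \<noteq> \<infinity>" for n
        by (simp add: N_Ioi)
    qed (auto simp: setsN)
    also have "(\<Inter>n. {s - inverse (real (Suc n))<..}) = {s..}"
    proof (intro equalityI subsetI)
      fix y assume y: "y \<in> (\<Inter>n. {s - inverse (real (Suc n))<..})"
      show "y \<in> {s..}"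
      proof (rule ccontr)
        assume "y \<notin> {s..}"
        then obtain n where "inverse (real (Suc n)) < s - y"
          using reals_Archimedean[of "s - y"] by auto
        moreover have "s - inverse (real (Suc n)) < y" using y by blast
        ultimately show False by linarith
      qed
    next
      fix y assume "y \<in> {s..}"
      then have "s - inverse (real (Suc n)) < y" for n
        by (smt (verit) atLeast_iff inverse_positive_iff_positive of_nat_0_less_iff zero_less_Suc)
      then show "y \<in> (\<Inter>n. {s - inverse (real (Suc n))<..})" by auto
    qed
    finally show ?thesis
      by (rule LIMSEQ_le_const) (auto simp: N_Ioi intro!: ennreal_leI qQ)
  qed
  define \<nu> where "\<nu> = distr N borel exp"
  have sets\<nu>: "sets \<nu> = sets borel" and space\<nu>: "space \<nu> = UNIV"
    by (auto simp: \<nu>_def)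
  have em: "emeasure \<nu> A = emeasure N (exp -` A)" if "A \<in> sets borel" for A
    unfolding \<nu>_def using that by (subst emeasure_distr) (auto simp: spaceN)
  have \<nu>0: "emeasure \<nu> {..0} = 0"
    by (subst em) (auto simp: vimage_def not_le)
  have tails: "emeasure \<nu> {y<..} \<le> ennreal (p y) \<and> ennreal (p y) \<le> emeasure \<nu> {y..}" if "0 < y" for y
  proof -
    have "y < exp z \<longleftrightarrow> ln y < z" "y \<le> exp z \<longleftrightarrow> ln y \<le> z" for z
      using exp_less_cancel_iff[of "ln y" z] exp_le_cancel_iff[of "ln y" z] that by simp_all
    then have "exp -` {y<..} = {ln y<..}" "exp -` {y..} = {ln y..}"
      by auto
    moreover have "q (ln y) = p y" using that by (simp add: q_def)
    ultimately show ?thesis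
      using Qq[of "ln y"] N_Ici[of "ln y"] by (auto simp: em N_Ioi intro!: ennreal_leI)
  qed
  have "sigma_finite_measure \<nu>"
  proof (unfold_locales, intro exI conjI ballI)
    show "countable (insert {..0} (range (\<lambda>n. {inverse (real (Suc n))<..})))"
      by simp
    show "insert {..0} (range (\<lambda>n. {inverse (real (Suc n))<..})) \<subseteq> sets \<nu>"
      by (auto simp: sets\<nu>)
    show "\<Union>(insert {..0} (range (\<lambda>n. {inverse (real (Suc n))<..}))) = space \<nu>"
    proof -
      have "y \<in> {..0} \<or> (\<exists>n. inverse (real (Suc n)) < y)" for y
        using reals_Archimedean[of y] by (cases "y \<le> 0") auto
      then show ?thesis unfolding space\<nu> by blast
    qed
    show "emeasure \<nu> a \<noteq> \<infinity>" if "a \<in> insert {..0} (range (\<lambda>n. {inverse (real (Suc n))<..}))" for a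
    proof -
      have "emeasure \<nu> {inverse (real (Suc n))<..} < \<infinity>" for n
        using tails[of "inverse (real (Suc n))"] by (auto intro: le_less_trans)
      then show ?thesis using that \<nu>0 by (auto simp: less_top)
    qed
  qed
  with sets\<nu> \<nu>0 tails show ?thesis by (intro that) auto
qed

section \<open>Williamson's representation of k-monotone functions\<close>

text \<open>
  The infimum of the slopes of the chords to the left is minus the left derivative of \<open>g\<close>, and
  by convexity it dominates the slopes of the chords to the right.
\<close>
lemma convex_left_slope:
  fixes g :: "real \<Rightarrow> real"
  assumes anti: "antimono_on {0<..} g" and conv: "convex_on {0<..} g"
  obtains p where "\<And>y. 0 < y \<Longrightarrow> 0 \<le> p y" "antimono_on {0<..} p"
    "\<And>a b. 0 < a \<Longrightarrow> a \<le> b \<Longrightarrow> p b * (b - a) \<le> g a - g b \<and> g a - g b \<le> p a * (b - a)"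
proof -
  define s where "s b a = (g a - g b) / (b - a)" for a b
  define p where "p y = (INF a\<in>{0<..<y}. s y a)" for y
  have ne: "{0<..<y} \<noteq> {}" if "0 < y" for y :: real
    using that by simp
  have s0: "0 \<le> s b a" if "0 < a" "a < b" for a b
    using anti that by (auto simp: s_def monotone_on_def)
  have bdd: "bdd_below (s y ` {0<..<y})" if "0 < y" for y
    by (rule bdd_belowI[of _ 0]) (auto intro: s0)
  have p0: "0 \<le> p y" if "0 < y" for y
    unfolding p_def by (rule cINF_greatest[OF ne[OF that]]) (auto intro: s0)
  have p_le: "p b \<le> s b a" if "0 < a" "a < b" for a b
    unfolding p_def by (rule cINF_lower[OF bdd]) (auto simp: that intro: less_trans[OF that])
  have le_p: "s b a \<le> p a" if "0 < a" "a < b" for a b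
    unfolding p_def
  proof (rule cINF_greatest[OF ne[OF that(1)]])
    fix c assume "c \<in> {0<..<a}"
    then show "s b a \<le> s a c"
      using convex_on_slope_le[OF conv, of c b a] that unfolding s_def
      by (auto simp: minus_divide_right[symmetric] minus_diff_eq[symmetric, of b a] minus_diff_eq[symmetric, of a c]
          simp del: minus_diff_eq)
  qed
  have slope: "p b * (b - a) \<le> g a - g b \<and> g a - g b \<le> p a * (b - a)" if "0 < a" "a \<le> b" for a b
  proof (cases "a = b")
    case False
    with that p_le[of a b] le_p[of a b] show ?thesis
      by (auto simp: s_def field_simps)
  qed simp
  have "antimono_on {0<..} p"
  proof (rule monotone_onI)
    fix a b :: real assume "a \<in> {0<..}" "b \<in> {0<..}" "a \<le> b"
    then show "p b \<le> p a"
      using p_le[of a b] le_p[of a b] by (cases "a = b") auto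
  qed
  then show ?thesis
  proof (rule that[rotated])
    show "0 \<le> p y" if "0 < y" for y using p0[OF that] .
    show "p b * (b - a) \<le> g a - g b \<and> g a - g b \<le> p a * (b - a)" if "0 < a" "a \<le> b" for a b
      using slope[OF that] .
  qed
qed

lemma deriv_pow_uminus_deriv:
  assumes "\<And>m. m \<le> l \<Longrightarrow> (deriv ^^ m) g differentiable_on {0<..}" and "0 < x"
  shows "(deriv ^^ l) (\<lambda>x. - deriv g x) x = - (deriv ^^ Suc l) g (x::real)"
  using assms
proof (induction l arbitrary: x)
  case (Suc l)
  have "(deriv ^^ Suc l) (\<lambda>x. - deriv g x) x = deriv ((deriv ^^ l) (\<lambda>x. - deriv g x)) x"
    by simp
  also have "\<dots> = deriv (\<lambda>x. - (deriv ^^ Suc l) g x) x"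
  proof (rule deriv_cong_ev)
    have "eventually (\<lambda>y. 0 < y) (nhds x)"
      using Suc.prems(2) by (intro eventually_nhds_in_open[of "{0<..}", simplified]) auto
    then show "\<forall>\<^sub>F y in nhds x. (deriv ^^ l) (\<lambda>x. - deriv g x) y = - (deriv ^^ Suc l) g y"
      by eventually_elim (rule Suc.IH, use Suc.prems(1) in auto)
  qed simp
  also have "\<dots> = - deriv ((deriv ^^ Suc l) g) x"
  proof (rule deriv_minus)
    have "(deriv ^^ Suc l) g differentiable at x within {0<..}"
      using Suc.prems(1)[of "Suc l"] Suc.prems(2) by (simp add: differentiable_on_def)
    then have "(deriv ^^ Suc l) g differentiable at x"
      using Suc.prems(2) by (simp add: at_within_open[of x "{0<..}"])
    then show "(deriv ^^ Suc l) g field_differentiable at x"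
      by (metis field_differentiable_def real_differentiable_def)
  qed
  finally show ?case by simp
qed simp

lemma convex_on_transform:
  assumes "convex_on S f" "\<And>x. x \<in> S \<Longrightarrow> f x = g x"
  shows "convex_on S g"
  unfolding convex_on_def
proof (intro conjI ballI allI impI)
  show S: "convex S" using assms(1) by (rule convex_on_imp_convex)
  fix x y and u v :: real assume *: "x \<in> S" "y \<in> S" "0 \<le> u" "0 \<le> v" "u + v = 1"
  then have "f (u *\<^sub>R x + v *\<^sub>R y) \<le> u * f x + v * f y"
    using assms(1) by (simp add: convex_on_def)
  moreover have "u *\<^sub>R x + v *\<^sub>R y \<in> S"
    using S * by (simp add: convex_def)
  ultimately show "g (u *\<^sub>R x + v *\<^sub>R y) \<le> u * g x + v * g y"
    using * by (simp add: assms(2))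
qed

lemma k_monotone_nonneg:
  assumes "k_monotone k g" "0 < x" shows "0 \<le> g x"
  using assms by (auto simp: k_monotone_def split: enat.splits if_splits dest: spec[of _ 0])

lemma differentiable_on_pos:
  fixes f :: "real \<Rightarrow> real"
  assumes "f differentiable_on {0<..}" "0 < x"
  shows "f differentiable at x"
proof -
  have "f differentiable at x within {0<..}"
    using assms by (simp add: differentiable_on_def)
  then show ?thesis
    using assms(2) by (simp add: at_within_open[of x "{0<..}"])
qed

lemma k_monotone_antimono:
  assumes "k_monotone k g" shows "antimono_on {0<..} g"
proof (cases k)
  case (enat j)
  then show ?thesis
    using assms by (auto simp: k_monotone_def split: if_splits dest: spec[of _ 0])
next
  case infinity
  have d: "g differentiable_on {0<..}" and s: "\<And>x. 0 < x \<Longrightarrow> deriv g x \<le> 0"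
    using assms infinity by (auto simp: k_monotone_def dest: spec[of _ 0] spec[of _ 1])
  show ?thesis
  proof (rule monotone_onI)
    fix a b :: real assume "a \<in> {0<..}" "b \<in> {0<..}" "a \<le> b"
    show "g b \<le> g a"
    proof (rule DERIV_nonpos_imp_nonincreasing[OF \<open>a \<le> b\<close>])
      fix x assume "a \<le> x" "x \<le> b"
      then have "0 < x" using \<open>a \<in> {0<..}\<close> by auto
      then have "g differentiable at x"
        by (rule differentiable_on_pos[OF d])
      then show "\<exists>y. (g has_real_derivative y) (at x) \<and> y \<le> 0"
        using s[OF \<open>0 < x\<close>] by (metis DERIV_deriv_iff_real_differentiable)
    qed
  qed
qed

text \<open>
  The inductive step of Williamson's theorem: lowering the order of monotonicity by one, with
  \<open>p\<close> the negative derivative. From order two to order one the derivative need not exist, and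
  the slope of a convex function takes its place.
\<close>
lemma k_monotone_Suc_slope:
  assumes "k_monotone (enat (Suc j)) g" "1 \<le> j"
  obtains p where "k_monotone (enat j) p"
    "\<And>a b. 0 < a \<Longrightarrow> a \<le> b \<Longrightarrow> p b * (b - a) \<le> g a - g b \<and> g a - g b \<le> p a * (b - a)"
proof (cases "j = 1")
  case True
  then have "antimono_on {0<..} g" "convex_on {0<..} g"
    using assms by (auto simp: k_monotone_def)
  from convex_left_slope[OF this] obtain p where p: "\<And>y. 0 < y \<Longrightarrow> 0 \<le> p y" "antimono_on {0<..} p"
    "\<And>a b. 0 < a \<Longrightarrow> a \<le> b \<Longrightarrow> p b * (b - a) \<le> g a - g b \<and> g a - g b \<le> p a * (b - a)"
    by metis
  then show ?thesis using True by (intro that[of p]) (auto simp: k_monotone_def)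
next
  case False
  then have j: "2 \<le> j" using assms by simp
  define p where "p x = - deriv g x" for x
  have diff: "(deriv ^^ l) g differentiable_on {0<..}" if "l < j - 1" for l
    using assms(1) that j by (auto simp: k_monotone_def)
  have sgn: "\<And>x. 0 < x \<Longrightarrow> 0 \<le> (-1) ^ l * (deriv ^^ l) g x"
    "antimono_on {0<..} (\<lambda>x. (-1) ^ l * (deriv ^^ l) g x)"
    "convex_on {0<..} (\<lambda>x. (-1) ^ l * (deriv ^^ l) g x)" if "l \<le> j - 1" for l
    using assms(1) that j by (auto simp: k_monotone_def)
  have eq: "(deriv ^^ l) p x = - (deriv ^^ Suc l) g x" if "l \<le> j - 2" "0 < x" for l x
    unfolding p_def using that j by (intro deriv_pow_uminus_deriv diff) auto
  have eq': "(-1) ^ l * (deriv ^^ l) p x = (-1) ^ Suc l * (deriv ^^ Suc l) g x"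
    if "l \<le> j - 2" "0 < x" for l x
    using eq[OF that] by simp
  have pk: "k_monotone (enat j) p"
    unfolding k_monotone_def using j
  proof (simp, intro conjI allI impI)
    fix l assume l: "l < j - 2"
    have "(\<lambda>x. - (deriv ^^ Suc l) g x) differentiable_on {0<..}"
      using diff[of "Suc l"] l by (intro differentiable_on_minus) auto
    then have d: "(\<lambda>x. - (deriv ^^ Suc l) g x) differentiable at x within {0<..}" if "0 < x" for x
      using that unfolding differentiable_on_def by blast
    have l': "l \<le> j - 2" using l by simp
    show "(deriv ^^ l) p differentiable_on {0<..}"
      unfolding differentiable_on_def
    proof
      fix x :: real assume x: "x \<in> {0<..}"
      show "(deriv ^^ l) p differentiable at x within {0<..}"
        by (rule differentiable_transform_within[OF d zero_less_one x])
           (use x eq[OF l'] in auto)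
    qed
  next
    fix l and x :: real assume l: "l \<le> j - 2" "0 < x"
    then show "0 \<le> (-1) ^ l * (deriv ^^ l) p x"
      unfolding eq'[OF l] by (intro sgn) (use j in auto)
  next
    fix l assume l: "l \<le> j - 2"
    have "antimono_on {0<..} (\<lambda>x. (-1) ^ Suc l * (deriv ^^ Suc l) g x)"
      by (intro sgn) (use j l in auto)
    then show "antimono_on {0<..} (\<lambda>x. (-1) ^ l * (deriv ^^ l) p x)"
      unfolding monotone_on_def using eq'[OF l] by simp
    have "convex_on {0<..} (\<lambda>x. (-1) ^ Suc l * (deriv ^^ Suc l) g x)"
      by (intro sgn) (use j l in auto)
    then show "convex_on {0<..} (\<lambda>x. (-1) ^ l * (deriv ^^ l) p x)"
      by (rule convex_on_transform) (use eq'[OF l] in auto)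
  qed
  have der: "(g has_real_derivative - p x) (at x)" if "0 < x" for x
  proof -
    have "g differentiable at x"
      using diff[of 0] j that by (intro differentiable_on_pos) auto
    then show ?thesis by (simp add: p_def DERIV_deriv_iff_real_differentiable)
  qed
  have anti: "p b \<le> p a" if "0 < a" "a \<le> b" for a b
    using k_monotone_antimono[OF pk] that by (auto simp: monotone_on_def)
  show ?thesis
  proof (rule that[OF pk])
    fix a b :: real assume ab: "0 < a" "a \<le> b"
    show "p b * (b - a) \<le> g a - g b \<and> g a - g b \<le> p a * (b - a)"
    proof (cases "a = b")
      case False
      then obtain z where z: "a < z" "z < b" "g b - g a = (b - a) * - p z"
        using MVT2[of a b g "\<lambda>x. - p x"] ab der by auto
      then have "g a - g b = p z * (b - a)" by (simp add: algebra_simps)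
      then show ?thesis
        using anti[of a z] anti[of z b] z ab by (auto intro: mult_right_mono)
    qed simp
  qed
qed

text \<open>
  \<open>p y\<close> is at most the decrease of \<open>g\<close> over \<open>[y - 1, y]\<close>.
\<close>
lemma slope_tendsto_0:
  fixes g p :: "real \<Rightarrow> real"
  assumes nonneg: "\<And>y. 0 < y \<Longrightarrow> 0 \<le> p y" and gnonneg: "\<And>y. 0 < y \<Longrightarrow> 0 \<le> g y"
    and slope: "\<And>a b. 0 < a \<Longrightarrow> a \<le> b \<Longrightarrow> p b * (b - a) \<le> g a - g b \<and> g a - g b \<le> p a * (b - a)"
    and lim: "(g \<longlongrightarrow> 0) at_top"
  shows "(p \<longlongrightarrow> 0) at_top"
proof (rule tendsto_sandwich[OF _ _ tendsto_const])
  show "eventually (\<lambda>y. 0 \<le> p y) at_top"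
    using eventually_gt_at_top[of 0] by eventually_elim (rule nonneg)
  show "((\<lambda>y. g (y + - 1)) \<longlongrightarrow> 0) at_top"
    using filterlim_tendsto_add_at_top[OF tendsto_const filterlim_ident, of "-1 :: real"]
    by (intro filterlim_compose[OF lim]) (simp add: add.commute)
  show "eventually (\<lambda>y. p y \<le> g (y + - 1)) at_top"
    using eventually_gt_at_top[of 1]
  proof eventually_elim
    case (elim y)
    then show ?case using slope[of "y - 1" y] gnonneg[of y] by simp
  qed
qed

lemma nn_integral_power_Ioc:
  fixes x t :: real
  shows "(\<integral>\<^sup>+y. ennreal ((t - y) ^ j / fact j) * indicator {x<..t} y \<partial>lborel)
      = ennreal ((t - x) ^ Suc j / fact (Suc j)) * indicator {x<..} t"
proof (cases "x < t")
  case True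
  have "(\<integral>\<^sup>+y. ennreal ((t - y) ^ j / fact j) * indicator {x<..t} y \<partial>lborel)
      = (\<integral>\<^sup>+y. ennreal ((t - y) ^ j / fact j) * indicator {x..t} y \<partial>lborel)"
    by (rule nn_integral_cong_AE)
       (use AE_lborel_singleton[of x] in eventually_elim, auto split: split_indicator)
  also have "\<dots> = ennreal (- ((t - t) ^ Suc j) / fact (Suc j) - (- ((t - x) ^ Suc j) / fact (Suc j)))"
  proof (rule nn_integral_FTC_Icc[where F="\<lambda>y. - ((t - y) ^ Suc j) / fact (Suc j)"])
    fix y assume "y \<in> {x..t}"
    have "((\<lambda>y. (t - y) ^ Suc j) has_real_derivative (1 + real j) * ((0 - 1) * (t - y) ^ j)) (at y)"
      by (intro DERIV_power_Suc derivative_intros)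
    from DERIV_cdivide[OF DERIV_minus[OF this], of "fact (Suc j)"]
    have "((\<lambda>y. - ((t - y) ^ Suc j) / fact (Suc j)) has_real_derivative
        - ((1 + real j) * ((0 - 1) * (t - y) ^ j)) / fact (Suc j)) (at y)" .
    also have "- ((1 + real j) * ((0 - 1) * (t - y) ^ j)) / fact (Suc j) = (t - y) ^ j / fact j"
      by (simp add: divide_simps)
    finally show "((\<lambda>y. - ((t - y) ^ Suc j) / fact (Suc j)) has_real_derivative (t - y) ^ j / fact j) (at y)" .
  qed (use True in auto)
  finally show ?thesis using True by simp
next
  case False
  then show ?thesis by (auto split: split_indicator)
qed

text \<open>
  Induction on the order, integrating the representation of the slope \<open>p\<close> and exchanging the
  integrals; the measure \<open>\<nu>\<close> stays the same throughout. The indicators \<open>{x<..}\<close> and \<open>{x..}\<close>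
  matter only for \<open>j = 0\<close>, where \<open>\<nu>\<close> may charge \<open>x\<close>. A single integration over \<open>y\<close> makes the
  two bounds meet, because the points \<open>y = t\<close> form a Lebesgue null set.
\<close>
theorem williamson_power_kernels:
  assumes "k_monotone (enat (Suc j)) g" "(g \<longlongrightarrow> 0) at_top"
  obtains \<nu> where "sets \<nu> = sets borel" "sigma_finite_measure \<nu>" "emeasure \<nu> {..0} = 0"
    "\<And>x. 0 < x \<Longrightarrow> (\<integral>\<^sup>+t. ennreal ((t - x) ^ j / fact j) * indicator {x<..} t \<partial>\<nu>) \<le> ennreal (g x)"
    "\<And>x. 0 < x \<Longrightarrow> ennreal (g x) \<le> (\<integral>\<^sup>+t. ennreal ((t - x) ^ j / fact j) * indicator {x..} t \<partial>\<nu>)"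
proof -
  have "\<exists>\<nu>. sets \<nu> = sets borel \<and> sigma_finite_measure \<nu> \<and> emeasure \<nu> {..0} = 0 \<and>
    (\<forall>x>0. (\<integral>\<^sup>+t. ennreal ((t - x) ^ j / fact j) * indicator {x<..} t \<partial>\<nu>) \<le> ennreal (g x) \<and>
           ennreal (g x) \<le> (\<integral>\<^sup>+t. ennreal ((t - x) ^ j / fact j) * indicator {x..} t \<partial>\<nu>))"
    using assms
  proof (induction j arbitrary: g)
    case 0
    then have "\<And>y. 0 < y \<Longrightarrow> 0 \<le> g y" "antimono_on {0<..} g"
      by (auto intro: k_monotone_nonneg k_monotone_antimono)
    from tail_measure_exists[OF this 0(2)] obtain \<nu> where \<nu>: "sets \<nu> = sets borel" "sigma_finite_measure \<nu>"
      "emeasure \<nu> {..0} = 0"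
      "\<And>y. 0 < y \<Longrightarrow> emeasure \<nu> {y<..} \<le> ennreal (g y) \<and> ennreal (g y) \<le> emeasure \<nu> {y..}"
      by metis
    then show ?case by (intro exI[of _ \<nu>]) auto
  next
    case (Suc j)
    let ?k = "\<lambda>x t :: real. ennreal ((t - x) ^ j / fact j)"
    let ?k1 = "\<lambda>x t :: real. ennreal ((t - x) ^ Suc j / fact (Suc j))"
    obtain p where p: "k_monotone (enat (Suc j)) p"
      "\<And>a b. 0 < a \<Longrightarrow> a \<le> b \<Longrightarrow> p b * (b - a) \<le> g a - g b \<and> g a - g b \<le> p a * (b - a)"
      using k_monotone_Suc_slope[OF Suc.prems(1)] by auto
    note p0 = k_monotone_nonneg[OF p(1)] and g0 = k_monotone_nonneg[OF Suc.prems(1)]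
    have "(p \<longlongrightarrow> 0) at_top"
      by (rule slope_tendsto_0[OF p0 g0 p(2) Suc.prems(2)])
    from Suc.IH[OF p(1) this] obtain \<nu> where \<nu>: "sets \<nu> = sets borel" "sigma_finite_measure \<nu>"
      "emeasure \<nu> {..0} = 0"
      "\<And>x. 0 < x \<Longrightarrow> (\<integral>\<^sup>+t. ?k x t * indicator {x<..} t \<partial>\<nu>) \<le> ennreal (p x)"
      "\<And>x. 0 < x \<Longrightarrow> ennreal (p x) \<le> (\<integral>\<^sup>+t. ?k x t * indicator {x..} t \<partial>\<nu>)"
      by blast
    interpret \<nu>: sigma_finite_measure \<nu> by fact
    interpret pair_sigma_finite \<nu> lborel ..
    note [measurable_cong] = \<nu>(1)
    let ?closed = "\<lambda>y. \<integral>\<^sup>+t. ?k y t * indicator {y..} t \<partial>\<nu>"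
    let ?open = "\<lambda>y. \<integral>\<^sup>+t. ?k y t * indicator {y<..} t \<partial>\<nu>"
    let ?C = "\<lambda>x. \<integral>\<^sup>+y. ?closed y * indicator {x<..} y \<partial>lborel"
    let ?O = "\<lambda>x. \<integral>\<^sup>+y. ?open y * indicator {x<..} y \<partial>lborel"
    let ?p = "\<lambda>x. \<integral>\<^sup>+y. ennreal (p y) * indicator {x<..} y \<partial>lborel"
    let ?next = "\<lambda>x. \<integral>\<^sup>+t. ?k1 x t * indicator {x<..} t \<partial>\<nu>"
    \<comment> \<open>Both bounds on \<open>p\<close> integrate to the same kernel of the next order.\<close>
    have fubini: "(\<integral>\<^sup>+y. (\<integral>\<^sup>+t. ?k y t * indicator (A y) t \<partial>\<nu>) * indicator {x<..} y \<partial>lborel) = ?next x"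
      if A: "A = atLeast \<or> A = greaterThan" for A x
    proof -
      have m: "(\<lambda>(t, y). ?k y t * (if x < y \<and> t \<in> A y then 1 else 0)) \<in> borel_measurable (\<nu> \<Otimes>\<^sub>M lborel)"
        using A by (elim disjE; simp; measurable)
      have "(\<integral>\<^sup>+y. (\<integral>\<^sup>+t. ?k y t * indicator (A y) t \<partial>\<nu>) * indicator {x<..} y \<partial>lborel)
        = (\<integral>\<^sup>+y. (\<integral>\<^sup>+t. ?k y t * (if x < y \<and> t \<in> A y then 1 else 0) \<partial>\<nu>) \<partial>lborel)"
        using A by (intro nn_integral_cong, subst nn_integral_multc[symmetric])
           (auto intro!: nn_integral_cong split: split_indicator)
      also have "\<dots> = (\<integral>\<^sup>+t. (\<integral>\<^sup>+y. ?k y t * (if x < y \<and> t \<in> A y then 1 else 0) \<partial>lborel) \<partial>\<nu>)"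
        by (rule Fubini'[OF m])
      also have "\<dots> = (\<integral>\<^sup>+t. (\<integral>\<^sup>+y. ?k y t * indicator {x<..t} y \<partial>lborel) \<partial>\<nu>)"
      proof (rule nn_integral_cong, rule nn_integral_cong_AE)
        fix t
        show "AE y in lborel. ?k y t * (if x < y \<and> t \<in> A y then 1 else 0) = ?k y t * indicator {x<..t} y"
          using AE_lborel_singleton[of t] by eventually_elim (use A in \<open>auto split: split_indicator\<close>)
      qed
      finally show ?thesis by (simp only: nn_integral_power_Ioc)
    qed
    have fubini_closed: "?C x = ?next x" and fubini_open: "?O x = ?next x" for x
      using fubini[of atLeast x] fubini[of greaterThan x] by simp_all
    have g_eq: "ennreal (g x) = ?next x" if "0 < x" for x
    proof -
      have e: "ennreal (g x) = ?p x"
        by (rule integral_of_slope_bound[OF p0 k_monotone_antimono[OF p(1)] p(2) Suc.prems(2) that])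
      have u: "?p x \<le> ?C x"
        using \<nu>(5) that by (intro nn_integral_mono) (auto split: split_indicator)
      have l: "?O x \<le> ?p x"
        using \<nu>(4) that by (intro nn_integral_mono) (auto split: split_indicator)
      show ?thesis
        unfolding e by (rule antisym[OF u[unfolded fubini_closed] l[unfolded fubini_open]])
    qed
    show ?case
    proof (rule exI[of _ \<nu>], intro conjI allI impI \<nu>(1-3))
      fix x :: real assume x: "0 < x"
      show "ennreal (g x) \<le> (\<integral>\<^sup>+t. ?k1 x t * indicator {x..} t \<partial>\<nu>)"
        unfolding g_eq[OF x] by (intro nn_integral_mono) (auto split: split_indicator)
      show "?next x \<le> ennreal (g x)"
        unfolding g_eq[OF x] ..
    qed
  qed
  then obtain \<nu> where \<nu>: "sets \<nu> = sets borel" "sigma_finite_measure \<nu>" "emeasure \<nu> {..0} = 0"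
    "\<forall>x>0. (\<integral>\<^sup>+t. ennreal ((t - x) ^ j / fact j) * indicator {x<..} t \<partial>\<nu>) \<le> ennreal (g x) \<and>
      ennreal (g x) \<le> (\<integral>\<^sup>+t. ennreal ((t - x) ^ j / fact j) * indicator {x..} t \<partial>\<nu>)"
    by (elim exE conjE)
  then show ?thesis
    by (intro that[OF \<nu>(1-3)]) simp_all
qed

lemma trunc_pow_nonneg: "0 \<le> trunc_pow y j"
  by (simp add: trunc_pow_def)

lemma mix_kernel_nonneg: "0 < t \<Longrightarrow> 0 \<le> mix_kernel k t x"
  by (auto simp: mix_kernel_def trunc_pow_nonneg split: enat.split)

lemma mix_kernel_Suc:
  "mix_kernel (enat (Suc i)) t x = (if x \<le> t then real (Suc i) * (t - x) ^ i / t ^ Suc i else 0)"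
  by (auto simp: mix_kernel_def trunc_pow_def max_def)

lemma measurable_mix_kernel[measurable]:
  assumes [measurable]: "f \<in> borel_measurable M" "g \<in> borel_measurable M"
  shows "(\<lambda>z. mix_kernel k (f z) (g z)) \<in> borel_measurable M"
proof (cases k)
  case (enat j)
  then show ?thesis
    by (cases j) (simp_all add: mix_kernel_Suc mix_kernel_def[of "enat 0"])
next
  case infinity
  then show ?thesis by (simp add: mix_kernel_def)
qed

lemma space_lebesgue_pos: "space lebesgue_pos = {0<..}"
  by (simp add: lebesgue_pos_def space_restrict_space)

lemma nn_integral_lebesgue_pos:
  "(\<integral>\<^sup>+x. f x \<partial>lebesgue_pos) = (\<integral>\<^sup>+x. f x * indicator {0<..} x \<partial>lborel)"
  unfolding lebesgue_pos_def by (rule nn_integral_restrict_space) simp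

text \<open>
  The boundary point \<open>x = t\<close> is left out so that the lower bound in Williamson's theorem for
  \<open>k = 1\<close> has full mass, too.
\<close>
lemma nn_integral_mix_kernel_open:
  assumes "0 < t"
  shows "(\<integral>\<^sup>+x. ennreal (mix_kernel (enat (Suc i)) t x) * indicator {0<..<t} x \<partial>lborel) = 1"
proof -
  define c where "c = real (Suc i) * fact i / t ^ Suc i"
  have "(\<integral>\<^sup>+x. ennreal (mix_kernel (enat (Suc i)) t x) * indicator {0<..<t} x \<partial>lborel)
      = (\<integral>\<^sup>+x. ennreal c * (ennreal ((t - x) ^ i / fact i) * indicator {0<..t} x) \<partial>lborel)"
  proof (rule nn_integral_cong_AE)
    show "AE x in lborel. ennreal (mix_kernel (enat (Suc i)) t x) * indicator {0<..<t} x
      = ennreal c * (ennreal ((t - x) ^ i / fact i) * indicator {0<..t} x)"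
      using AE_lborel_singleton[of t]
    proof eventually_elim
      case (elim x)
      have "0 \<le> c" using assms by (simp add: c_def)
      then have "ennreal (mix_kernel (enat (Suc i)) t x) = ennreal c * ennreal ((t - x) ^ i / fact i)" if "x < t"
        using that by (simp add: mix_kernel_Suc c_def del: of_nat_Suc flip: ennreal_mult')
      then show ?case
        using elim by (auto split: split_indicator)
    qed
  qed
  also have "\<dots> = ennreal c * (\<integral>\<^sup>+x. ennreal ((t - x) ^ i / fact i) * indicator {0<..t} x \<partial>lborel)"
    by (rule nn_integral_cmult) measurable
  also have "\<dots> = ennreal c * ennreal (t ^ Suc i / fact (Suc i))"
    using assms by (simp add: nn_integral_power_Ioc del: fact_Suc power_Suc)
  also have "\<dots> = ennreal (c * (t ^ Suc i / fact (Suc i)))"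
    using assms by (intro ennreal_mult[symmetric]) (auto simp: c_def)
  also have "c * (t ^ Suc i / fact (Suc i)) = 1"
    using assms by (simp add: c_def fact_Suc del: power_Suc of_nat_Suc)
  finally show ?thesis by simp
qed

lemma nn_integral_mix_kernel:
  assumes "0 < t" "1 \<le> k"
  shows "(\<integral>\<^sup>+x. ennreal (mix_kernel k t x) * indicator {0<..} x \<partial>lborel) = 1"
proof (cases k)
  case (enat j)
  then obtain i where i: "k = enat (Suc i)"
    using assms(2) by (cases j) (auto simp: one_enat_def)
  have "(\<integral>\<^sup>+x. ennreal (mix_kernel k t x) * indicator {0<..} x \<partial>lborel)
    = (\<integral>\<^sup>+x. ennreal (mix_kernel k t x) * indicator {0<..<t} x \<partial>lborel)"
    by (rule nn_integral_cong_AE)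
       (use AE_lborel_singleton[of t] in eventually_elim, auto simp: i mix_kernel_Suc split: split_indicator)
  then show ?thesis
    using nn_integral_mix_kernel_open[OF assms(1)] i by simp
next
  case infinity
  have "(\<integral>\<^sup>+x. ennreal (mix_kernel k t x) * indicator {0<..} x \<partial>lborel)
    = (\<integral>\<^sup>+x. ennreal (exp (- x / t) / t) * indicator {0..} x \<partial>lborel)"
    by (rule nn_integral_cong_AE)
       (use AE_lborel_singleton[of 0] in eventually_elim,
        auto simp: infinity mix_kernel_def split: split_indicator)
  also have "\<dots> = ennreal (0 - - exp (- 0 / t))"
  proof (rule nn_integral_FTC_atLeast)
    show "((\<lambda>x. - exp (- x / t)) has_real_derivative exp (- x / t) / t) (at x)" for x
      using assms by (auto intro!: derivative_eq_intros)
    have "((\<lambda>x. - exp (- x / t)) \<longlongrightarrow> - 0) at_top"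
      using assms filterlim_tendsto_pos_mult_at_top[OF tendsto_const _ filterlim_ident, of "1 / t"]
      by (intro tendsto_minus filterlim_compose[OF exp_at_bot]) (auto simp: filterlim_uminus_at_bot)
    then show "((\<lambda>x. - exp (- x / t)) \<longlongrightarrow> 0) at_top" by simp
  qed (use assms in auto)
  finally show ?thesis by simp
qed

text \<open>
  A mixing distribution up to its total mass, which is left free so that vague limits that have
  lost mass, and integrable functions that are not densities, are covered.
\<close>
definition mixing_measure :: "real measure \<Rightarrow> bool" where
  "mixing_measure \<nu> \<longleftrightarrow> finite_measure \<nu> \<and> sets \<nu> = sets borel \<and> emeasure \<nu> {..0} = 0"

definition mixture :: "enat \<Rightarrow> real measure \<Rightarrow> real \<Rightarrow> ennreal" where
  "mixture k \<nu> x = (\<integral>\<^sup>+t. ennreal (mix_kernel k t x) \<partial>\<nu>)"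

lemma AE_pos:
  assumes "sets \<nu> = sets borel" "emeasure \<nu> {..0} = 0"
  shows "AE t in \<nu>. 0 < (t::real)"
  by (rule AE_I[of _ _ "{..0}"]) (use assms in \<open>auto simp: not_less\<close>)

text \<open>
  Tonelli. The kernel is arbitrary because for \<open>k = 1\<close> the mass has to be computed with the
  kernel for \<open>x < t\<close> as well as with the one for \<open>x \<le> t\<close>.
\<close>
lemma mass_of_kernel_mixture:
  fixes \<kappa> :: "real \<Rightarrow> real \<Rightarrow> ennreal"
  assumes "sigma_finite_measure \<nu>" "sets \<nu> = sets borel" "emeasure \<nu> {..0} = 0"
    and [measurable]: "case_prod \<kappa> \<in> borel_measurable (borel \<Otimes>\<^sub>M borel)"
    and one: "\<And>t. 0 < t \<Longrightarrow> (\<integral>\<^sup>+x. \<kappa> t x * indicator {0<..} x \<partial>lborel) = 1"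
  shows "(\<integral>\<^sup>+x. (\<integral>\<^sup>+t. \<kappa> t x \<partial>\<nu>) \<partial>lebesgue_pos) = emeasure \<nu> UNIV"
proof -
  interpret sigma_finite_measure \<nu> by fact
  interpret pair_sigma_finite \<nu> lborel ..
  note [measurable_cong] = assms(2)
  have "space \<nu> = UNIV" using sets_eq_imp_space_eq[OF assms(2)] by simp
  have "(\<integral>\<^sup>+x. (\<integral>\<^sup>+t. \<kappa> t x \<partial>\<nu>) \<partial>lebesgue_pos)
      = (\<integral>\<^sup>+x. (\<integral>\<^sup>+t. \<kappa> t x * indicator {0<..} x \<partial>\<nu>) \<partial>lborel)"
    unfolding nn_integral_lebesgue_pos by (intro nn_integral_cong nn_integral_multc[symmetric]) measurable
  also have "\<dots> = (\<integral>\<^sup>+t. (\<integral>\<^sup>+x. \<kappa> t x * indicator {0<..} x \<partial>lborel) \<partial>\<nu>)"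
    by (rule Fubini') measurable
  also have "\<dots> = (\<integral>\<^sup>+t. 1 \<partial>\<nu>)"
    by (rule nn_integral_cong_AE) (use AE_pos[OF assms(2,3)] in eventually_elim, auto simp: one)
  finally show ?thesis using \<open>space \<nu> = UNIV\<close> by simp
qed

lemma mass_of_mixture:
  assumes "mixing_measure \<nu>" "1 \<le> k"
  shows "(\<integral>\<^sup>+x. mixture k \<nu> x \<partial>lebesgue_pos) = emeasure \<nu> UNIV"
proof -
  have "sigma_finite_measure \<nu>"
    using assms(1) by (auto simp: mixing_measure_def finite_measure_def)
  then show ?thesis
    unfolding mixture_def
    using assms by (intro mass_of_kernel_mixture) (auto simp: mixing_measure_def nn_integral_mix_kernel)
qed

lemma nn_integral_k_monotone_L1:
  assumes "g \<in> k_monotone_L1 k"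
  shows "(\<integral>\<^sup>+x. ennreal (g x) \<partial>lebesgue_pos) = ennreal (LINT x|lebesgue_pos. g x)"
  using assms
  by (intro nn_integral_eq_integral AE_I2)
     (auto simp: k_monotone_L1_def k_monotone_class_def space_lebesgue_pos intro: k_monotone_nonneg)

lemma integral_k_monotone_L1_nonneg:
  assumes "g \<in> k_monotone_L1 k" shows "0 \<le> (LINT x|lebesgue_pos. g x)"
  using assms
  by (intro integral_nonneg_AE AE_I2)
     (auto simp: k_monotone_L1_def k_monotone_class_def space_lebesgue_pos intro: k_monotone_nonneg)

text \<open>
  A nonincreasing \<open>g\<close> is at least \<open>g x\<close> on \<open>(0, x]\<close>.
\<close>
lemma k_monotone_L1_le:
  assumes g: "g \<in> k_monotone_L1 k" and "0 < x"
  shows "g x \<le> (LINT x|lebesgue_pos. g x) / x"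
proof -
  have k: "k_monotone k g" using g by (simp add: k_monotone_L1_def k_monotone_class_def)
  have "ennreal (g x * x) = (\<integral>\<^sup>+y. ennreal (g x) * indicator {0<..x} y \<partial>lborel)"
    using \<open>0 < x\<close> k_monotone_nonneg[OF k] by (simp add: nn_integral_cmult_indicator ennreal_mult)
  also have "\<dots> \<le> (\<integral>\<^sup>+y. ennreal (g y) * indicator {0<..} y \<partial>lborel)"
    using k_monotone_antimono[OF k] \<open>0 < x\<close>
    by (intro nn_integral_mono) (auto split: split_indicator simp: monotone_on_def intro!: ennreal_leI)
  also have "\<dots> = ennreal (LINT x|lebesgue_pos. g x)"
    using nn_integral_k_monotone_L1[OF g] by (simp add: nn_integral_lebesgue_pos)
  finally have "g x * x \<le> (LINT x|lebesgue_pos. g x)"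
    using integral_k_monotone_L1_nonneg[OF g] by simp
  then show ?thesis using \<open>0 < x\<close> by (simp add: field_simps)
qed

lemma k_monotone_L1_tendsto_0:
  assumes g: "g \<in> k_monotone_L1 k"
  shows "(g \<longlongrightarrow> 0) at_top"
proof (rule tendsto_sandwich[OF _ _ tendsto_const])
  have k: "k_monotone k g" using g by (simp add: k_monotone_L1_def k_monotone_class_def)
  show "\<forall>\<^sub>F x in at_top. 0 \<le> g x"
    using eventually_gt_at_top[of 0] by eventually_elim (rule k_monotone_nonneg[OF k])
  show "\<forall>\<^sub>F x in at_top. g x \<le> (LINT x|lebesgue_pos. g x) / x"
    using eventually_gt_at_top[of 0] by eventually_elim (rule k_monotone_L1_le[OF g])
  show "((\<lambda>x. (LINT x|lebesgue_pos. g x) / x) \<longlongrightarrow> 0) at_top"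
    by (intro tendsto_divide_0[OF tendsto_const] filterlim_at_top_imp_at_infinity filterlim_ident)
qed

text \<open>
  Normalising the power kernels to probability densities turns the measure \<open>\<nu>0\<close> into one with
  density \<open>t ^ Suc i / fact (Suc i)\<close>. Its mass lies between the integrals of the two bounds on
  \<open>g\<close>, and these agree. Equality at \<open>x\<close> can only fail for \<open>i = 0\<close>, that is \<open>k = 1\<close>, at a jump
  of \<open>g\<close>.
\<close>
theorem williamson:
  assumes g: "g \<in> k_monotone_L1 (enat (Suc i))"
  obtains \<nu> where "mixing_measure \<nu>" "emeasure \<nu> UNIV = ennreal (LINT x|lebesgue_pos. g x)"
    "\<And>x. 0 < x \<Longrightarrow> ennreal (g x) \<le> mixture (enat (Suc i)) \<nu> x"
    "\<And>x. 0 < x \<Longrightarrow> i \<noteq> 0 \<or> emeasure \<nu> {x} = 0 \<Longrightarrow> ennreal (g x) = mixture (enat (Suc i)) \<nu> x"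
proof -
  let ?P = "\<lambda>t x :: real. ennreal ((t - x) ^ i / fact i)"
  let ?K = "\<lambda>t x. ennreal (mix_kernel (enat (Suc i)) t x)"
  have k: "k_monotone (enat (Suc i)) g" using g by (simp add: k_monotone_L1_def k_monotone_class_def)
  obtain \<nu>0 where \<nu>0: "sets \<nu>0 = sets borel" "sigma_finite_measure \<nu>0" "emeasure \<nu>0 {..0} = 0"
    "\<And>x. 0 < x \<Longrightarrow> (\<integral>\<^sup>+t. ?P t x * indicator {x<..} t \<partial>\<nu>0) \<le> ennreal (g x)"
    "\<And>x. 0 < x \<Longrightarrow> ennreal (g x) \<le> (\<integral>\<^sup>+t. ?P t x * indicator {x..} t \<partial>\<nu>0)"
    using williamson_power_kernels[OF k k_monotone_L1_tendsto_0[OF g]] by blast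
  note [measurable_cong] = \<nu>0(1)
  interpret \<nu>0: sigma_finite_measure \<nu>0 by fact
  define d where "d t = t ^ Suc i / fact (Suc i)" for t :: real
  have [measurable]: "d \<in> borel_measurable borel" unfolding d_def by measurable
  define \<nu> where "\<nu> = density \<nu>0 (\<lambda>t. ennreal (d t))"
  let ?mix = "mixture (enat (Suc i)) \<nu>"
  have sets\<nu>[measurable_cong]: "sets \<nu> = sets borel" by (simp add: \<nu>_def \<nu>0(1))
  have space\<nu>: "space \<nu> = UNIV" using sets_eq_imp_space_eq[OF sets\<nu>] by simp
  have sf: "sigma_finite_measure \<nu>"
    unfolding \<nu>_def by (subst \<nu>0.sigma_finite_iff_density_finite) auto
  have "AE t in \<nu>0. t \<notin> {..0}"
    using AE_pos[OF \<nu>0(1,3)] by eventually_elim auto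
  then have \<nu>_neg: "emeasure \<nu> {..0} = 0"
    unfolding \<nu>_def by (subst emeasure_density) (auto simp: nn_integral_0_iff_AE split: split_indicator)
  have kernel: "ennreal (d t) * ?K t x = ?P t x * indicator {x..} t" if "0 < t" for t x
  proof (cases "x \<le> t")
    case True
    have "d t * mix_kernel (enat (Suc i)) t x = (t - x) ^ i / fact i"
      using True that by (simp add: mix_kernel_Suc d_def fact_Suc del: power_Suc of_nat_Suc)
    moreover have "0 \<le> d t" using that by (simp add: d_def)
    ultimately show ?thesis
      using True ennreal_mult'[of "d t" "mix_kernel (enat (Suc i)) t x"] by simp
  qed (simp add: mix_kernel_Suc)
  have mix: "(\<integral>\<^sup>+t. ?K t x * indicator A t \<partial>\<nu>) = (\<integral>\<^sup>+t. ?P t x * indicator {x..} t * indicator A t \<partial>\<nu>0)"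
    if [measurable]: "A \<in> sets borel" for x A
  proof -
    have "(\<integral>\<^sup>+t. ?K t x * indicator A t \<partial>\<nu>) = (\<integral>\<^sup>+t. ennreal (d t) * (?K t x * indicator A t) \<partial>\<nu>0)"
      unfolding \<nu>_def by (rule nn_integral_density) measurable
    also have "\<dots> = (\<integral>\<^sup>+t. ?P t x * indicator {x..} t * indicator A t \<partial>\<nu>0)"
      by (rule nn_integral_cong_AE)
         (use AE_pos[OF \<nu>0(1,3)] in eventually_elim, simp only: kernel mult.assoc[symmetric])
    finally show ?thesis .
  qed
  have upper: "ennreal (g x) \<le> ?mix x" if "0 < x" for x
    using \<nu>0(5)[OF that] mix[of UNIV x] by (simp add: mixture_def)
  have lower: "(\<integral>\<^sup>+t. ?K t x * indicator {x<..} t \<partial>\<nu>) \<le> ennreal (g x)" if "0 < x" for x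
  proof -
    have "(\<integral>\<^sup>+t. ?K t x * indicator {x<..} t \<partial>\<nu>) = (\<integral>\<^sup>+t. ?P t x * indicator {x<..} t \<partial>\<nu>0)"
      by (subst mix) (auto intro!: nn_integral_cong split: split_indicator)
    with \<nu>0(4)[OF that] show ?thesis by simp
  qed
  have mass1: "(\<integral>\<^sup>+x. ?mix x \<partial>lebesgue_pos) = emeasure \<nu> UNIV"
    unfolding mixture_def
    by (rule mass_of_kernel_mixture[OF sf sets\<nu> \<nu>_neg]) (auto simp: nn_integral_mix_kernel one_enat_def)
  have mass2: "(\<integral>\<^sup>+x. (\<integral>\<^sup>+t. ?K t x * (if x < t then 1 else 0) \<partial>\<nu>) \<partial>lebesgue_pos) = emeasure \<nu> UNIV"
  proof (rule mass_of_kernel_mixture[OF sf sets\<nu> \<nu>_neg])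
    fix t :: real assume t: "0 < t"
    have "(\<integral>\<^sup>+x. ?K t x * (if x < t then 1 else 0) * indicator {0<..} x \<partial>lborel)
      = (\<integral>\<^sup>+x. ?K t x * indicator {0<..<t} x \<partial>lborel)"
      by (intro nn_integral_cong) (auto split: split_indicator)
    then show "(\<integral>\<^sup>+x. ?K t x * (if x < t then 1 else 0) * indicator {0<..} x \<partial>lborel) = 1"
      using nn_integral_mix_kernel_open[OF t] by simp
  qed measurable
  have "emeasure \<nu> UNIV \<le> (\<integral>\<^sup>+x. ennreal (g x) \<partial>lebesgue_pos)"
    unfolding mass2[symmetric]
  proof (rule nn_integral_mono)
    fix x assume "x \<in> space lebesgue_pos"
    then have x: "0 < x" by (simp add: space_lebesgue_pos)
    have "(\<integral>\<^sup>+t. ?K t x * (if x < t then 1 else 0) \<partial>\<nu>) = (\<integral>\<^sup>+t. ?K t x * indicator {x<..} t \<partial>\<nu>)"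
      by (intro nn_integral_cong) (auto split: split_indicator)
    then show "(\<integral>\<^sup>+t. ?K t x * (if x < t then 1 else 0) \<partial>\<nu>) \<le> ennreal (g x)"
      using lower[OF x] by simp
  qed
  moreover have "(\<integral>\<^sup>+x. ennreal (g x) \<partial>lebesgue_pos) \<le> emeasure \<nu> UNIV"
    unfolding mass1[symmetric] by (rule nn_integral_mono) (simp add: space_lebesgue_pos upper)
  ultimately have mass: "emeasure \<nu> UNIV = ennreal (LINT x|lebesgue_pos. g x)"
    using nn_integral_k_monotone_L1[OF g] by simp
  have "mixing_measure \<nu>"
    unfolding mixing_measure_def using mass
    by (auto simp: sets\<nu> \<nu>_neg space\<nu> intro!: finite_measureI)
  moreover have "ennreal (g x) = ?mix x"
    if x: "0 < x" and c: "i \<noteq> 0 \<or> emeasure \<nu> {x} = 0" for x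
  proof (rule antisym[OF upper[OF x]])
    have "?mix x = (\<integral>\<^sup>+t. ?K t x * indicator {x<..} t \<partial>\<nu>)"
      unfolding mixture_def
    proof (rule nn_integral_cong_AE)
      have "AE t in \<nu>. i = 0 \<longrightarrow> t \<noteq> x"
        using c by (cases "i = 0") (auto intro!: AE_I[of _ _ "{x}"] simp: sets\<nu>)
      then show "AE t in \<nu>. ?K t x = ?K t x * indicator {x<..} t"
        by eventually_elim (auto simp: mix_kernel_Suc power_0_left split: split_indicator)
    qed
    then show "?mix x \<le> ennreal (g x)"
      using lower[OF x] by simp
  qed
  ultimately show ?thesis
    using mass upper by (intro that[of \<nu>]) auto
qed

section \<open>Compactness of mixing measures and limits of maximizing sequences\<close>

text \<open>
  The substitution \<open>u = t / (1 + t)\<close> compactifies \<open>(0, \<infinity>)\<close> to \<open>[0, 1]\<close>. A function dominated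
  by \<open>C * t\<close> and by \<open>C / t\<close> vanishes at both ends, so its extension by zero is continuous on the
  line.
\<close>
lemma compactified_isCont:
  fixes f :: "real \<Rightarrow> real"
  assumes cont: "continuous_on {0<..} f"
    and b1: "\<And>t. 0 < t \<Longrightarrow> \<bar>f t\<bar> \<le> C * t" and b2: "\<And>t. 0 < t \<Longrightarrow> \<bar>f t\<bar> \<le> C / t"
  defines "h \<equiv> \<lambda>u. if 0 < u \<and> u < 1 then f (u / (1 - u)) else 0"
  shows "isCont h u" "\<bar>h u\<bar> \<le> 2 * C"
proof -
  have C: "0 \<le> C" using b1[of 1] by simp
  have bound: "\<bar>h v\<bar> \<le> 2 * C * \<bar>v\<bar> \<and> \<bar>h v\<bar> \<le> 2 * C * \<bar>v - 1\<bar>" for v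
  proof (cases "0 < v \<and> v < 1")
    case True
    define s where "s = v / (1 - v)"
    have s: "0 < s" using True by (simp add: s_def)
    have hv: "\<bar>h v\<bar> \<le> C * s" "\<bar>h v\<bar> \<le> C / s"
      using True b1[OF s] b2[OF s] by (simp_all add: h_def s_def)
    show ?thesis
    proof (cases "v \<le> 1 / 2")
      case le: True
      have "s \<le> 2 * v" using True le by (simp add: s_def field_simps)
      moreover have "2 * v \<le> 2 * (1 - v)" using le by simp
      ultimately have "C * s \<le> C * (2 * v)" "C * (2 * v) \<le> C * (2 * (1 - v))"
        using C by (auto intro: mult_left_mono)
      then show ?thesis using hv True by (auto simp: algebra_simps)
    next
      case ge: False
      have "(1 - v) * (1 / v) \<le> (1 - v) * 2"
        using True ge by (intro mult_left_mono) (auto simp: field_simps)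
      then have "1 / s \<le> 2 * (1 - v)" by (simp add: s_def)
      from mult_left_mono[OF this C] have "C / s \<le> C * (2 * (1 - v))" by simp
      moreover have "C * (2 * (1 - v)) \<le> C * (2 * v)" using C ge by (intro mult_left_mono) auto
      ultimately have "\<bar>h v\<bar> \<le> C * (2 * (1 - v))" "\<bar>h v\<bar> \<le> C * (2 * v)"
        using hv(2) by linarith+
      then show ?thesis using hv True by (auto simp: algebra_simps)
    qed
  qed (use C in \<open>auto simp: h_def\<close>)
  show "\<bar>h u\<bar> \<le> 2 * C"
  proof (cases "0 < u \<and> u < 1")
    case True
    then have "2 * C * \<bar>u\<bar> \<le> 2 * C * 1" using C by (intro mult_left_mono) auto
    then show ?thesis using bound[of u] by linarith
  qed (use C in \<open>auto simp: h_def\<close>)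
  have edge: "isCont h a" if "h a = 0" "\<And>v. \<bar>h v\<bar> \<le> 2 * C * \<bar>v - a\<bar>" for a
    unfolding isCont_def that(1)
  proof (rule Lim_null_comparison)
    show "\<forall>\<^sub>F v in at a. norm (h v) \<le> 2 * C * \<bar>v - a\<bar>" using that(2) by simp
    have "((\<lambda>v. 2 * C * \<bar>v - a\<bar>) \<longlongrightarrow> 2 * C * \<bar>a - a\<bar>) (at a)"
      by (intro tendsto_intros)
    then show "((\<lambda>v. 2 * C * \<bar>v - a\<bar>) \<longlongrightarrow> 0) (at a)" by simp
  qed
  consider "u = 0" | "u = 1" | "0 < u \<and> u < 1" | "u < 0 \<or> 1 < u" by linarith
  then show "isCont h u"
  proof cases
    case 1 then show ?thesis using bound by (intro edge) (auto simp: h_def)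
  next
    case 2 then show ?thesis using bound by (intro edge) (auto simp: h_def)
  next
    case 3
    have "continuous_on {0<..<1} (\<lambda>v. f (v / (1 - v)))"
      by (intro continuous_on_compose2[OF cont] continuous_intros) auto
    then have "continuous_on {0<..<1} h"
      by (rule continuous_on_cong[THEN iffD1, rotated 2]) (auto simp: h_def)
    then show ?thesis using 3 by (simp add: continuous_on_eq_continuous_at)
  next
    case 4
    have "continuous_on ({..<0} \<union> {1<..}) h"
      by (rule continuous_on_cong[THEN iffD2, OF refl _ continuous_on_const[of _ 0]]) (auto simp: h_def)
    then show ?thesis using 4 by (subst (asm) continuous_on_eq_continuous_at) auto
  qed
qed

text \<open>
  On \<open>[0, 1]\<close> the transported measures are tight and Helly's theorem gives a weak limit; the part of
  it in \<open>(0, 1)\<close> is transported back. Mass that has gone to the end points \<open>0\<close> and \<open>1\<close> is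
  discarded, so the limit may have mass less than one.
\<close>
theorem vague_compactness:
  fixes \<nu> :: "nat \<Rightarrow> real measure"
  assumes prob: "\<And>m. prob_space (\<nu> m)" and sets: "\<And>m. sets (\<nu> m) = sets borel"
    and pos: "\<And>m. emeasure (\<nu> m) {..0} = 0"
  obtains r N where "strict_mono (r :: nat \<Rightarrow> nat)" "mixing_measure N" "emeasure N UNIV \<le> 1"
    "\<And>f C. f \<in> borel_measurable borel \<Longrightarrow> continuous_on {0<..} f \<Longrightarrow>
       (\<And>t. 0 < t \<Longrightarrow> \<bar>f t\<bar> \<le> C * t) \<Longrightarrow> (\<And>t. 0 < t \<Longrightarrow> \<bar>f t\<bar> \<le> C / t) \<Longrightarrow>
       (\<lambda>m. \<integral>t. f t \<partial>\<nu> (r m)) \<longlonglongrightarrow> (\<integral>t. f t \<partial>N)"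
proof -
  define \<phi> where "\<phi> t = (if 0 < t then t / (1 + t) else 0)" for t :: real
  have [measurable]: "\<phi> \<in> borel_measurable borel" unfolding \<phi>_def by measurable
  note [measurable_cong] = sets
  define \<mu> where "\<mu> m = distr (\<nu> m) borel \<phi>" for m
  have space: "space (\<nu> m) = UNIV" for m
    using sets_eq_imp_space_eq[OF sets] by simp
  have rd: "real_distribution (\<mu> m)" for m
    unfolding \<mu>_def by (intro prob_space.real_distribution_distr prob) measurable
  have range: "\<phi> -` {-1<..1} = UNIV" by (auto simp: \<phi>_def field_simps)
  have "measure (\<mu> m) {-1<..1} = 1" for m
    unfolding \<mu>_def using prob_space.prob_space[OF prob, of m]
    by (subst measure_distr) (auto simp: space range)
  then have "tight \<mu>"
    unfolding tight_def using rd by (intro conjI allI impI exI[of _ "-1 :: real"] exI[of _ "1 :: real"]) simp_all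
  then obtain r M where r: "strict_mono (r :: nat \<Rightarrow> nat)" and M: "real_distribution M"
    and conv: "weak_conv_m (\<mu> \<circ> id \<circ> r) M"
    using tight_imp_convergent_subsubsequence[of \<mu> id] by (auto simp: strict_mono_def)
  interpret M: real_distribution M by fact
  define N where "N = distr (density M (indicator {0<..<1})) borel (\<lambda>u. u / (1 - u))"
  have setsN[measurable_cong]: "sets N = sets borel" by (simp add: N_def)
  have emN: "emeasure N A = emeasure M ({u. u / (1 - u) \<in> A} \<inter> {0<..<1})" if [measurable]: "A \<in> sets borel" for A
  proof -
    have [measurable]: "{u. u / (1 - u) \<in> A} \<in> sets borel" by measurable
    have "emeasure N A = emeasure (density M (indicator {0<..<1})) {u. u / (1 - u) \<in> A}"
      unfolding N_def by (subst emeasure_distr) (auto simp: vimage_def)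
    also have "\<dots> = (\<integral>\<^sup>+u. indicator {0<..<1} u * indicator {u. u / (1 - u) \<in> A} u \<partial>M)"
      by (rule emeasure_density) auto
    also have "\<dots> = (\<integral>\<^sup>+u. indicator ({u. u / (1 - u) \<in> A} \<inter> {0<..<1}) u \<partial>M)"
      by (intro nn_integral_cong) (auto split: split_indicator)
    also have "\<dots> = emeasure M ({u. u / (1 - u) \<in> A} \<inter> {0<..<1})"
      by (rule nn_integral_indicator) measurable
    finally show ?thesis .
  qed
  have N1: "emeasure N UNIV \<le> 1"
    by (subst emN) (auto intro: M.emeasure_le_1)
  have "{u. u / (1 - u) \<in> {..0}} \<inter> {0<..<1} = ({} :: real set)"
    by (auto simp: divide_simps)
  then have "emeasure N {..0} = 0" by (subst emN) auto
  moreover have "finite_measure N"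
    using N1 sets_eq_imp_space_eq[OF setsN] by (intro finite_measureI) (auto simp: top_unique)
  ultimately have "mixing_measure N"
    using setsN by (simp add: mixing_measure_def)
  moreover have "(\<lambda>m. \<integral>t. f t \<partial>\<nu> (r m)) \<longlonglongrightarrow> (\<integral>t. f t \<partial>N)"
    if [measurable]: "f \<in> borel_measurable borel" and f: "continuous_on {0<..} f"
      "\<And>t. 0 < t \<Longrightarrow> \<bar>f t\<bar> \<le> C * t" "\<And>t. 0 < t \<Longrightarrow> \<bar>f t\<bar> \<le> C / t" for f C
  proof -
    define h where "h u = (if 0 < u \<and> u < 1 then f (u / (1 - u)) else 0)" for u :: real
    have [measurable]: "h \<in> borel_measurable borel" unfolding h_def by measurable
    have hc: "isCont h u" "\<bar>h u\<bar> \<le> 2 * C" for u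
      using compactified_isCont[OF f] unfolding h_def by blast+
    have "(\<lambda>m. integral\<^sup>L ((\<mu> \<circ> id \<circ> r) m) h) \<longlonglongrightarrow> integral\<^sup>L M h"
      by (rule weak_conv_imp_integral_bdd_continuous_conv[OF _ M conv hc(1), where B="2 * C"])
         (use rd hc(2) in auto)
    moreover have "integral\<^sup>L (\<mu> m) h = (\<integral>t. f t \<partial>\<nu> m)" for m
    proof -
      have "integral\<^sup>L (\<mu> m) h = (\<integral>t. h (\<phi> t) \<partial>\<nu> m)"
        unfolding \<mu>_def by (rule integral_distr) measurable
      also have "\<dots> = (\<integral>t. f t \<partial>\<nu> m)"
      proof (rule integral_cong_AE)
        show "AE t in \<nu> m. h (\<phi> t) = f t"
          using AE_pos[OF sets pos, of m]
        proof eventually_elim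
          case (elim t)
          then have "t / (1 + t) / (1 - t / (1 + t)) = t" "0 < t / (1 + t)" "t / (1 + t) < 1"
            by (auto simp: field_simps)
          then show ?case using elim by (simp add: h_def \<phi>_def)
        qed
      qed measurable
      finally show ?thesis .
    qed
    moreover have "integral\<^sup>L M h = (\<integral>t. f t \<partial>N)"
    proof -
      have "(\<integral>t. f t \<partial>N) = (\<integral>u. f (u / (1 - u)) \<partial>density M (indicator {0<..<1}))"
        unfolding N_def by (rule integral_distr) measurable
      also have "density M (indicator {0<..<1}) = density M (\<lambda>u. ennreal (indicator {0<..<1} u))"
        by (simp add: ennreal_indicator)
      also have "(\<integral>u. f (u / (1 - u)) \<partial>density M (\<lambda>u. ennreal (indicator {0<..<1} u)))
          = (\<integral>u. indicator {0<..<1} u *\<^sub>R f (u / (1 - u)) \<partial>M)"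
        by (rule integral_density) auto
      also have "\<dots> = integral\<^sup>L M h"
        by (intro Bochner_Integration.integral_cong) (auto simp: h_def split: split_indicator)
      finally show ?thesis by simp
    qed
    ultimately show ?thesis by simp
  qed
  ultimately show ?thesis using r N1 that by blast
qed

lemma bounded_real_family_subsequence:
  fixes f :: "nat \<Rightarrow> 'i \<Rightarrow> real"
  assumes "finite I" "\<And>m i. i \<in> I \<Longrightarrow> \<bar>f m i\<bar> \<le> B"
  obtains r L where "strict_mono (r :: nat \<Rightarrow> nat)" "\<And>i. i \<in> I \<Longrightarrow> (\<lambda>m. f (r m) i) \<longlonglongrightarrow> L i"
proof -
  have "\<exists>r L. strict_mono (r :: nat \<Rightarrow> nat) \<and> (\<forall>i\<in>I. (\<lambda>m. f (r m) i) \<longlonglongrightarrow> L i)"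
    using assms
  proof (induction I rule: finite_induct)
    case empty
    then show ?case by (auto intro!: exI[of _ id] strict_mono_id)
  next
    case (insert a I)
    then obtain r L where r: "strict_mono (r :: nat \<Rightarrow> nat)" "\<forall>i\<in>I. (\<lambda>m. f (r m) i) \<longlonglongrightarrow> L i"
      by auto
    have "bounded (range (\<lambda>m. f (r m) a))"
      using insert.prems by (intro boundedI[of _ B]) auto
    then obtain l s where s: "strict_mono (s :: nat \<Rightarrow> nat)" "((\<lambda>m. f (r m) a) \<circ> s) \<longlonglongrightarrow> l"
      using bounded_imp_convergent_subsequence[of "\<lambda>m. f (r m) a"] by blast
    show ?case
    proof (intro exI[of _ "r \<circ> s"] exI[of _ "L(a := l)"] conjI ballI)
      show "strict_mono (r \<circ> s)" using r(1) s(1) by (rule strict_mono_o)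
      fix i assume i: "i \<in> insert a I"
      show "(\<lambda>m. f ((r \<circ> s) m) i) \<longlonglongrightarrow> (L(a := l)) i"
      proof (cases "i = a")
        case True
        then show ?thesis using s(2) by (simp add: o_def)
      next
        case False
        then have "((\<lambda>m. f (r m) i) \<circ> s) \<longlonglongrightarrow> L i"
          using i r(2) s(1) by (intro LIMSEQ_subseq_LIMSEQ) auto
        then show ?thesis using False by (simp add: o_def)
      qed
    qed
  qed
  then show ?thesis using that by blast
qed

lemma pmf_expectation_mix:
  fixes f :: "'a \<Rightarrow> real" and a :: 'a and p :: "'a pmf"
  assumes f: "\<And>t. 0 \<le> f t \<and> f t \<le> B" and e: "0 \<le> e" "e \<le> 1"
  defines "q \<equiv> bind_pmf (bernoulli_pmf e) (\<lambda>b. if b then return_pmf a else p)"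
  shows "measure_pmf.expectation q f = e * f a + (1 - e) * measure_pmf.expectation p f"
proof -
  have int: "integrable (measure_pmf p') f" for p'
    by (rule measure_pmf.integrable_const_bound[where B=B]) (use f in auto)
  have nn: "(\<integral>\<^sup>+t. ennreal (f t) \<partial>measure_pmf p') = ennreal (measure_pmf.expectation p' f)" for p'
    using f by (intro nn_integral_eq_integral int) auto
  have E0: "0 \<le> measure_pmf.expectation p' f" for p'
    using f by (intro integral_nonneg_AE) auto
  have "(\<integral>\<^sup>+t. ennreal (f t) \<partial>measure_pmf q)
      = ennreal (f a) * ennreal e + ennreal (measure_pmf.expectation p f) * ennreal (1 - e)"
    unfolding q_def nn_integral_bind_pmf
    by (subst nn_integral_bernoulli_pmf) (use e in \<open>simp_all add: nn\<close>)
  also have "\<dots> = ennreal (e * f a + (1 - e) * measure_pmf.expectation p f)"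
    using e f E0 by (simp add: ennreal_mult'[symmetric] mult.commute)
  finally have "ennreal (measure_pmf.expectation q f) = ennreal (e * f a + (1 - e) * measure_pmf.expectation p f)"
    unfolding nn .
  moreover have "0 \<le> e * f a + (1 - e) * measure_pmf.expectation p f"
    using e f E0 by simp
  ultimately show ?thesis
    using ennreal_inj[OF E0[of q]] by simp
qed

text \<open>
  Maximize the product of the expectations of the \<open>\<kappa> i\<close> over distributions on \<open>T\<close>. The supremum
  need not be attained, but a maximizing sequence has a subsequence along which the expectations
  converge, to \<open>L\<close> say. Replacing each \<open>p m\<close> by \<open>(1 - e) p m + e \<delta>\<^sub>t\<close> and letting \<open>m\<close> tend to
  infinity shows that \<open>\<Prod>i. (1 - e) L i + e \<kappa> i t\<close> is at most its value at \<open>e = 0\<close>, and its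
  derivative there must not be positive.
\<close>
lemma limiting_stationarity:
  fixes \<kappa> :: "'i \<Rightarrow> 'a \<Rightarrow> real"
  assumes I: "finite I" and \<kappa>: "\<And>i t. 0 \<le> \<kappa> i t \<and> \<kappa> i t \<le> B"
    and a: "a \<in> T" "\<And>i. i \<in> I \<Longrightarrow> 0 < \<kappa> i a"
  obtains p L where "\<And>m :: nat. set_pmf (p m) \<subseteq> T"
    "\<And>i. i \<in> I \<Longrightarrow> (\<lambda>m. measure_pmf.expectation (p m) (\<kappa> i)) \<longlonglongrightarrow> L i"
    "\<And>i. i \<in> I \<Longrightarrow> 0 < L i" "\<And>t. t \<in> T \<Longrightarrow> (\<Sum>i\<in>I. \<kappa> i t / L i) \<le> real (card I)"
proof -
  define E where "E p i = measure_pmf.expectation p (\<kappa> i)" for p i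
  define J where "J p = (\<Prod>i\<in>I. E p i)" for p
  define P where "P = {p. set_pmf p \<subseteq> T}"
  have int: "integrable (measure_pmf p) (\<kappa> i)" for p i
    by (rule measure_pmf.integrable_const_bound[where B=B]) (use \<kappa> in auto)
  have E0: "0 \<le> E p i" for p i unfolding E_def using \<kappa> by (intro integral_nonneg_AE) auto
  have EB: "E p i \<le> B" for p i
    unfolding E_def using \<kappa> by (intro measure_pmf.integral_le_const int) auto
  have bdd: "bdd_above (J ` P)"
    unfolding J_def by (intro bdd_aboveI[of _ "\<Prod>i\<in>I. B"]) (auto simp del: prod_constant intro!: prod_mono simp: E0 EB)
  define S where "S = (SUP p\<in>P. J p)"
  have J_le: "J p \<le> S" if "set_pmf p \<subseteq> T" for p
    unfolding S_def using that by (intro cSUP_upper bdd) (auto simp: P_def)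
  have "0 < J (return_pmf a)" unfolding J_def E_def using a by (auto intro!: prod_pos)
  then have S: "0 < S" using J_le[of "return_pmf a"] a by auto
  have ne: "P \<noteq> {}" using a by (auto simp: P_def intro!: exI[of _ "return_pmf a"])
  have "\<exists>p. p \<in> P \<and> S - inverse (real (Suc m)) < J p" for m
    using less_cSUP_iff[OF ne bdd, of "S - inverse (real (Suc m))"] by (auto simp: S_def)
  then obtain p0 where p0: "\<And>m. p0 m \<in> P" "\<And>m. S - inverse (real (Suc m)) < J (p0 m)"
    by metis
  have J_lim: "(\<lambda>m. J (p0 m)) \<longlonglongrightarrow> S"
  proof (rule tendsto_sandwich[OF _ _ _ tendsto_const])
    have "(\<lambda>m. S - inverse (real (Suc m))) \<longlonglongrightarrow> S - 0"
      by (intro tendsto_intros LIMSEQ_inverse_real_of_nat)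
    then show "(\<lambda>m. S - inverse (real (Suc m))) \<longlonglongrightarrow> S" by simp
  qed (use p0 J_le in \<open>auto simp: P_def less_imp_le\<close>)
  have "\<bar>E (p0 m) i\<bar> \<le> B" for m i using E0 EB by simp
  then obtain r L where r: "strict_mono (r :: nat \<Rightarrow> nat)"
    and L: "\<And>i. i \<in> I \<Longrightarrow> (\<lambda>m. E (p0 (r m)) i) \<longlonglongrightarrow> L i"
    using bounded_real_family_subsequence[OF I, of "\<lambda>m. E (p0 m)" B] by blast
  have "(\<lambda>m. J (p0 (r m))) \<longlonglongrightarrow> (\<Prod>i\<in>I. L i)"
    unfolding J_def by (intro tendsto_prod L)
  moreover have "(\<lambda>m. J (p0 (r m))) \<longlonglongrightarrow> S"
    using LIMSEQ_subseq_LIMSEQ[OF J_lim r] by (simp add: o_def)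
  ultimately have prodL: "(\<Prod>i\<in>I. L i) = S" by (rule LIMSEQ_unique)
  have L0: "0 < L i" if "i \<in> I" for i
  proof -
    have "0 \<le> L i" using L[OF that] by (rule LIMSEQ_le_const) (use E0 in auto)
    moreover have "L i \<noteq> 0" using prodL S I that by (metis less_irrefl prod_zero_iff)
    ultimately show ?thesis by simp
  qed
  have stat: "(\<Sum>i\<in>I. \<kappa> i t / L i) \<le> real (card I)" if t: "t \<in> T" for t
  proof (rule ccontr)
    assume neg: "\<not> ?thesis"
    \<comment> \<open>The logarithmic derivative of the \<open>i\<close>-th factor at \<open>e = 0\<close>.\<close>
    define c where "c i = \<kappa> i t / L i - 1" for i
    have pos: "0 < (\<Sum>i\<in>I. c i)" using neg by (simp add: c_def sum_subtractf)
    have le: "(\<Prod>i\<in>I. 1 + e * c i) \<le> 1" if e: "0 \<le> e" "e \<le> 1" for e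
    proof -
      define q where "q m = bind_pmf (bernoulli_pmf e) (\<lambda>b. if b then return_pmf t else p0 (r m))" for m
      have "set_pmf (q m) \<subseteq> T" for m
        using p0(1) t by (auto simp: q_def P_def subset_iff split: if_splits)
      then have "J (q m) \<le> S" for m by (rule J_le)
      moreover have "E (q m) i = e * \<kappa> i t + (1 - e) * E (p0 (r m)) i" for m i
        unfolding E_def q_def by (rule pmf_expectation_mix[OF \<kappa> e])
      moreover have "(\<lambda>m. \<Prod>i\<in>I. e * \<kappa> i t + (1 - e) * E (p0 (r m)) i)
          \<longlonglongrightarrow> (\<Prod>i\<in>I. e * \<kappa> i t + (1 - e) * L i)"
        by (intro tendsto_intros L)
      ultimately have "(\<Prod>i\<in>I. e * \<kappa> i t + (1 - e) * L i) \<le> S"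
        by (intro LIMSEQ_le_const2) (auto simp: J_def)
      also have "(\<Prod>i\<in>I. e * \<kappa> i t + (1 - e) * L i) = (\<Prod>i\<in>I. L i * (1 + e * c i))"
      proof (rule prod.cong[OF refl])
        fix i assume "i \<in> I"
        then have "L i \<noteq> 0" using L0[of i] by simp
        then show "e * \<kappa> i t + (1 - e) * L i = L i * (1 + e * c i)"
          by (simp add: c_def field_simps)
      qed
      finally show ?thesis
        using S by (simp add: prod.distrib prodL)
    qed
    have "((\<lambda>e. \<Prod>i\<in>I. 1 + e * c i) has_real_derivative
        (\<Sum>i\<in>I. c i * (\<Prod>j\<in>I - {i}. 1 + 0 * c j))) (at 0)"
      by (intro has_field_derivative_prod) (auto intro!: derivative_eq_intros)
    then have "((\<lambda>e. \<Prod>i\<in>I. 1 + e * c i) has_real_derivative (\<Sum>i\<in>I. c i)) (at 0)" by simp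
    from DERIV_pos_inc_right[OF this pos] obtain d where d: "0 < d"
      "\<And>h. 0 < h \<Longrightarrow> h < d \<Longrightarrow> 1 < (\<Prod>i\<in>I. 1 + h * c i)" by auto
    define h where "h = min 1 (d / 2)"
    have "0 < h" "h \<le> 1" "h < d" using d(1) by (auto simp: h_def min_def)
    then show False
      using d(2)[of h] le[of h] by simp
  qed
  show ?thesis
  proof (rule that)
    show "set_pmf (p0 (r m)) \<subseteq> T" for m
      using p0(1)[of "r m"] by (simp add: P_def)
    show "(\<lambda>m. measure_pmf.expectation (p0 (r m)) (\<kappa> i)) \<longlonglongrightarrow> L i" if "i \<in> I" for i
      using L[OF that] by (simp add: E_def)
  qed (fact L0, fact stat)
qed

section \<open>Existence of a stationary mixture\<close>

lemma enat_cases_pos: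
  assumes "1 \<le> k"
  obtains i where "k = enat (Suc i)" | "k = \<infinity>"
  using assms by (cases k rule: enat.exhaust) (auto simp: one_enat_def dest!: Suc_le_D)

lemma mix_kernel_pos:
  assumes "1 \<le> k" "0 < x" "x < t"
  shows "0 < mix_kernel k t x"
  using assms(1) by (rule enat_cases_pos) (use assms in \<open>auto simp: mix_kernel_Suc mix_kernel_def[of \<infinity>]\<close>)

lemma power_exp_le:
  fixes y :: real
  assumes "0 \<le> y" "0 < n"
  shows "y ^ n * exp (- y) \<le> real n ^ n"
proof -
  have "y / real n \<le> exp (y / real n)" using exp_ge_add_one_self[of "y / real n"] by linarith
  then have "(y / real n) ^ n \<le> exp (y / real n) ^ n" using assms by (intro power_mono) auto
  also have "\<dots> = exp y" using assms by (simp add: exp_of_nat_mult[symmetric])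
  finally have "y ^ n \<le> real n ^ n * exp y" using assms by (simp add: power_divide field_simps)
  then show ?thesis by (simp add: exp_minus field_simps)
qed

lemma common_bound:
  fixes y :: real
  assumes "0 < t" "y \<le> A / t" "y \<le> B * t"
  shows "y \<le> max A B * t" "y \<le> max A B / t"
proof -
  have "A / t \<le> max A B / t" "B * t \<le> max A B * t"
    by (intro divide_right_mono mult_right_mono max.cobounded1 max.cobounded2 less_imp_le assms(1))+
  then show "y \<le> max A B * t" "y \<le> max A B / t" using assms by linarith+
qed

lemma mix_kernel_bounds:
  assumes "1 \<le> k" "0 < x"
  obtains C where "\<And>t. 0 < t \<Longrightarrow> mix_kernel k t x \<le> C * t" "\<And>t. 0 < t \<Longrightarrow> mix_kernel k t x \<le> C / t"
  using assms(1)
proof (rule enat_cases_pos)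
  fix i assume k: "k = enat (Suc i)"
  have 1: "mix_kernel k t x \<le> real (Suc i) / t" if t: "0 < t" for t
  proof (cases "x \<le> t")
    case True
    then have "(t - x) ^ i \<le> t ^ i" using t assms by (intro power_mono) auto
    then have "real (Suc i) * (t - x) ^ i / t ^ Suc i \<le> real (Suc i) * t ^ i / t ^ Suc i"
      using t by (intro divide_right_mono mult_left_mono) auto
    then show ?thesis using True t by (simp add: k mix_kernel_Suc)
  qed (use t in \<open>simp add: k mix_kernel_Suc\<close>)
  have 2: "mix_kernel k t x \<le> real (Suc i) / x\<^sup>2 * t" if t: "0 < t" for t
  proof (cases "x \<le> t")
    case True
    then have "x\<^sup>2 \<le> t\<^sup>2" using assms by (intro power_mono) auto
    then have "1 / t \<le> 1 / x\<^sup>2 * t" using t assms by (simp add: field_simps power2_eq_square)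
    then have "real (Suc i) * (1 / t) \<le> real (Suc i) * (1 / x\<^sup>2 * t)" by (intro mult_left_mono) auto
    then show ?thesis using 1[OF t] by simp
  qed (use t in \<open>simp add: k mix_kernel_Suc\<close>)
  let ?C = "max (real (Suc i)) (real (Suc i) / x\<^sup>2)"
  show ?thesis
  proof (rule that[of ?C])
    fix t :: real assume t: "0 < t"
    show "mix_kernel k t x \<le> ?C * t" "mix_kernel k t x \<le> ?C / t"
      by (rule common_bound[OF t 1[OF t] 2[OF t]])+
  qed
next
  assume k: "k = \<infinity>"
  have 1: "mix_kernel k t x \<le> 1 / t" if "0 < t" for t
    using that assms by (simp add: k mix_kernel_def divide_right_mono)
  have 2: "mix_kernel k t x \<le> 4 / x\<^sup>2 * t" if t: "0 < t" for t
  proof -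
    have "(x / t)\<^sup>2 * exp (- (x / t)) \<le> 4" using power_exp_le[of "x / t" 2] t assms by simp
    then have "exp (- (x / t)) \<le> 4 / x\<^sup>2 * t\<^sup>2" using t assms by (simp add: field_simps)
    then have "exp (- (x / t)) / t \<le> 4 / x\<^sup>2 * t\<^sup>2 / t" using t by (intro divide_right_mono) auto
    then show ?thesis using t by (simp add: k mix_kernel_def power2_eq_square)
  qed
  let ?C = "max 1 (4 / x\<^sup>2)"
  show ?thesis
  proof (rule that[of ?C])
    fix t :: real assume t: "0 < t"
    show "mix_kernel k t x \<le> ?C * t" "mix_kernel k t x \<le> ?C / t"
      by (rule common_bound[OF t 1[OF t] 2[OF t]])+
  qed
qed

lemma le_of_two_bounds:
  assumes "y \<le> C * t" "y \<le> C / t" "0 < t" "0 \<le> y"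
  shows "y \<le> (C :: real)"
proof (cases "t \<le> 1")
  case True
  have "0 \<le> C" using assms by (metis order_trans zero_le_mult_iff not_le)
  then have "C * t \<le> C" using True by (simp add: mult_left_le)
  then show ?thesis using assms by linarith
next
  case False
  have "0 \<le> C" using assms by (metis order_trans zero_le_mult_iff not_le)
  then have "C / t \<le> C" using False mult_left_mono[of 1 t C] by (simp add: field_simps)
  then show ?thesis using assms by linarith
qed

lemma continuous_on_mix_kernel:
  assumes "1 \<le> k" "k \<noteq> 1"
  shows "continuous_on {0<..} (\<lambda>t. mix_kernel k t x)"
  using assms(1)
proof (rule enat_cases_pos)
  fix i assume k: "k = enat (Suc i)"
  then have "i \<noteq> 0" using assms(2) by (auto simp: one_enat_def)
  then have eq: "(\<lambda>t. mix_kernel k t x) = (\<lambda>t. real (Suc i) * (max (t - x) 0) ^ i / t ^ Suc i)"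
    by (simp add: k mix_kernel_def trunc_pow_def)
  show ?thesis unfolding eq by (auto intro!: continuous_intros)
next
  assume "k = \<infinity>"
  then show ?thesis by (auto simp: mix_kernel_def intro!: continuous_intros)
qed

text \<open>
  For \<open>k = 1\<close> the kernel jumps at \<open>t = x\<close> and vague convergence does not apply to it. It is upper
  semicontinuous, though, hence a limit of continuous majorants, and this suffices for an inequality
  between the limit of the integrals and the integral of the limit.
\<close>
lemma kernel_majorants:
  assumes "1 \<le> k" "0 < x"
  obtains f :: "nat \<Rightarrow> real \<Rightarrow> real" and C where
    "\<And>l. f l \<in> borel_measurable borel" "\<And>l. continuous_on {0<..} (f l)"
    "\<And>l t. 0 < t \<Longrightarrow> mix_kernel k t x \<le> f l t"
    "\<And>l t. 0 < t \<Longrightarrow> f l t \<le> C * t" "\<And>l t. 0 < t \<Longrightarrow> f l t \<le> C / t"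
    "\<And>t. 0 < t \<Longrightarrow> (\<lambda>l. f l t) \<longlonglongrightarrow> mix_kernel k t x"
proof (cases "k = 1")
  case False
  obtain C where "\<And>t. 0 < t \<Longrightarrow> mix_kernel k t x \<le> C * t" "\<And>t. 0 < t \<Longrightarrow> mix_kernel k t x \<le> C / t"
    using mix_kernel_bounds[OF assms] by blast
  then show ?thesis
    using continuous_on_mix_kernel[OF assms(1) False]
    by (intro that[of "\<lambda>_ t. mix_kernel k t x" C]) auto
next
  case True
  have K: "mix_kernel k t x = (if x \<le> t then 1 / t else 0)" for t
    using mix_kernel_Suc[of 0 t x] by (simp add: True one_enat_def)
  \<comment> \<open>The slope is at least \<open>2 / x\<close>, so that the majorant vanishes for \<open>t \<le> x / 2\<close> and is bounded by a multiple of \<open>t\<close>.\<close>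
  define f where "f l t = 1 / t * max 0 (1 - (real l + 2 / x) * max 0 (x - t))" for l :: nat and t
  have f_le: "0 \<le> max 0 (1 - (real l + 2 / x) * max 0 (x - t))"
    "max 0 (1 - (real l + 2 / x) * max 0 (x - t)) \<le> 1" for l t
    using assms by (auto simp: mult_nonneg_nonneg)
  have f0: "f l t = 0" if "0 < t" "t \<le> x / 2" for l t
  proof -
    have "1 \<le> 2 / x * (x / 2)" using assms by simp
    also have "\<dots> \<le> (real l + 2 / x) * max 0 (x - t)"
      using assms that by (intro mult_mono) auto
    finally show ?thesis by (simp add: f_def)
  qed
  have b1: "f l t \<le> 1 / t" if "0 < t" for l t
    using that mult_left_mono[OF f_le(2)[of l t], of "1 / t"] by (simp add: f_def)
  have b2: "f l t \<le> 4 / x\<^sup>2 * t" if t: "0 < t" for l t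
  proof (cases "t \<le> x / 2")
    case False
    then have "(x / 2)\<^sup>2 \<le> t\<^sup>2" using assms by (intro power_mono) auto
    then have "1 / t \<le> 4 / x\<^sup>2 * t" using t assms by (simp add: field_simps power2_eq_square)
    then show ?thesis using b1[OF t, of l] by simp
  qed (use f0 t in auto)
  let ?C = "max 1 (4 / x\<^sup>2)"
  show ?thesis
  proof (rule that[of f ?C])
    show "f l \<in> borel_measurable borel" for l unfolding f_def by measurable
    show "continuous_on {0<..} (f l)" for l unfolding f_def by (auto intro!: continuous_intros)
    fix t :: real assume t: "0 < t"
    show "f l t \<le> ?C * t" "f l t \<le> ?C / t" for l
      by (rule common_bound[OF t b1[OF t] b2[OF t]])+
    show "mix_kernel k t x \<le> f l t" for l
      using t f_le(1)[of l t] by (auto simp: K f_def)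
    show "(\<lambda>l. f l t) \<longlonglongrightarrow> mix_kernel k t x"
    proof (cases "x \<le> t")
      case True
      then show ?thesis by (simp add: K f_def)
    next
      case False
      obtain l0 where l0: "1 / (x - t) \<le> real l0" using real_arch_simple by blast
      have "f l t = 0" if "l0 \<le> l" for l
      proof -
        have "1 \<le> real l0 * (x - t)" using l0 False by (simp add: field_simps)
        also have "\<dots> \<le> (real l + 2 / x) * (x - t)"
          using False that assms by (intro mult_right_mono) (auto intro: add_increasing2)
        finally show ?thesis using False by (simp add: f_def)
      qed
      then have "eventually (\<lambda>l. f l t = 0) sequentially"
        by (auto simp: eventually_sequentially)
      then show ?thesis using False by (simp add: K tendsto_eventually)
    qed
  qed
qed

lemma mixing_measureD:
  assumes "mixing_measure \<nu>"
  shows "finite_measure \<nu>" "sets \<nu> = sets borel" "AE t in \<nu>. 0 < t" "space \<nu> = UNIV"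
  using assms AE_pos[of \<nu>] sets_eq_imp_space_eq[of \<nu> borel] by (auto simp: mixing_measure_def)

lemma integrable_bounded_pos:
  assumes \<nu>: "mixing_measure \<nu>" and [measurable]: "f \<in> borel_measurable borel"
    and "\<And>t. 0 < t \<Longrightarrow> \<bar>f t\<bar> \<le> (B :: real)"
  shows "integrable \<nu> f"
proof -
  note D = mixing_measureD[OF \<nu>]
  interpret finite_measure \<nu> by (rule D)
  note [measurable_cong] = D(2)
  show ?thesis
  proof (rule integrable_const_bound)
    show "AE t in \<nu>. norm (f t) \<le> B" using D(3) by eventually_elim (simp add: assms(3))
  qed measurable
qed

lemma integrable_mix_kernel:
  assumes "mixing_measure \<nu>" "1 \<le> k" "0 < x"
  shows "integrable \<nu> (\<lambda>t. mix_kernel k t x)"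
proof -
  obtain C where C: "\<And>t. 0 < t \<Longrightarrow> mix_kernel k t x \<le> C * t" "\<And>t. 0 < t \<Longrightarrow> mix_kernel k t x \<le> C / t"
    using mix_kernel_bounds[OF assms(2,3)] by blast
  show ?thesis
  proof (rule integrable_bounded_pos[OF assms(1), where B=C])
    fix t :: real assume t: "0 < t"
    show "\<bar>mix_kernel k t x\<bar> \<le> C"
      using le_of_two_bounds[OF C(1)[OF t] C(2)[OF t] t mix_kernel_nonneg[OF t]] mix_kernel_nonneg[OF t, of k x] C t by simp
  qed measurable
qed

lemma mixture_eq_integral:
  assumes "mixing_measure \<nu>" "1 \<le> k" "0 < x"
  shows "mixture k \<nu> x = ennreal (\<integral>t. mix_kernel k t x \<partial>\<nu>)"
  unfolding mixture_def
  by (intro nn_integral_eq_integral integrable_mix_kernel assms)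
     (use mixing_measureD(3)[OF assms(1)] in eventually_elim, rule mix_kernel_nonneg)

text \<open>
  \<open>L\<close> collects the limiting values, at the points \<open>x i\<close>, of a maximizing sequence of discrete
  mixtures, and \<open>N\<close> is a vague limit of their mixing distributions. Only
  \<open>L i \<le> \<integral> K t (x i) dN\<close> is claimed: for \<open>k = 1\<close> this is what upper semicontinuity gives.
\<close>
theorem stationary_mixture_exists:
  fixes x :: "'i \<Rightarrow> real"
  assumes k: "1 \<le> k" and I: "finite I" and x: "\<And>i. i \<in> I \<Longrightarrow> 0 < x i"
  obtains N L where "mixing_measure N" "emeasure N UNIV \<le> 1"
    "\<And>i. i \<in> I \<Longrightarrow> 0 < L i" "\<And>i. i \<in> I \<Longrightarrow> L i \<le> (\<integral>t. mix_kernel k t (x i) \<partial>N)"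
    "\<And>t. 0 < t \<Longrightarrow> (\<Sum>i\<in>I. mix_kernel k t (x i) / L i) \<le> real (card I)"
proof -
  define \<kappa> where "\<kappa> i t = (if i \<in> I \<and> 0 < t then mix_kernel k t (x i) else 0)" for i t
  have "\<forall>i\<in>I. \<exists>C. \<forall>t>0. mix_kernel k t (x i) \<le> C"
  proof
    fix i assume i: "i \<in> I"
    obtain C where C: "\<And>t. 0 < t \<Longrightarrow> mix_kernel k t (x i) \<le> C * t" "\<And>t. 0 < t \<Longrightarrow> mix_kernel k t (x i) \<le> C / t"
      using mix_kernel_bounds[OF k x[OF i]] by blast
    then show "\<exists>C. \<forall>t>0. mix_kernel k t (x i) \<le> C"
      using le_of_two_bounds[OF C(1) C(2) _ mix_kernel_nonneg] by meson
  qed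
  then obtain C where C: "\<And>i t. i \<in> I \<Longrightarrow> 0 < t \<Longrightarrow> mix_kernel k t (x i) \<le> C i"
    by metis
  have C0: "0 \<le> C i" if "i \<in> I" for i
    using C[OF that zero_less_one] mix_kernel_nonneg[OF zero_less_one, of k "x i"] by linarith
  have \<kappa>: "0 \<le> \<kappa> i t \<and> \<kappa> i t \<le> (\<Sum>i\<in>I. C i)" for i t
  proof (cases "i \<in> I \<and> 0 < t")
    case True
    then have "C i \<le> (\<Sum>i\<in>I. C i)" using C0 I by (intro member_le_sum) auto
    then show ?thesis using True C[of i t] mix_kernel_nonneg[of t k "x i"] by (simp add: \<kappa>_def)
  qed (use C0 in \<open>auto simp: \<kappa>_def intro: sum_nonneg\<close>)
  \<comment> \<open>A point to the right of all \<open>x i\<close>, where every kernel is positive.\<close>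
  define a where "a = 1 + (\<Sum>i\<in>I. x i)"
  have xa: "x i < a" if "i \<in> I" for i
    unfolding a_def using member_le_sum[OF that _ I, of x] x by (force intro: less_imp_le)
  have a0: "0 < a" unfolding a_def using x by (intro add_pos_nonneg sum_nonneg) (auto intro: less_imp_le)
  have \<kappa>a: "0 < \<kappa> i a" if "i \<in> I" for i
    using mix_kernel_pos[OF k x xa] that a0 by (simp add: \<kappa>_def)
  have aT: "a \<in> {0<..}" using a0 by simp
  obtain p L where p: "\<And>m :: nat. set_pmf (p m) \<subseteq> {0<..}"
    and L: "\<And>i. i \<in> I \<Longrightarrow> (\<lambda>m. measure_pmf.expectation (p m) (\<kappa> i)) \<longlonglongrightarrow> L i"
    and L0: "\<And>i. i \<in> I \<Longrightarrow> 0 < L i"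
    and stat: "\<And>t. t \<in> {0<..} \<Longrightarrow> (\<Sum>i\<in>I. \<kappa> i t / L i) \<le> real (card I)"
    by (rule limiting_stationarity[where \<kappa>=\<kappa> and B="\<Sum>i\<in>I. C i" and a=a and T="{0<..}", OF I \<kappa> aT \<kappa>a])
       (assumption, rule that)
  define \<nu> where "\<nu> m = distr (measure_pmf (p m)) borel (\<lambda>t. t)" for m
  have \<nu>: "prob_space (\<nu> m)" "sets (\<nu> m) = sets borel" "emeasure (\<nu> m) {..0} = 0" for m
  proof -
    show "prob_space (\<nu> m)" unfolding \<nu>_def by (intro measure_pmf.prob_space_distr) simp
    have "emeasure (measure_pmf (p m)) {..0} = 0"
      using p[of m] by (auto simp: measure_pmf.emeasure_eq_measure measure_pmf_zero_iff)
    then show "emeasure (\<nu> m) {..0} = 0" unfolding \<nu>_def by (subst emeasure_distr) auto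
  qed (simp add: \<nu>_def)
  have int\<nu>: "(\<integral>t. f t \<partial>\<nu> m) = measure_pmf.expectation (p m) f"
    if "f \<in> borel_measurable borel" for f :: "real \<Rightarrow> real" and m
    unfolding \<nu>_def using that by (intro integral_distr) auto
  obtain r N where r: "strict_mono (r :: nat \<Rightarrow> nat)" and N: "mixing_measure N" "emeasure N UNIV \<le> 1"
    and conv: "\<And>f C. f \<in> borel_measurable borel \<Longrightarrow> continuous_on {0<..} f \<Longrightarrow>
       (\<And>t. 0 < t \<Longrightarrow> \<bar>f t\<bar> \<le> C * t) \<Longrightarrow> (\<And>t. 0 < t \<Longrightarrow> \<bar>f t\<bar> \<le> C / t) \<Longrightarrow>
       (\<lambda>m. \<integral>t. f t \<partial>\<nu> (r m)) \<longlonglongrightarrow> (\<integral>t. f t \<partial>N)"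
    using vague_compactness[of \<nu>, OF \<nu>] by blast
  have "L i \<le> (\<integral>t. mix_kernel k t (x i) \<partial>N)" if i: "i \<in> I" for i
  proof -
    obtain f D where f: "\<And>l. f l \<in> borel_measurable borel" "\<And>l. continuous_on {0<..} (f l)"
      "\<And>l t. 0 < t \<Longrightarrow> mix_kernel k t (x i) \<le> f l t"
      "\<And>l t. 0 < t \<Longrightarrow> f l t \<le> D * t" "\<And>l t. 0 < t \<Longrightarrow> f l t \<le> D / t"
      "\<And>t. 0 < t \<Longrightarrow> (\<lambda>l :: nat. f l t) \<longlonglongrightarrow> mix_kernel k t (x i)"
      using kernel_majorants[OF k x[OF i]] by blast
    have f0: "0 \<le> f l t" if "0 < t" for l t
      using f(3)[OF that] mix_kernel_nonneg[OF that] by (rule order_trans[rotated])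
    have fD: "f l t \<le> D" if "0 < t" for l t
      by (rule le_of_two_bounds[OF f(4)[OF that] f(5)[OF that] that f0[OF that]])
    have "L i \<le> (\<integral>t. f l t \<partial>N)" for l
    proof (rule LIMSEQ_le)
      show "(\<lambda>m. measure_pmf.expectation (p (r m)) (\<kappa> i)) \<longlonglongrightarrow> L i"
        using LIMSEQ_subseq_LIMSEQ[OF L[OF i] r] by (simp add: o_def)
      show "(\<lambda>m. \<integral>t. f l t \<partial>\<nu> (r m)) \<longlonglongrightarrow> (\<integral>t. f l t \<partial>N)"
        by (rule conv[where C=D]) (use f f0 in auto)
      have "measure_pmf.expectation (p m) (\<kappa> i) \<le> (\<integral>t. f l t \<partial>\<nu> m)" for m
        unfolding int\<nu>[OF f(1)]
      proof (rule integral_mono_AE)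
        show "integrable (measure_pmf (p m)) (\<kappa> i)"
          by (rule measure_pmf.integrable_const_bound[where B="\<Sum>i\<in>I. C i"]) (use \<kappa> in auto)
        have pos: "AE t in measure_pmf (p m). 0 < t"
          using p[of m] by (auto simp: AE_measure_pmf_iff)
        show "integrable (measure_pmf (p m)) (f l)"
          by (rule measure_pmf.integrable_const_bound[where B=D])
             (use pos in eventually_elim, use f0 fD in auto)
        show "AE t in measure_pmf (p m). \<kappa> i t \<le> f l t"
          using pos by eventually_elim (use f(3) i in \<open>auto simp: \<kappa>_def\<close>)
      qed
      then show "\<exists>M. \<forall>m\<ge>M. measure_pmf.expectation (p (r m)) (\<kappa> i) \<le> (\<integral>t. f l t \<partial>\<nu> (r m))" by blast
    qed
    moreover have "(\<lambda>l. \<integral>t. f l t \<partial>N) \<longlonglongrightarrow> (\<integral>t. mix_kernel k t (x i) \<partial>N)"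
    proof (rule integral_dominated_convergence[where w="\<lambda>_. D"])
      note [measurable_cong] = mixing_measureD(2)[OF N(1)]
      show "f l \<in> borel_measurable N" for l using f(1)[of l] by measurable
      show "(\<lambda>t. mix_kernel k t (x i)) \<in> borel_measurable N" by measurable
      show "integrable N (\<lambda>_. D)" by (rule integrable_bounded_pos[OF N(1), where B="\<bar>D\<bar>"]) auto
      show "AE t in N. (\<lambda>l. f l t) \<longlonglongrightarrow> mix_kernel k t (x i)"
        using mixing_measureD(3)[OF N(1)] by eventually_elim (rule f(6))
      show "AE t in N. norm (f l t) \<le> D" for l
        using mixing_measureD(3)[OF N(1)] by eventually_elim (use f0 fD in auto)
    qed
    ultimately show ?thesis by (intro LIMSEQ_le_const) auto
  qed
  moreover have "(\<Sum>i\<in>I. mix_kernel k t (x i) / L i) \<le> real (card I)" if "0 < t" for t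
  proof -
    have "(\<Sum>i\<in>I. mix_kernel k t (x i) / L i) = (\<Sum>i\<in>I. \<kappa> i t / L i)"
      using that by (intro sum.cong) (auto simp: \<kappa>_def)
    then show ?thesis using stat that by simp
  qed
  ultimately show ?thesis using N L0 by (intro that[of N L]) auto
qed

section \<open>Bernstein's representation of completely monotone functions\<close>

text \<open>
  The second bound multiplies \<open>1 - z / n\<close> by \<open>exp (z / n) \<ge> 1 + z / n\<close> and applies Bernoulli's
  inequality to \<open>(1 - (z / n)\<^sup>2) ^ n\<close>.
\<close>
lemma exp_approx_power:
  fixes z :: real
  assumes "0 \<le> z" "0 < n"
  shows "max 0 (1 - z / real n) ^ n \<le> exp (- z)"
    and "exp (- z) - max 0 (1 - z / real n) ^ n \<le> z\<^sup>2 * exp (- z) / real n"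
proof -
  have n: "0 < real n" using assms by simp
  have e: "exp (- z) = exp (- (z / real n)) ^ n"
    using n by (simp add: exp_of_nat_mult[symmetric])
  have "max 0 (1 - z / real n) \<le> exp (- (z / real n))"
    using exp_ge_add_one_self[of "- (z / real n)"] by auto
  then show "max 0 (1 - z / real n) ^ n \<le> exp (- z)"
    unfolding e by (intro power_mono) auto
  show "exp (- z) - max 0 (1 - z / real n) ^ n \<le> z\<^sup>2 * exp (- z) / real n"
  proof (cases "z \<le> real n")
    case True
    then have r: "0 \<le> 1 - z / real n" using n by simp
    have r2: "0 \<le> 1 - (z / real n)\<^sup>2"
      using assms n True by (simp add: power_le_one)
    have "1 - z\<^sup>2 / real n = 1 + real n * (- (z / real n)\<^sup>2)"
      using n by (simp add: power2_eq_square field_simps)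
    also have "\<dots> \<le> (1 + (- (z / real n)\<^sup>2)) ^ n"
      using r2 by (intro Bernoulli_inequality) auto
    also have "\<dots> = ((1 - z / real n) * (1 + z / real n)) ^ n"
      by (simp add: power2_eq_square algebra_simps)
    also have "\<dots> \<le> ((1 - z / real n) * exp (z / real n)) ^ n"
      using r assms n by (intro power_mono mult_left_mono mult_nonneg_nonneg) auto
    also have "\<dots> = (1 - z / real n) ^ n * exp z"
      using n by (simp add: power_mult_distrib exp_of_nat_mult[symmetric])
    finally have "(1 - z\<^sup>2 / real n) * exp (- z) \<le> (1 - z / real n) ^ n * exp z * exp (- z)"
      by (intro mult_right_mono) auto
    also have "\<dots> = max 0 (1 - z / real n) ^ n"
      using r by (simp add: mult_exp_exp max_def)
    finally show ?thesis by (simp add: algebra_simps)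
  next
    case False
    then have "real n * 1 \<le> z * z" using assms by (intro mult_mono) auto
    then have "1 \<le> z\<^sup>2 / real n" using n by (simp add: power2_eq_square)
    then have "1 * exp (- z) \<le> z\<^sup>2 / real n * exp (- z)" by (intro mult_right_mono) auto
    moreover have "0 \<le> max 0 (1 - z / real n) ^ n" by simp
    moreover have "z\<^sup>2 / real n * exp (- z) = z\<^sup>2 * exp (- z) / real n" by simp
    ultimately show ?thesis by linarith
  qed
qed

text \<open>
  With \<open>t = (m + 1) s\<close> and \<open>z = x / s\<close> the kernel of order \<open>m + 2\<close> is
  \<open>(1 + 1 / (m + 1)) (1 - z / (m + 1))\<^sub>+ ^ (m + 1) / s\<close>, which tends to \<open>exp (- z) / s\<close>. The bound
  does not depend on \<open>t\<close>, because the factor \<open>1 / s = z / x\<close> is absorbed by \<open>exp (- z)\<close>.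
\<close>
lemma kernel_to_exponential:
  assumes "0 < t" "0 < x"
  shows "\<bar>mix_kernel (enat (Suc (Suc m))) t x - mix_kernel \<infinity> (t / real (Suc m)) x\<bar> \<le> 28 / x / real (Suc m)"
proof -
  define n where "n = Suc m"
  define s where "s = t / real n"
  define z where "z = x / s"
  define q where "q = max 0 (1 - z / real n) ^ n"
  have n: "0 < real n" and s: "0 < s" and z: "0 < z" using assms by (auto simp: n_def s_def z_def)
  have t: "t = real n * s" using n by (simp add: s_def)
  have inf: "mix_kernel \<infinity> s x = exp (- z) / s" by (simp add: mix_kernel_def z_def)
  have fin: "mix_kernel (enat (Suc n)) t x = (1 + 1 / real n) * q / s"
  proof (cases "x \<le> t")
    case True
    have eq: "t - x = t * (1 - z / real n)" using s n by (simp add: t z_def field_simps)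
    have "0 \<le> 1 - z / real n" using True s n by (simp add: t z_def field_simps)
    then have "q = (1 - z / real n) ^ n" by (simp add: q_def max_def)
    moreover have "mix_kernel (enat (Suc n)) t x = real (Suc n) * (t * (1 - z / real n)) ^ n / t ^ Suc n"
      using True by (simp add: mix_kernel_Suc eq)
    moreover have "\<dots> = real (Suc n) * (1 - z / real n) ^ n / t"
      using assms by (simp add: power_mult_distrib)
    ultimately have "mix_kernel (enat (Suc n)) t x = real (Suc n) * q / t" by simp
    also have "\<dots> = (1 + 1 / real n) * q / s" using s n by (simp add: t field_simps)
    finally show ?thesis .
  next
    case False
    then have "1 - z / real n \<le> 0" using s n by (simp add: t z_def field_simps)
    then have "q = 0" using n by (simp add: q_def max_def)
    then show ?thesis using False by (simp add: mix_kernel_Suc)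
  qed
  have q: "0 \<le> q" "q \<le> exp (- z)" "exp (- z) - q \<le> z\<^sup>2 * exp (- z) / real n"
    using exp_approx_power[of z n] z n by (auto simp: q_def)
  have "z \<le> exp z" using exp_ge_add_one_self[of z] by linarith
  then have z1: "z * exp (- z) \<le> 1" by (simp add: exp_minus field_simps)
  \<comment> \<open>The constant 28 is the sum of the bounds 27 of \<open>z ^ 3 * exp (- z)\<close> and 1 of \<open>z * exp (- z)\<close>.\<close>
  have z3: "z ^ 3 * exp (- z) \<le> 27" using power_exp_le[of z 3] z by simp
  have inv_s: "1 / s = z / x" using s assms by (simp add: z_def)
  have "(1 + 1 / real n) * q / s - exp (- z) / s = (z / x) * (q / real n - (exp (- z) - q))"
    unfolding inv_s[symmetric] by (simp add: algebra_simps add_divide_distrib diff_divide_distrib)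
  also have "\<bar>\<dots>\<bar> \<le> (z / x) * (exp (- z) / real n + z\<^sup>2 * exp (- z) / real n)"
  proof -
    have "q / real n \<le> exp (- z) / real n" "0 \<le> q / real n"
      using q n by (auto intro: divide_right_mono)
    then have "\<bar>q / real n - (exp (- z) - q)\<bar> \<le> exp (- z) / real n + z\<^sup>2 * exp (- z) / real n"
      using q by linarith
    then show ?thesis
      using z assms by (simp only: abs_mult) (intro mult_mono; simp)
  qed
  also have "\<dots> = (z * exp (- z) + z ^ 3 * exp (- z)) / x / real n"
    by (simp add: algebra_simps add_divide_distrib power3_eq_cube power2_eq_square)
  also have "\<dots> \<le> 28 / x / real n"
    using z1 z3 n assms by (intro divide_right_mono) auto
  finally show ?thesis
    by (simp only: n_def[symmetric] fin inf s_def[symmetric])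
qed

lemma k_monotone_infinity_imp:
  assumes "k_monotone \<infinity> g"
  shows "k_monotone (enat (Suc (Suc m))) g"
proof -
  have d: "(deriv ^^ l) g differentiable_on {0<..}" for l
    using assms by (auto simp: k_monotone_def)
  have s: "0 \<le> (-1) ^ l * (deriv ^^ l) g x" if "0 < x" for l x
    using assms that by (auto simp: k_monotone_def)
  define u where "u l x = (-1) ^ l * (deriv ^^ l) g x" for l x
  have der: "(u l has_real_derivative - u (Suc l) x) (at x)" if "0 < x" for l x
  proof -
    have "((deriv ^^ l) g has_real_derivative (deriv ^^ Suc l) g x) (at x)"
      using differentiable_on_pos[OF d that] by (simp add: DERIV_deriv_iff_real_differentiable)
    then have "((\<lambda>x. (-1) ^ l * (deriv ^^ l) g x) has_real_derivative (-1) ^ l * (deriv ^^ Suc l) g x) (at x)"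
      by (rule DERIV_cmult)
    moreover have "u l = (\<lambda>x. (-1) ^ l * (deriv ^^ l) g x)" by (simp add: u_def fun_eq_iff)
    ultimately show ?thesis by (simp add: u_def)
  qed
  have u0: "0 \<le> u l x" if "0 < x" for l x using s[OF that] by (simp add: u_def)
  have anti: "u l b \<le> u l a" if "0 < a" "a \<le> b" for l a b
  proof (rule DERIV_nonpos_imp_nonincreasing[OF that(2)])
    fix y assume "a \<le> y"
    then have "0 < y" using that(1) by simp
    then show "\<exists>D. (u l has_real_derivative D) (at y) \<and> D \<le> 0"
      using der u0 by (intro exI[of _ "- u (Suc l) y"]) auto
  qed
  have conv: "convex_on {0<..} (u l)" for l
    by (rule convex_on_realI[where f'="\<lambda>x. - u (Suc l) x"]) (auto simp: der anti)
  show ?thesis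
    using d u0 anti conv unfolding k_monotone_def u_def
    by (auto simp: monotone_on_def)
qed

text \<open>
  A completely monotone \<open>g\<close> has a Williamson measure of mass \<open>c = \<integral> g\<close> for every order
  \<open>m + 2\<close>. Rescaled by \<open>m + 1\<close> and normalised, these measures \<open>P m\<close> have a vague limit, and as the
  kernels converge uniformly, the limit represents \<open>g\<close>.
\<close>
theorem bernstein:
  assumes g: "g \<in> k_monotone_L1 \<infinity>"
  obtains \<nu> where "mixing_measure \<nu>" "\<And>x. 0 < x \<Longrightarrow> ennreal (g x) = mixture \<infinity> \<nu> x"
proof -
  define c where "c = (LINT x|lebesgue_pos. g x)"
  have km: "k_monotone \<infinity> g" and int: "integrable lebesgue_pos g"
    using g by (auto simp: k_monotone_L1_def k_monotone_class_def)
  have c0: "0 \<le> c" unfolding c_def by (rule integral_k_monotone_L1_nonneg[OF g])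
  show ?thesis
  proof (cases "c = 0")
    case True
    have "mixing_measure (null_measure borel)"
      unfolding mixing_measure_def by (auto intro!: finite_measureI)
    moreover have "ennreal (g x) = mixture \<infinity> (null_measure borel) x" if "0 < x" for x
    proof -
      have "g x \<le> 0" using k_monotone_L1_le[OF g that] True by (simp add: c_def)
      then show ?thesis using k_monotone_nonneg[OF km that] by (simp add: mixture_def)
    qed
    ultimately show ?thesis by (rule that)
  next
    case False
    then have c: "0 < c" using c0 by simp
    have "\<exists>\<nu>. mixing_measure \<nu> \<and> emeasure \<nu> UNIV = ennreal c \<and>
      (\<forall>x>0. ennreal (g x) = mixture (enat (Suc (Suc m))) \<nu> x)" for m
    proof -
      have gm: "g \<in> k_monotone_L1 (enat (Suc (Suc m)))"
        using k_monotone_infinity_imp[OF km] int by (simp add: k_monotone_L1_def k_monotone_class_def)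
      obtain \<nu> where "mixing_measure \<nu>" "emeasure \<nu> UNIV = ennreal c"
        "\<And>x. 0 < x \<Longrightarrow> Suc m \<noteq> 0 \<or> emeasure \<nu> {x} = 0 \<Longrightarrow> ennreal (g x) = mixture (enat (Suc (Suc m))) \<nu> x"
        using williamson[OF gm] unfolding c_def by metis
      then show ?thesis by auto
    qed
    then obtain \<nu> where \<nu>: "\<And>m. mixing_measure (\<nu> m)" "\<And>m. emeasure (\<nu> m) UNIV = ennreal c"
      "\<And>m x. 0 < x \<Longrightarrow> ennreal (g x) = mixture (enat (Suc (Suc m))) (\<nu> m) x"
      by metis
    note D = mixing_measureD[OF \<nu>(1)]
    note [measurable_cong] = D(2)
    define P where "P m = distr (density (\<nu> m) (\<lambda>_. ennreal (1 / c))) borel (\<lambda>t. t / real (Suc m))" for m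
    have setsP: "sets (P m) = sets borel" for m by (simp add: P_def)
    have emP: "emeasure (P m) A = ennreal (1 / c) * emeasure (\<nu> m) ((\<lambda>t. t / real (Suc m)) -` A)"
      if [measurable]: "A \<in> sets borel" for m A
    proof -
      have 1: "(\<lambda>t. t / real (Suc m)) -` A \<in> sets borel"
        by (rule measurable_sets_borel) measurable
      have "emeasure (P m) A = emeasure (density (\<nu> m) (\<lambda>_. ennreal (1 / c))) ((\<lambda>t. t / real (Suc m)) -` A)"
        unfolding P_def by (subst emeasure_distr) (auto simp: D)
      also have "\<dots> = ennreal (1 / c) * emeasure (\<nu> m) ((\<lambda>t. t / real (Suc m)) -` A)"
        using 1 by (subst emeasure_density) (auto simp: D nn_integral_cmult_indicator)
      finally show ?thesis .
    qed
    have P1: "prob_space (P m)" for m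
    proof
      have "space (P m) = UNIV" by (simp add: P_def)
      then show "emeasure (P m) (space (P m)) = 1"
        using c by (simp add: emP \<nu>(2) ennreal_mult[symmetric])
    qed
    have P0: "emeasure (P m) {..0} = 0" for m
    proof -
      have "t / real (Suc m) \<le> 0 \<longleftrightarrow> t \<le> 0" for t
        using pos_divide_le_eq[of "real (Suc m)" t 0] by simp
      then have "(\<lambda>t. t / real (Suc m)) -` {..0} = {..0}" by blast
      then show ?thesis using \<nu>(1)[of m] by (simp add: emP mixing_measure_def)
    qed
    obtain r N where r: "strict_mono (r :: nat \<Rightarrow> nat)" and N: "mixing_measure N" "emeasure N UNIV \<le> 1"
      and conv: "\<And>f C. f \<in> borel_measurable borel \<Longrightarrow> continuous_on {0<..} f \<Longrightarrow>
       (\<And>t. 0 < t \<Longrightarrow> \<bar>f t\<bar> \<le> C * t) \<Longrightarrow> (\<And>t. 0 < t \<Longrightarrow> \<bar>f t\<bar> \<le> C / t) \<Longrightarrow>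
       (\<lambda>m. \<integral>t. f t \<partial>P (r m)) \<longlonglongrightarrow> (\<integral>t. f t \<partial>N)"
      using vague_compactness[of P, OF P1 setsP P0] by blast
    have g_eq: "g x = c * (\<integral>t. mix_kernel \<infinity> t x \<partial>N)" if x: "0 < x" for x
    proof -
      let ?K = "\<lambda>m t. mix_kernel (enat (Suc (Suc m))) t x" and ?E = "\<lambda>t. mix_kernel \<infinity> t x"
      obtain C where C: "\<And>t. 0 < t \<Longrightarrow> ?E t \<le> C * t" "\<And>t. 0 < t \<Longrightarrow> ?E t \<le> C / t"
        using mix_kernel_bounds[of \<infinity> x] x by auto
      have lim1: "(\<lambda>m. \<integral>t. ?E t \<partial>P (r m)) \<longlonglongrightarrow> (\<integral>t. ?E t \<partial>N)"
        by (rule conv[where C=C])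
           (use C mix_kernel_nonneg in \<open>auto intro!: continuous_on_mix_kernel simp: one_enat_def\<close>)
      have intP: "c * (\<integral>t. ?E t \<partial>P m) = (\<integral>t. ?E (t / real (Suc m)) \<partial>\<nu> m)" for m
      proof -
        have "(\<integral>t. ?E t \<partial>P m)
            = (\<integral>t. ?E (t / real (Suc m)) \<partial>density (\<nu> m) (\<lambda>_. ennreal (1 / c)))"
          unfolding P_def by (rule integral_distr) measurable
        also have "\<dots> = (\<integral>t. (1 / c) *\<^sub>R ?E (t / real (Suc m)) \<partial>\<nu> m)"
          using c by (intro integral_density) auto
        finally show ?thesis using c by simp
      qed
      have int1: "integrable (\<nu> m) (\<lambda>t. ?K m t)" for m
        by (rule integrable_mix_kernel[OF \<nu>(1) _ x]) (simp add: one_enat_def)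
      have int2: "integrable (\<nu> m) (\<lambda>t. ?E (t / real (Suc m)))" for m
      proof (rule integrable_bounded_pos[OF \<nu>(1)])
        fix t :: real assume "0 < t"
        then have t: "0 < t / real (Suc m)" by simp
        show "\<bar>?E (t / real (Suc m))\<bar> \<le> C"
          using le_of_two_bounds[OF C(1)[OF t] C(2)[OF t] t mix_kernel_nonneg[OF t]]
            mix_kernel_nonneg[OF t, of \<infinity> x] by simp
      qed measurable
      have g_m: "g x = (\<integral>t. ?K m t \<partial>\<nu> m)" for m
      proof -
        have "ennreal (g x) = ennreal (\<integral>t. ?K m t \<partial>\<nu> m)"
          unfolding \<nu>(3)[OF x, of m] by (rule mixture_eq_integral[OF \<nu>(1) _ x]) (simp add: one_enat_def)
        moreover have "0 \<le> (\<integral>t. ?K m t \<partial>\<nu> m)"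
          by (rule integral_nonneg_AE) (use D(3) in eventually_elim, rule mix_kernel_nonneg)
        ultimately show ?thesis using k_monotone_nonneg[OF km x] by simp
      qed
      have close: "\<bar>g x - c * (\<integral>t. ?E t \<partial>P m)\<bar> \<le> 28 * c / x * inverse (real (Suc m))" for m
      proof -
        interpret finite_measure "\<nu> m" by (rule D)
        have "g x - c * (\<integral>t. ?E t \<partial>P m)
          = (\<integral>t. ?K m t - ?E (t / real (Suc m)) \<partial>\<nu> m)"
          unfolding intP g_m[of m] by (rule Bochner_Integration.integral_diff[OF int1 int2, symmetric])
        also have "\<bar>\<dots>\<bar> \<le> (\<integral>t. \<bar>?K m t - ?E (t / real (Suc m))\<bar> \<partial>\<nu> m)"
          by (rule integral_abs_bound)
        also have "\<dots> \<le> (\<integral>t. 28 / x / real (Suc m) \<partial>\<nu> m)"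
        proof (rule integral_mono_AE)
          show "integrable (\<nu> m) (\<lambda>t. \<bar>?K m t - ?E (t / real (Suc m))\<bar>)"
            by (intro integrable_abs Bochner_Integration.integrable_diff int1 int2)
          show "AE t in \<nu> m. \<bar>?K m t - ?E (t / real (Suc m))\<bar>
              \<le> 28 / x / real (Suc m)"
            using D(3)[of m] by eventually_elim (rule kernel_to_exponential[OF _ x])
        qed simp
        also have "\<dots> = 28 * c / x * inverse (real (Suc m))"
        proof -
          have "measure (\<nu> m) UNIV = c"
            using \<nu>(2)[of m] c by (simp add: measure_def)
          then show ?thesis
            by (simp only: Bochner_Integration.lebesgue_integral_const D(4) real_scaleR_def divide_inverse mult_ac)
        qed
        finally show ?thesis .
      qed
      have "(\<lambda>m. 28 * c / x * inverse (real (Suc m))) \<longlonglongrightarrow> 28 * c / x * 0"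
        by (intro tendsto_intros LIMSEQ_inverse_real_of_nat)
      then have null: "(\<lambda>m. 28 * c / x * inverse (real (Suc m))) \<longlonglongrightarrow> 0" by simp
      have "(\<lambda>m. g x - c * (\<integral>t. ?E t \<partial>P m)) \<longlonglongrightarrow> 0"
        by (rule Lim_null_comparison[OF always_eventually null]) (intro allI, simp only: real_norm_def close)
      from LIMSEQ_subseq_LIMSEQ[OF this r]
      have "(\<lambda>m. g x - c * (\<integral>t. ?E t \<partial>P (r m))) \<longlonglongrightarrow> 0" by (simp add: o_def)
      moreover have "(\<lambda>m. g x - c * (\<integral>t. ?E t \<partial>P (r m)))
          \<longlonglongrightarrow> g x - c * (\<integral>t. ?E t \<partial>N)"
        by (intro tendsto_intros lim1)
      ultimately have "g x - c * (\<integral>t. ?E t \<partial>N) = 0"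
        using LIMSEQ_unique by blast
      then show ?thesis by simp
    qed
    note DN = mixing_measureD[OF N(1)]
    note [measurable_cong] = DN(2)
    define N' where "N' = density N (\<lambda>_. ennreal c)"
    have "mixing_measure N'"
      unfolding mixing_measure_def
    proof (intro conjI)
      interpret N: finite_measure N by (rule DN)
      show "finite_measure N'"
        unfolding N'_def by (rule finite_measureI) (simp add: emeasure_density_const ennreal_mult_eq_top_iff N.emeasure_eq_measure)
      show "sets N' = sets borel" by (simp add: N'_def DN)
      show "emeasure N' {..0} = 0"
        using N by (simp add: N'_def emeasure_density_const DN mixing_measure_def)
    qed
    moreover have "ennreal (g x) = mixture \<infinity> N' x" if x: "0 < x" for x
    proof -
      have "mixture \<infinity> N' x = (\<integral>\<^sup>+t. ennreal c * ennreal (mix_kernel \<infinity> t x) \<partial>N)"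
        unfolding mixture_def N'_def by (rule nn_integral_density) measurable
      also have "\<dots> = ennreal c * mixture \<infinity> N x"
        unfolding mixture_def by (rule nn_integral_cmult) measurable
      also have "\<dots> = ennreal (g x)"
        using c x by (simp add: mixture_eq_integral[OF N(1)] g_eq ennreal_mult'[symmetric])
      finally show ?thesis ..
    qed
    ultimately show ?thesis by (rule that)
  qed
qed

section \<open>Finiteness of the contact set\<close>

text \<open>
  The solutions are bounded, as \<open>s * exp (- x i * s)\<close> is at most a multiple of \<open>1 / s\<close>. Infinitely
  many would accumulate and force the entire function \<open>F\<close> to vanish identically, whereas
  \<open>F 0 = - b\<close>.
\<close>
lemma finite_exponential_sum_solutions:
  fixes x c :: "'i \<Rightarrow> real"
  assumes I: "finite I" and x: "\<And>i. i \<in> I \<Longrightarrow> 0 < x i" and c: "\<And>i. i \<in> I \<Longrightarrow> 0 \<le> c i" and b: "0 < b"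
  shows "finite {s. 0 < s \<and> (\<Sum>i\<in>I. c i * (s * exp (- x i * s))) = b}" (is "finite ?Z")
proof (rule ccontr)
  assume inf: "infinite ?Z"
  define F where "F z = (\<Sum>i\<in>I. of_real (c i) * (z * exp (- of_real (x i) * z))) - of_real b" for z :: complex
  define U where "U = complex_of_real ` ?Z"
  have "inj_on complex_of_real ?Z" by (rule inj_onI) simp
  with inf have "infinite U" unfolding U_def using finite_imageD by blast
  define B where "B = (\<Sum>i\<in>I. c i * (4 / (x i)\<^sup>2)) / b"
  have sq: "y\<^sup>2 * exp (- y) \<le> 4" if "0 \<le> y" for y :: real
    using power_exp_le[of y 2] that by simp
  have "s \<le> B" if s: "s \<in> ?Z" for s
  proof -
    have s0: "0 < s" using s by simp
    have "b * s = (\<Sum>i\<in>I. c i * (s * exp (- x i * s))) * s" using s by simp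
    also have "\<dots> = (\<Sum>i\<in>I. c i * ((x i * s)\<^sup>2 * exp (- (x i * s)) / (x i)\<^sup>2))"
      unfolding sum_distrib_right
    proof (rule sum.cong[OF refl])
      fix i assume "i \<in> I"
      then have "x i \<noteq> 0" using x[of i] by simp
      then show "c i * (s * exp (- x i * s)) * s = c i * ((x i * s)\<^sup>2 * exp (- (x i * s)) / (x i)\<^sup>2)"
        by (simp add: power2_eq_square)
    qed
    also have "\<dots> \<le> (\<Sum>i\<in>I. c i * (4 / (x i)\<^sup>2))"
      using x c s0 by (intro sum_mono mult_left_mono divide_right_mono sq) (auto intro: less_imp_le)
    finally show ?thesis using b by (simp add: B_def field_simps)
  qed
  then have "U \<subseteq> cball 0 B" by (auto simp: U_def)
  with \<open>infinite U\<close> obtain \<xi> where "\<xi> islimpt U"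
    using compact_eq_Bolzano_Weierstrass[of "cball (0::complex) B"] by auto
  have "F 0 = 0"
  proof (rule analytic_continuation[where f=F and S=UNIV and U=U and \<xi>=\<xi>])
    show "F holomorphic_on UNIV" unfolding F_def by (intro holomorphic_intros)
    fix z assume "z \<in> U"
    then obtain s where s: "s \<in> ?Z" "z = of_real s" by (auto simp: U_def)
    have "F z = of_real ((\<Sum>i\<in>I. c i * (s * exp (- x i * s))) - b)"
      by (simp add: F_def s(2) exp_of_real[symmetric])
    moreover have "(\<Sum>i\<in>I. c i * (s * exp (- x i * s))) - b = 0" using s(1) by simp
    ultimately show "F z = 0" by (simp only: of_real_0)
  qed (use \<open>\<xi> islimpt U\<close> in auto)
  then show False using b by (simp add: F_def)
qed

text \<open>
  The difference of the two sides is a polynomial with leading term \<open>t ^ Suc m\<close>.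
\<close>
lemma finite_power_sum_solutions:
  fixes x c :: "'i \<Rightarrow> real"
  assumes I: "finite I"
  shows "finite {t. t ^ Suc m = (\<Sum>i\<in>I. c i * (t - x i) ^ m)}"
proof -
  define q where "q = (\<Sum>i\<in>I. smult (c i) ([:- x i, 1:] ^ m))"
  have "degree q \<le> m"
    unfolding q_def
  proof (rule degree_sum_le[OF I])
    fix i
    have "degree (smult (c i) ([:- x i, 1:] ^ m)) \<le> degree ([:- x i, 1:] ^ m)"
      by (rule degree_smult_le)
    also have "\<dots> \<le> degree [:- x i, 1:] * m" by (rule degree_power_le)
    finally show "degree (smult (c i) ([:- x i, 1:] ^ m)) \<le> m" by simp
  qed
  then have "coeff (monom 1 (Suc m) - q) (Suc m) = 1"
    by (simp add: coeff_eq_0)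
  then have "monom 1 (Suc m) - q \<noteq> 0" by auto
  then have "finite {t. poly (monom 1 (Suc m) - q) t = 0}" by (rule poly_roots_finite)
  moreover have peq: "poly (monom 1 (Suc m) - q) t = t ^ Suc m - (\<Sum>i\<in>I. c i * (t - x i) ^ m)" for t
    by (simp add: q_def poly_monom poly_sum poly_power)
  ultimately show ?thesis
    by (simp only: right_minus_eq)
qed

text \<open>
  For finite \<open>k\<close> the points are sorted by the set \<open>J\<close> of those \<open>x i\<close> that are at most \<open>t\<close>: on each
  class the kernels are rational functions of \<open>t\<close>. For \<open>k = \<infinity>\<close> the variable is changed to
  \<open>1 / t\<close>.
\<close>
theorem finite_contact_set:
  fixes x c :: "'i \<Rightarrow> real"
  assumes k: "1 \<le> k" and I: "finite I" and x: "\<And>i. i \<in> I \<Longrightarrow> 0 < x i"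
    and c: "\<And>i. i \<in> I \<Longrightarrow> 0 \<le> c i" and b: "0 < b"
  shows "finite {t. 0 < t \<and> (\<Sum>i\<in>I. c i * mix_kernel k t (x i)) = b}" (is "finite ?Z")
  using k
proof (rule enat_cases_pos)
  fix m assume km: "k = enat (Suc m)"
  let ?U = "\<Union>J\<in>Pow I. {t. t ^ Suc m = (\<Sum>i\<in>J. c i * real (Suc m) / b * (t - x i) ^ m)}"
  have "?Z \<subseteq> ?U"
  proof
    fix t assume t: "t \<in> ?Z"
    define J where "J = {i \<in> I. x i \<le> t}"
    have "b = (\<Sum>i\<in>I. c i * mix_kernel k t (x i))" using t by simp
    also have "\<dots> = (\<Sum>i\<in>J. c i * mix_kernel k t (x i))"
      unfolding J_def using I by (intro sum.mono_neutral_right) (auto simp: km mix_kernel_Suc)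
    also have "\<dots> = (\<Sum>i\<in>J. c i * real (Suc m) * (t - x i) ^ m) / t ^ Suc m"
      unfolding sum_divide_distrib by (intro sum.cong) (auto simp: J_def km mix_kernel_Suc)
    finally have "b * t ^ Suc m = (\<Sum>i\<in>J. c i * real (Suc m) * (t - x i) ^ m)"
      using t by (simp add: field_simps)
    then have "t ^ Suc m = (\<Sum>i\<in>J. c i * real (Suc m) * (t - x i) ^ m) / b"
      using b by (metis nonzero_mult_div_cancel_left less_irrefl)
    also have "\<dots> = (\<Sum>i\<in>J. c i * real (Suc m) / b * (t - x i) ^ m)"
      unfolding sum_divide_distrib by simp
    finally show "t \<in> ?U"
      by (auto simp: J_def intro!: bexI[of _ J])
  qed
  moreover have "finite ?U"
    using I by (intro finite_UN_I finite_power_sum_solutions) (auto intro: finite_subset)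
  ultimately show ?thesis by (rule finite_subset)
next
  assume k: "k = \<infinity>"
  let ?S = "{s. 0 < s \<and> (\<Sum>i\<in>I. c i * (s * exp (- x i * s))) = b}"
  have "?Z \<subseteq> inverse ` ?S"
  proof
    fix t assume t: "t \<in> ?Z"
    have "(\<Sum>i\<in>I. c i * (inverse t * exp (- x i * inverse t))) = b"
      using t by (simp add: k mix_kernel_def divide_inverse mult.commute)
    then show "t \<in> inverse ` ?S"
      using t by (intro image_eqI[of _ _ "inverse t"]) auto
  qed
  moreover have "finite (inverse ` ?S)"
    by (intro finite_imageI finite_exponential_sum_solutions I x c b)
  ultimately show ?thesis by (rule finite_subset)
qed

section \<open>Finite mixtures are k-monotone densities\<close>

lemma DERIV_pos_part_power:
  fixes z x :: real
  shows "((\<lambda>x. max (z - x) 0 ^ Suc (Suc q)) has_real_derivative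
    - (real (Suc (Suc q)) * max (z - x) 0 ^ Suc q)) (at x)"
proof -
  consider "x < z" | "z < x" | "x = z" by linarith
  then show ?thesis
  proof cases
    case 1
    have "((\<lambda>x. (z - x) ^ Suc (Suc q)) has_real_derivative (1 + real (Suc q)) * ((0 - 1) * (z - x) ^ Suc q)) (at x)"
      by (intro DERIV_power_Suc derivative_intros)
    also have "(1 + real (Suc q)) * ((0 - 1) * (z - x) ^ Suc q) = - (real (Suc (Suc q)) * max (z - x) 0 ^ Suc q)"
      using 1 by (simp add: max_def)
    finally show ?thesis
      by (rule has_field_derivative_transform_within_open[of _ _ _ "{..<z}"]) (use 1 in auto)
  next
    case 2
    have "((\<lambda>_. 0) has_real_derivative - (real (Suc (Suc q)) * max (z - x) 0 ^ Suc q)) (at x)"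
      using 2 by (auto simp: max_def)
    then show ?thesis
      by (rule has_field_derivative_transform_within_open[of _ _ _ "{z<..}"]) (use 2 in auto)
  next
    case 3
    have "((\<lambda>h. (max (z - (z + h)) 0 ^ Suc (Suc q) - max (z - z) 0 ^ Suc (Suc q)) / h) \<longlongrightarrow> 0) (at 0)"
    proof (rule Lim_null_comparison)
      have "\<bar>max (- h) 0 ^ Suc (Suc q) / h\<bar> \<le> \<bar>h\<bar> ^ Suc q" if "h \<noteq> 0" for h :: real
      proof -
        have "max (- h) 0 ^ Suc (Suc q) \<le> \<bar>h\<bar> ^ Suc (Suc q)" by (intro power_mono) auto
        then have "max (- h) 0 ^ Suc (Suc q) / \<bar>h\<bar> \<le> \<bar>h\<bar> ^ Suc (Suc q) / \<bar>h\<bar>" by (intro divide_right_mono) auto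
        then show ?thesis using that by (simp add: abs_mult)
      qed
      then show "\<forall>\<^sub>F h in at 0. norm ((max (z - (z + h)) 0 ^ Suc (Suc q) - max (z - z) 0 ^ Suc (Suc q)) / h) \<le> \<bar>h\<bar> ^ Suc q"
        by (auto simp: eventually_at_filter)
      have "((\<lambda>h::real. \<bar>h\<bar> ^ Suc q) \<longlongrightarrow> \<bar>0\<bar> ^ Suc q) (at 0)" by (intro tendsto_intros)
      then show "((\<lambda>h::real. \<bar>h\<bar> ^ Suc q) \<longlongrightarrow> 0) (at 0)" by simp
    qed
    then show ?thesis using 3 by (simp add: DERIV_def)
  qed
qed

lemma convex_on_pos_part_power:
  fixes z :: real
  shows "convex_on UNIV (\<lambda>x. max (z - x) 0 ^ Suc q)"
proof (cases q)
  case 0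
  show ?thesis
  proof (rule convex_onI)
    fix t x y :: real assume t: "0 < t" "t < 1"
    have "(1 - t) * (z - x) \<le> (1 - t) * max (z - x) 0" "t * (z - y) \<le> t * max (z - y) 0"
      using t by (auto intro!: mult_left_mono)
    moreover have "0 \<le> (1 - t) * max (z - x) 0" "0 \<le> t * max (z - y) 0"
      using t by auto
    ultimately have "z - ((1 - t) * x + t * y) \<le> (1 - t) * max (z - x) 0 + t * max (z - y) 0"
      "0 \<le> (1 - t) * max (z - x) 0 + t * max (z - y) 0"
      by (auto simp: algebra_simps)
    then show "max (z - ((1 - t) *\<^sub>R x + t *\<^sub>R y)) 0 ^ Suc q
        \<le> (1 - t) * max (z - x) 0 ^ Suc q + t * max (z - y) 0 ^ Suc q"
      using 0 by simp
  qed simp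
next
  case (Suc p)
  show ?thesis
    unfolding Suc
    by (rule convex_on_realI[OF _ DERIV_pos_part_power])
       (auto intro!: mult_left_mono power_mono simp del: power_Suc)
qed

lemma convex_on_sum_functions:
  assumes "finite I" "\<And>i. i \<in> I \<Longrightarrow> convex_on S (f i)" "convex S"
  shows "convex_on S (\<lambda>x. \<Sum>i\<in>I. f i x)"
  using assms
proof (induction I rule: finite_induct)
  case empty
  then show ?case by (simp add: convex_on_const)
next
  case (insert i I)
  then show ?case by (auto intro!: convex_on_add)
qed

lemma k_monotone_spline:
  fixes C :: "real \<Rightarrow> real"
  assumes Z: "finite Z" and C: "\<And>z. z \<in> Z \<Longrightarrow> 0 \<le> C z"
  shows "k_monotone (enat (Suc (Suc n))) (\<lambda>x. \<Sum>z\<in>Z. C z * max (z - x) 0 ^ Suc n)" (is "k_monotone _ ?g")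
proof -
  define g where "g = ?g"
  \<comment> \<open>\<open>u l\<close> is \<open>(-1) ^ l\<close> times the \<open>l\<close>-th derivative for \<open>l \<le> n\<close>.\<close>
  define u where "u l x = (\<Sum>z\<in>Z. C z * (fact (Suc n) / fact (Suc n - l)) * max (z - x) 0 ^ (Suc n - l))"
    for l and x :: real
  have der: "(u l has_real_derivative - u (Suc l) x) (at x)" if l: "l < n" for l x
  proof -
    define p where "p = n - Suc l"
    have p: "Suc n - l = Suc (Suc p)" "Suc n - Suc l = Suc p" using l unfolding p_def by linarith+
    have "(u l has_real_derivative (\<Sum>z\<in>Z. C z * (fact (Suc n) / fact (Suc (Suc p))) *
        (- (real (Suc (Suc p)) * max (z - x) 0 ^ Suc p)))) (at x)"
      unfolding u_def p by (intro DERIV_sum DERIV_cmult DERIV_pos_part_power)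
    also have "(\<Sum>z\<in>Z. C z * (fact (Suc n) / fact (Suc (Suc p))) *
        (- (real (Suc (Suc p)) * max (z - x) 0 ^ Suc p))) = - u (Suc l) x"
      unfolding u_def p sum_negf[symmetric]
    proof (rule sum.cong[OF refl])
      fix z
      have "fact (Suc n) / fact (Suc (Suc p)) * real (Suc (Suc p)) = (fact (Suc n) / fact (Suc p) :: real)"
        by (subst fact_Suc[of "Suc p"]) (simp del: fact_Suc of_nat_Suc)
      then show "C z * (fact (Suc n) / fact (Suc (Suc p))) * (- (real (Suc (Suc p)) * max (z - x) 0 ^ Suc p))
        = - (C z * (fact (Suc n) / fact (Suc p)) * max (z - x) 0 ^ Suc p)"
        by (simp only: mult_minus_right mult.assoc[symmetric] mult.assoc[of "C z" "fact (Suc n) / fact (Suc (Suc p))" "real (Suc (Suc p))"])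
    qed
    finally show ?thesis .
  qed
  have deriv_eq: "(deriv ^^ l) g = (\<lambda>x. (-1) ^ l * u l x)" if "l \<le> n" for l
    using that
  proof (induction l)
    case 0
    then show ?case by (simp add: u_def g_def)
  next
    case (Suc l)
    have "deriv (\<lambda>x. (-1) ^ l * u l x) x = (-1) ^ l * - u (Suc l) x" for x
      using Suc.prems by (intro DERIV_imp_deriv DERIV_cmult der) auto
    then have "deriv (\<lambda>x. (-1) ^ l * u l x) = (\<lambda>x. (-1) ^ Suc l * u (Suc l) x)" by auto
    moreover have "(deriv ^^ l) g = (\<lambda>x. (-1) ^ l * u l x)" using Suc by simp
    ultimately show ?case by (simp only: funpow.simps o_apply)
  qed
  have u_eq: "(-1) ^ l * (deriv ^^ l) g x = u l x" if "l \<le> n" for l x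
    using deriv_eq[OF that] by (simp add: mult.assoc[symmetric] power_mult_distrib[symmetric])
  have coeff: "0 \<le> C z * (fact (Suc n) / fact (Suc n - l))" if "z \<in> Z" for z l
    using C[OF that] by simp
  have "(deriv ^^ l) g differentiable_on {0<..}" if "l < n" for l
  proof -
    have "(\<lambda>x. (-1) ^ l * u l x) differentiable at x" for x
      using DERIV_cmult[OF der[OF that]] unfolding real_differentiable_def by blast
    then show ?thesis
      using that by (simp only: deriv_eq less_imp_le differentiable_on_def differentiable_at_withinI) simp
  qed
  moreover have "0 \<le> u l x" for l x
    unfolding u_def by (intro sum_nonneg mult_nonneg_nonneg coeff) auto
  moreover have "u l b \<le> u l a" if "a \<le> b" for l a b
    unfolding u_def using that
    by (intro sum_mono mult_left_mono power_mono coeff) auto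
  moreover have "convex_on {0<..} (u l)" if l: "l \<le> n" for l
  proof -
    obtain p where p: "Suc n - l = Suc p" using l by (metis Suc_diff_le)
    show ?thesis
      unfolding u_def
      by (intro convex_on_sum_functions Z convex_on_cmul coeff)
         (auto simp: p simp del: power_Suc intro: convex_on_subset[OF convex_on_pos_part_power])
  qed
  ultimately have "k_monotone (enat (Suc (Suc n))) g"
    unfolding k_monotone_def by (simp add: u_eq monotone_on_def)
  then show ?thesis by (simp only: g_def)
qed

lemma k_monotone_exponential_sum:
  fixes C :: "real \<Rightarrow> real"
  assumes Z: "finite Z" and C: "\<And>z. z \<in> Z \<Longrightarrow> 0 \<le> C z \<and> 0 < z"
  shows "k_monotone \<infinity> (\<lambda>x. \<Sum>z\<in>Z. C z * exp (- x / z))" (is "k_monotone _ ?g")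
proof -
  define g where "g = ?g"
  \<comment> \<open>\<open>u l\<close> is \<open>(-1) ^ l\<close> times the \<open>l\<close>-th derivative.\<close>
  define u where "u l x = (\<Sum>z\<in>Z. C z * (1 / z) ^ l * exp (- x / z))" for l and x :: real
  have der: "(u l has_real_derivative - u (Suc l) x) (at x)" for l x
    unfolding u_def sum_negf[symmetric]
  proof (rule DERIV_sum)
    fix z assume "z \<in> Z"
    then have "z \<noteq> 0" using C[of z] by simp
    then show "((\<lambda>x. C z * (1 / z) ^ l * exp (- x / z)) has_real_derivative
        - (C z * (1 / z) ^ Suc l * exp (- x / z))) (at x)"
      by (auto intro!: derivative_eq_intros)
  qed
  have deriv_eq: "(deriv ^^ l) g = (\<lambda>x. (-1) ^ l * u l x)" for l
  proof (induction l)
    case 0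
    then show ?case by (simp add: u_def g_def)
  next
    case (Suc l)
    have "deriv (\<lambda>x. (-1) ^ l * u l x) x = (-1) ^ l * - u (Suc l) x" for x
      by (intro DERIV_imp_deriv DERIV_cmult der)
    then have "deriv (\<lambda>x. (-1) ^ l * u l x) = (\<lambda>x. (-1) ^ Suc l * u (Suc l) x)" by auto
    moreover have "(deriv ^^ l) g = (\<lambda>x. (-1) ^ l * u l x)" using Suc by simp
    ultimately show ?case by (simp only: funpow.simps o_apply)
  qed
  have "(deriv ^^ l) g differentiable_on {0<..}" for l
  proof -
    have "(\<lambda>x. (-1) ^ l * u l x) differentiable at x" for x
      using DERIV_cmult[OF der] unfolding real_differentiable_def by blast
    then show ?thesis
      by (simp only: deriv_eq differentiable_on_def differentiable_at_withinI) simp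
  qed
  moreover have "(-1) ^ l * (deriv ^^ l) g x = u l x" for l x
    by (simp add: deriv_eq mult.assoc[symmetric] power_mult_distrib[symmetric])
  moreover have "0 \<le> u l x" for l x
    unfolding u_def using C by (intro sum_nonneg mult_nonneg_nonneg) (auto intro: less_imp_le)
  ultimately have "k_monotone (\<infinity>) g"
    unfolding k_monotone_def by simp
  then show ?thesis by (simp only: g_def)
qed

theorem finite_mixture_density:
  fixes w :: "real \<Rightarrow> real"
  assumes k: "1 \<le> k" and Z: "finite Z" and w: "\<And>z. z \<in> Z \<Longrightarrow> 0 \<le> w z \<and> 0 < z" and sum1: "(\<Sum>z\<in>Z. w z) = 1"
  shows "(\<lambda>x. \<Sum>z\<in>Z. w z * mix_kernel k z x) \<in> k_monotone_densities k" (is "?g \<in> _")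
proof -
  have km: "k_monotone k ?g"
    using k
  proof (rule enat_cases_pos)
    fix i assume i: "k = enat (Suc i)"
    show ?thesis
    proof (cases i)
      case 0
      have "0 \<le> ?g x" for x
        using w by (intro sum_nonneg mult_nonneg_nonneg mix_kernel_nonneg) auto
      moreover have "?g b \<le> ?g a" if "a \<le> b" for a b
        using that w by (intro sum_mono mult_left_mono) (auto simp: i 0 mix_kernel_Suc intro: less_imp_le)
      ultimately show ?thesis by (simp add: k_monotone_def i 0 monotone_on_def)
    next
      case (Suc n)
      have eq: "?g = (\<lambda>x. \<Sum>z\<in>Z. (w z * real (Suc i) / z ^ Suc i) * max (z - x) 0 ^ Suc n)"
        by (intro ext sum.cong) (auto simp: i Suc mix_kernel_def trunc_pow_def)
      have "k_monotone (enat (Suc (Suc n)))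
          (\<lambda>x. \<Sum>z\<in>Z. (w z * real (Suc i) / z ^ Suc i) * max (z - x) 0 ^ Suc n)"
        by (rule k_monotone_spline[OF Z]) (use w in \<open>auto intro!: divide_nonneg_pos mult_nonneg_nonneg\<close>)
      then show ?thesis unfolding eq by (simp only: i Suc)
    qed
  next
    assume i: "k = \<infinity>"
    have eq: "?g = (\<lambda>x. \<Sum>z\<in>Z. (w z / z) * exp (- x / z))"
      by (intro ext sum.cong) (auto simp: i mix_kernel_def)
    have "k_monotone \<infinity> (\<lambda>x. \<Sum>z\<in>Z. (w z / z) * exp (- x / z))"
      by (rule k_monotone_exponential_sum[OF Z]) (use w in \<open>auto intro!: divide_nonneg_pos\<close>)
    then show ?thesis unfolding eq by (simp only: i)
  qed
  have meas: "?g \<in> borel_measurable lebesgue_pos"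
    unfolding lebesgue_pos_def by (rule measurable_restrict_space1) measurable
  have nonneg: "0 \<le> ?g x" for x
    using w by (intro sum_nonneg mult_nonneg_nonneg mix_kernel_nonneg) auto
  have "(\<integral>\<^sup>+x. ennreal (?g x) \<partial>lebesgue_pos)
      = (\<integral>\<^sup>+x. (\<Sum>z\<in>Z. ennreal (w z) * (ennreal (mix_kernel k z x) * indicator {0<..} x)) \<partial>lborel)"
    unfolding nn_integral_lebesgue_pos
  proof (rule nn_integral_cong)
    fix x
    have "ennreal (?g x) = (\<Sum>z\<in>Z. ennreal (w z) * ennreal (mix_kernel k z x))"
      using w by (subst sum_ennreal[symmetric])
        (auto intro!: mult_nonneg_nonneg mix_kernel_nonneg sum.cong simp: ennreal_mult mix_kernel_nonneg)
    then show "ennreal (?g x) * indicator {0<..} x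
        = (\<Sum>z\<in>Z. ennreal (w z) * (ennreal (mix_kernel k z x) * indicator {0<..} x))"
      by (simp add: sum_distrib_right mult.assoc)
  qed
  also have "\<dots> = (\<Sum>z\<in>Z. ennreal (w z) * (\<integral>\<^sup>+x. ennreal (mix_kernel k z x) * indicator {0<..} x \<partial>lborel))"
    by (subst nn_integral_sum) (auto intro!: sum.cong nn_integral_cmult)
  also have "\<dots> = (\<Sum>z\<in>Z. ennreal (w z))"
    using w k by (intro sum.cong) (auto simp: nn_integral_mix_kernel)
  also have "\<dots> = 1"
    using w sum1 by (subst sum_ennreal) auto
  finally have nn: "(\<integral>\<^sup>+x. ennreal (?g x) \<partial>lebesgue_pos) = 1" .
  have int: "integrable lebesgue_pos ?g"
    by (rule integrableI_nonneg[OF meas]) (use nonneg nn in auto)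
  have one: "(LINT x|lebesgue_pos. ?g x) = 1"
    using nonneg nn by (subst integral_eq_nn_integral[OF meas]) auto
  show ?thesis
    using km int one by (simp add: k_monotone_densities_def k_monotone_class_def)
qed

section \<open>The log-likelihood of a sample\<close>

lemma interval_measure_cdf:
  assumes "real_distribution M"
  shows "interval_measure (cdf M) = M"
proof -
  interpret real_distribution M by fact
  have *: "\<And>x y. x \<le> y \<Longrightarrow> cdf M x \<le> cdf M y" "\<And>a. continuous (at_right a) (cdf M)"
    "(cdf M \<longlongrightarrow> 0) at_bot" "(cdf M \<longlongrightarrow> 1) at_top"
    by (rule cdf_nondecreasing cdf_is_right_cont cdf_lim_at_bot cdf_lim_at_top_prob; assumption)+
  show ?thesis
    by (intro cdf_unique real_distribution_interval_measure cdf_interval_measure * assms)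
qed

definition empirical_measure :: "nat \<Rightarrow> (nat \<Rightarrow> real) \<Rightarrow> real measure" where
  "empirical_measure n X = distr (measure_pmf (pmf_of_set {1..n})) borel X"

lemma interval_measure_ecdf:
  assumes "1 \<le> n"
  shows "interval_measure (ecdf n X) = empirical_measure n X"
proof -
  have "real_distribution (empirical_measure n X)"
    unfolding empirical_measure_def by (rule prob_space.real_distribution_distr[OF prob_space_measure_pmf]) simp
  moreover have "cdf (empirical_measure n X) = ecdf n X"
  proof
    fix x
    have "cdf (empirical_measure n X) x = measure (measure_pmf (pmf_of_set {1..n})) (X -` {..x})"
      unfolding cdf_def empirical_measure_def by (subst measure_distr) auto
    also have "\<dots> = real (card ({1..n} \<inter> X -` {..x})) / real n"
      using assms by (subst measure_pmf_of_set) auto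
    also have "real (card ({1..n} \<inter> X -` {..x})) = (\<Sum>i=1..n. of_bool (X i \<le> x))"
      by (simp add: of_bool_def sum.If_cases Int_def vimage_def)
    finally show "cdf (empirical_measure n X) x = ecdf n X x" by (simp add: ecdf_def)
  qed
  ultimately show ?thesis using interval_measure_cdf by metis
qed

text \<open>
  Almost everywhere \<open>f\<close> agrees with a combination \<open>h\<close> of indicators of the observations (which
  may coincide), and \<open>h\<close> is measurable whatever \<open>f\<close> is.
\<close>
lemma nn_integral_empirical:
  assumes n: "1 \<le> n" and X: "\<And>i. i \<in> {1..n} \<Longrightarrow> 0 < X i"
  shows "(\<integral>\<^sup>+x. f x \<partial>restrict_space (interval_measure (ecdf n X)) {0<..})
    = (\<Sum>i=1..n. f (X i)) / ennreal (real n)"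
proof -
  let ?p = "measure_pmf (pmf_of_set {1..n})"
  define h where "h x = (\<Sum>a\<in>X ` {1..n}. f a * indicator {a} x)" for x
  have h: "h x = f x" if "x \<in> X ` {1..n}" for x
  proof -
    have "h x = f x * indicator {x} x + (\<Sum>a\<in>X ` {1..n} - {x}. f a * indicator {a} x)"
      unfolding h_def using that by (intro sum.remove) auto
    also have "(\<Sum>a\<in>X ` {1..n} - {x}. f a * indicator {a} x) = 0"
      by (intro sum.neutral) auto
    finally show ?thesis by simp
  qed
  have ne: "{1..n} \<noteq> {}" using n by auto
  have "(\<integral>\<^sup>+x. f x \<partial>restrict_space (empirical_measure n X) {0<..})
      = (\<integral>\<^sup>+x. f x * indicator {0<..} x \<partial>empirical_measure n X)"
    by (rule nn_integral_restrict_space) (simp add: empirical_measure_def)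
  also have "\<dots> = (\<integral>\<^sup>+x. h x \<partial>empirical_measure n X)"
  proof (rule nn_integral_cong_AE)
    have "AE x in empirical_measure n X. x \<in> X ` {1..n}"
      unfolding empirical_measure_def using n
      by (subst AE_distr_iff)
         (auto simp: AE_measure_pmf_iff set_pmf_of_set intro!: borel_closed finite_imp_closed)
    then show "AE x in empirical_measure n X. f x * indicator {0<..} x = h x"
      by eventually_elim (use X h in auto)
  qed
  also have "\<dots> = (\<integral>\<^sup>+i. h (X i) \<partial>?p)"
    unfolding empirical_measure_def h_def by (rule nn_integral_distr) measurable
  also have "\<dots> = (\<Sum>i=1..n. h (X i)) / ennreal (real n)"
    using ne by (subst nn_integral_pmf_of_set) (auto simp: ennreal_of_nat_eq_real_of_nat)
  also have "(\<Sum>i=1..n. h (X i)) = (\<Sum>i=1..n. f (X i))"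
    using h by (intro sum.cong) auto
  finally show ?thesis by (simp only: interval_measure_ecdf[OF n])
qed

theorem log_lik_eq:
  assumes n: "1 \<le> n" and X: "\<And>i. i \<in> {1..n} \<Longrightarrow> 0 < X i"
  shows "log_lik n X g = (if \<forall>i\<in>{1..n}. 0 < g (X i) then ereal ((\<Sum>i=1..n. ln (g (X i))) / real n) else -\<infinity>)"
proof -
  have pos: "0 < real n" using n by simp
  define P where "P = (\<Sum>i=1..n. e2ennreal (max 0 (ext_ln (g (X i))))) / ennreal (real n)"
  define Q where "Q = (\<Sum>i=1..n. e2ennreal (max 0 (- ext_ln (g (X i))))) / ennreal (real n)"
  have ll: "log_lik n X g = enn2ereal P - enn2ereal Q"
    unfolding log_lik_def ext_integral_def P_def Q_def by (simp only: nn_integral_empirical[OF n X])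
  have e: "e2ennreal (max 0 (ereal a)) = ennreal (max 0 a)" for a
  proof -
    have "max 0 (ereal a) = ereal (max 0 a)" by (simp add: max_def zero_ereal_def)
    then show ?thesis by (simp only: e2ennreal_ereal)
  qed
  have P: "P = ennreal ((\<Sum>i=1..n. if 0 < g (X i) then max 0 (ln (g (X i))) else 0) / real n)"
  proof -
    have "(\<Sum>i=1..n. e2ennreal (max 0 (ext_ln (g (X i)))))
        = (\<Sum>i=1..n. ennreal (if 0 < g (X i) then max 0 (ln (g (X i))) else 0))"
      by (intro sum.cong) (auto simp: ext_ln_def e)
    then show ?thesis
      unfolding P_def using pos by (simp add: sum_ennreal divide_ennreal sum_nonneg)
  qed
  show ?thesis
  proof (cases "\<forall>i\<in>{1..n}. 0 < g (X i)")
    case True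
    have "(\<Sum>i=1..n. e2ennreal (max 0 (- ext_ln (g (X i)))))
        = (\<Sum>i=1..n. ennreal (max 0 (- ln (g (X i)))))"
      using True by (intro sum.cong) (auto simp: ext_ln_def e)
    also have "\<dots> = ennreal (\<Sum>i=1..n. max 0 (- ln (g (X i))))"
      by (rule sum_ennreal) simp
    finally have Q: "Q = ennreal ((\<Sum>i=1..n. max 0 (- ln (g (X i)))) / real n)"
      unfolding Q_def using pos by (simp only: divide_ennreal sum_nonneg max.cobounded1)
    have "P = ennreal ((\<Sum>i=1..n. max 0 (ln (g (X i)))) / real n)"
      unfolding P using True by (intro arg_cong[where f="\<lambda>s. ennreal (s / real n)"] sum.cong) auto
    then have "log_lik n X g = ereal ((\<Sum>i=1..n. max 0 (ln (g (X i)))) / real n - (\<Sum>i=1..n. max 0 (- ln (g (X i)))) / real n)"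
      unfolding ll Q using pos by (simp add: enn2ereal_ennreal sum_nonneg)
    also have "(\<Sum>i=1..n. max 0 (ln (g (X i)))) / real n - (\<Sum>i=1..n. max 0 (- ln (g (X i)))) / real n
      = (\<Sum>i=1..n. ln (g (X i))) / real n"
      unfolding diff_divide_distrib[symmetric] sum_subtractf[symmetric]
      by (intro arg_cong[where f="\<lambda>s. s / real n"] sum.cong) (auto simp: max_def)
    finally show ?thesis using True by simp
  next
    case False
    then obtain i where i: "i \<in> {1..n}" "\<not> 0 < g (X i)" by blast
    have S: "(\<Sum>i=1..n. e2ennreal (max 0 (- ext_ln (g (X i))))) = top"
      using i by (subst ennreal_sum_eq_top) (auto simp: ext_ln_def intro!: bexI[of _ i])
    have "Q = top"
      unfolding Q_def S by (simp add: ennreal_top_divide)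
    moreover have "0 \<le> (\<Sum>i=1..n. if 0 < g (X i) then max 0 (ln (g (X i))) else 0) / real n"
      using pos by (intro divide_nonneg_pos sum_nonneg) auto
    ultimately have "log_lik n X g = -\<infinity>"
      unfolding ll P by (subst enn2ereal_ennreal) auto
    then show ?thesis using False by simp
  qed
qed

section \<open>Maximizers of the likelihood\<close>

text \<open>
  Williamson's and Bernstein's theorems in one form. At a jump of a nonincreasing \<open>g\<close> the mixture
  takes the left limit, which is why \<open>k = 1\<close> needs an exception.
\<close>
lemma kernel_mixture_representation:
  assumes k: "1 \<le> k" and g: "g \<in> k_monotone_L1 k"
  obtains \<nu> where "mixing_measure \<nu>" "emeasure \<nu> UNIV = ennreal (LINT x|lebesgue_pos. g x)"
    "\<And>x. 0 < x \<Longrightarrow> g x \<le> (\<integral>t. mix_kernel k t x \<partial>\<nu>)"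
    "\<And>x. 0 < x \<Longrightarrow> k \<noteq> 1 \<or> emeasure \<nu> {x} = 0 \<Longrightarrow> g x = (\<integral>t. mix_kernel k t x \<partial>\<nu>)"
proof -
  have km: "k_monotone k g" using g by (simp add: k_monotone_L1_def k_monotone_class_def)
  have "\<exists>\<nu>. mixing_measure \<nu> \<and> emeasure \<nu> UNIV = ennreal (LINT x|lebesgue_pos. g x) \<and>
    (\<forall>x>0. ennreal (g x) \<le> mixture k \<nu> x) \<and>
    (\<forall>x>0. k \<noteq> 1 \<or> emeasure \<nu> {x} = 0 \<longrightarrow> ennreal (g x) = mixture k \<nu> x)"
    using k
  proof (rule enat_cases_pos)
    fix i assume i: "k = enat (Suc i)"
    obtain \<nu> where "mixing_measure \<nu>" "emeasure \<nu> UNIV = ennreal (LINT x|lebesgue_pos. g x)"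
      "\<And>x. 0 < x \<Longrightarrow> ennreal (g x) \<le> mixture k \<nu> x"
      "\<And>x. 0 < x \<Longrightarrow> i \<noteq> 0 \<or> emeasure \<nu> {x} = 0 \<Longrightarrow> ennreal (g x) = mixture k \<nu> x"
      using williamson[OF g[unfolded i]] unfolding i by blast
    moreover have "k \<noteq> 1 \<longleftrightarrow> i \<noteq> 0" by (simp add: i one_enat_def)
    ultimately show ?thesis by (intro exI[of _ \<nu>]) simp
  next
    assume i: "k = \<infinity>"
    obtain \<nu> where \<nu>: "mixing_measure \<nu>" "\<And>x. 0 < x \<Longrightarrow> ennreal (g x) = mixture k \<nu> x"
      using bernstein[OF g[unfolded i]] unfolding i by blast
    have "emeasure \<nu> UNIV = (\<integral>\<^sup>+x. mixture k \<nu> x \<partial>lebesgue_pos)"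
      by (rule mass_of_mixture[OF \<nu>(1) k, symmetric])
    also have "\<dots> = (\<integral>\<^sup>+x. ennreal (g x) \<partial>lebesgue_pos)"
      by (rule nn_integral_cong) (simp add: space_lebesgue_pos \<nu>(2))
    also have "\<dots> = ennreal (LINT x|lebesgue_pos. g x)"
      by (rule nn_integral_k_monotone_L1[OF g])
    finally show ?thesis using \<nu> by (intro exI[of _ \<nu>]) simp
  qed
  then obtain \<nu> where \<nu>: "mixing_measure \<nu>" "emeasure \<nu> UNIV = ennreal (LINT x|lebesgue_pos. g x)"
    "\<forall>x>0. ennreal (g x) \<le> mixture k \<nu> x"
    "\<forall>x>0. k \<noteq> 1 \<or> emeasure \<nu> {x} = 0 \<longrightarrow> ennreal (g x) = mixture k \<nu> x"
    by blast
  have nonneg: "0 \<le> (\<integral>t. mix_kernel k t x \<partial>\<nu>)" for x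
    by (rule integral_nonneg_AE) (use mixing_measureD(3)[OF \<nu>(1)] in eventually_elim, rule mix_kernel_nonneg)
  show ?thesis
  proof (rule that[OF \<nu>(1,2)])
    fix x :: real assume x: "0 < x"
    show "g x \<le> (\<integral>t. mix_kernel k t x \<partial>\<nu>)"
      using \<nu>(3)[rule_format, OF x] nonneg[of x] by (simp add: mixture_eq_integral[OF \<nu>(1) k x])
    assume "k \<noteq> 1 \<or> emeasure \<nu> {x} = 0"
    then show "g x = (\<integral>t. mix_kernel k t x \<partial>\<nu>)"
      using \<nu>(4)[rule_format, OF x] nonneg[of x] k_monotone_nonneg[OF km x]
      by (simp add: mixture_eq_integral[OF \<nu>(1) k x])
  qed
qed

lemma integral_kernel_sum:
  fixes x L :: "'i \<Rightarrow> real"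
  assumes \<nu>: "mixing_measure \<nu>" and k: "1 \<le> k" and x: "\<And>i. i \<in> I \<Longrightarrow> 0 < x i"
  shows "integrable \<nu> (\<lambda>t. \<Sum>i\<in>I. mix_kernel k t (x i) / L i)"
    "(\<integral>t. (\<Sum>i\<in>I. mix_kernel k t (x i) / L i) \<partial>\<nu>) = (\<Sum>i\<in>I. (\<integral>t. mix_kernel k t (x i) \<partial>\<nu>) / L i)"
proof -
  have int: "integrable \<nu> (\<lambda>t. mix_kernel k t (x i) / L i)" if "i \<in> I" for i
    by (intro integrable_divide_zero integrable_mix_kernel \<nu> k x that)
  then show "integrable \<nu> (\<lambda>t. \<Sum>i\<in>I. mix_kernel k t (x i) / L i)" by simp
  show "(\<integral>t. (\<Sum>i\<in>I. mix_kernel k t (x i) / L i) \<partial>\<nu>) = (\<Sum>i\<in>I. (\<integral>t. mix_kernel k t (x i) \<partial>\<nu>) / L i)"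
    using int by (subst Bochner_Integration.integral_sum) auto
qed

lemma integral_kernel_sum_le:
  fixes x L :: "'i \<Rightarrow> real"
  assumes \<nu>: "mixing_measure \<nu>" and k: "1 \<le> k" and x: "\<And>i. i \<in> I \<Longrightarrow> 0 < x i"
    and stat: "\<And>t. 0 < t \<Longrightarrow> (\<Sum>i\<in>I. mix_kernel k t (x i) / L i) \<le> b"
  shows "(\<Sum>i\<in>I. (\<integral>t. mix_kernel k t (x i) \<partial>\<nu>) / L i) \<le> b * measure \<nu> UNIV"
proof -
  have "(\<Sum>i\<in>I. (\<integral>t. mix_kernel k t (x i) \<partial>\<nu>) / L i)
      = (\<integral>t. (\<Sum>i\<in>I. mix_kernel k t (x i) / L i) \<partial>\<nu>)"
    by (rule integral_kernel_sum(2)[OF \<nu> k x, symmetric])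
  also have "\<dots> \<le> (\<integral>t. b \<partial>\<nu>)"
  proof (rule integral_mono_AE)
    show "AE t in \<nu>. (\<Sum>i\<in>I. mix_kernel k t (x i) / L i) \<le> b"
      using mixing_measureD(3)[OF \<nu>] by eventually_elim (rule stat)
    show "integrable \<nu> (\<lambda>t. b)" by (rule integrable_bounded_pos[OF \<nu>, where B="\<bar>b\<bar>"]) auto
  qed (rule integral_kernel_sum(1)[OF \<nu> k x])
  also have "\<dots> = b * measure \<nu> UNIV" by (simp add: mixing_measureD(4)[OF \<nu>] mult.commute)
  finally show ?thesis .
qed

text \<open>
  Write \<open>n\<close> for the number of points and integrate \<open>D t = (\<Sum>i. K t (x i) / L i) \<le> n\<close>: the
  integral is at least \<open>n\<close> because each summand contributes at least \<open>1\<close>, and at most \<open>n\<close>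
  times the mass. So all inequalities are equalities, and \<open>D = n\<close> almost everywhere.
\<close>
lemma stationary_support:
  fixes x L :: "'i \<Rightarrow> real"
  assumes \<nu>: "mixing_measure \<nu>" and k: "1 \<le> k" and I: "finite I" "I \<noteq> {}"
    and x: "\<And>i. i \<in> I \<Longrightarrow> 0 < x i" and L: "\<And>i. i \<in> I \<Longrightarrow> 0 < L i"
    and stat: "\<And>t. 0 < t \<Longrightarrow> (\<Sum>i\<in>I. mix_kernel k t (x i) / L i) \<le> real (card I)"
    and mass: "emeasure \<nu> UNIV \<le> 1" and ge: "\<And>i. i \<in> I \<Longrightarrow> L i \<le> (\<integral>t. mix_kernel k t (x i) \<partial>\<nu>)"
  shows "emeasure \<nu> UNIV = 1" "\<And>i. i \<in> I \<Longrightarrow> (\<integral>t. mix_kernel k t (x i) \<partial>\<nu>) = L i"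
    "AE t in \<nu>. 0 < t \<and> (\<Sum>i\<in>I. mix_kernel k t (x i) / L i) = real (card I)"
proof -
  interpret finite_measure \<nu> by (rule mixing_measureD[OF \<nu>])
  let ?G = "\<lambda>i. \<integral>t. mix_kernel k t (x i) \<partial>\<nu>"
  let ?D = "\<lambda>t. \<Sum>i\<in>I. mix_kernel k t (x i) / L i"
  have n: "0 < real (card I)" using I by (simp add: card_gt_0_iff)
  have le1: "1 \<le> ?G i / L i" if "i \<in> I" for i
    using ge[OF that] L[OF that] by simp
  have sum_ge: "real (card I) \<le> (\<Sum>i\<in>I. ?G i / L i)"
    using sum_mono[of I "\<lambda>_. 1 :: real", OF le1] by simp
  have sum_le: "(\<Sum>i\<in>I. ?G i / L i) \<le> real (card I) * measure \<nu> UNIV"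
    by (rule integral_kernel_sum_le[OF \<nu> k x stat])
  have m1: "measure \<nu> UNIV \<le> 1"
    using mass by (simp add: emeasure_eq_measure)
  then have "real (card I) * measure \<nu> UNIV \<le> real (card I)"
    using n by (simp add: mult_left_le)
  with sum_ge sum_le have eq: "(\<Sum>i\<in>I. ?G i / L i) = real (card I)"
    and "real (card I) * measure \<nu> UNIV = real (card I)" by linarith+
  then have meas: "measure \<nu> UNIV = 1" using n by simp
  then show "emeasure \<nu> UNIV = 1" by (simp add: emeasure_eq_measure)
  show "?G i = L i" if "i \<in> I" for i
  proof -
    have "(\<Sum>i\<in>I. ?G i / L i - 1) = 0" using eq by (simp add: sum_subtractf)
    then have "\<forall>i\<in>I. ?G i / L i - 1 = 0"
      using le1 by (subst (asm) sum_nonneg_eq_0_iff[OF I(1)]) auto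
    then show ?thesis using that L[OF that] by auto
  qed
  have "(\<integral>t. real (card I) - ?D t \<partial>\<nu>) = 0"
    using integral_kernel_sum[where x=x and L=L and I=I, OF \<nu> k x] eq meas
    by (simp add: mixing_measureD(4)[OF \<nu>])
  moreover have "integrable \<nu> (\<lambda>t. real (card I) - ?D t)"
    by (intro Bochner_Integration.integrable_diff integral_kernel_sum(1)[OF \<nu> k x]) auto
  moreover have "AE t in \<nu>. 0 \<le> real (card I) - ?D t"
    using mixing_measureD(3)[OF \<nu>] by eventually_elim (use stat in simp)
  ultimately have "AE t in \<nu>. real (card I) - ?D t = 0"
    by (subst (asm) integral_nonneg_eq_0_iff_AE) auto
  then show "AE t in \<nu>. 0 < t \<and> ?D t = real (card I)"
    using mixing_measureD(3)[OF \<nu>] by eventually_elim auto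
qed

lemma finitely_supported_integral:
  fixes f :: "real \<Rightarrow> real"
  assumes \<nu>: "mixing_measure \<nu>" and [measurable]: "f \<in> borel_measurable borel"
    and Z: "finite Z" "AE t in \<nu>. t \<in> Z"
  shows "(\<integral>t. f t \<partial>\<nu>) = (\<Sum>z\<in>Z. measure \<nu> {z} * f z)"
proof -
  interpret finite_measure \<nu> by (rule mixing_measureD[OF \<nu>])
  note [measurable_cong] = mixing_measureD(2)[OF \<nu>]
  have "(\<integral>t. f t \<partial>\<nu>) = (\<integral>t. (\<Sum>z\<in>Z. f z * indicator {z} t) \<partial>\<nu>)"
  proof (rule integral_cong_AE)
    show "AE t in \<nu>. f t = (\<Sum>z\<in>Z. f z * indicator {z} t)"
      using Z(2)
    proof eventually_elim
      case (elim t)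
      have "(\<Sum>z\<in>Z. f z * indicator {z} t) = (\<Sum>z\<in>{t}. f z * indicator {z} t)"
        using elim Z(1) by (intro sum.mono_neutral_right) auto
      then show ?case by simp
    qed
  qed measurable
  also have "\<dots> = (\<Sum>z\<in>Z. \<integral>t. f z * indicator {z} t \<partial>\<nu>)"
    by (rule Bochner_Integration.integral_sum) (auto simp: mixing_measureD(2)[OF \<nu>] emeasure_eq_measure)
  also have "\<dots> = (\<Sum>z\<in>Z. measure \<nu> {z} * f z)"
    by (intro sum.cong) (auto simp: mixing_measureD(4)[OF \<nu>])
  finally show ?thesis .
qed

text \<open>
  \<open>ln r \<le> r - 1\<close> for \<open>r = h i / L i\<close>, with equality only for \<open>r = 1\<close>. In the application \<open>c\<close> is
  the integral of the function with values \<open>h i\<close>.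
\<close>
lemma sum_ln_le:
  fixes h L :: "'i \<Rightarrow> real"
  assumes I: "finite I" "I \<noteq> {}" and h: "\<And>i. i \<in> I \<Longrightarrow> 0 < h i" and L: "\<And>i. i \<in> I \<Longrightarrow> 0 < L i"
    and ratio: "(\<Sum>i\<in>I. h i / L i) \<le> real (card I) * c"
  shows "(\<Sum>i\<in>I. ln (h i)) / card I - c \<le> (\<Sum>i\<in>I. ln (L i)) / card I - 1"
    "(\<Sum>i\<in>I. ln (h i)) / card I - c = (\<Sum>i\<in>I. ln (L i)) / card I - 1 \<Longrightarrow> c = 1 \<and> (\<forall>i\<in>I. h i = L i)"
proof -
  have n: "0 < real (card I)" using I by (simp add: card_gt_0_iff)
  have term_le: "0 \<le> (h i / L i - 1) - ln (h i / L i)" if "i \<in> I" for i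
    using ln_le_minus_one[of "h i / L i"] h[OF that] L[OF that] by simp
  have split: "(\<Sum>i\<in>I. (h i / L i - 1) - ln (h i / L i))
      = (\<Sum>i\<in>I. h i / L i) - real (card I) - ((\<Sum>i\<in>I. ln (h i)) - (\<Sum>i\<in>I. ln (L i)))"
  proof -
    have "(\<Sum>i\<in>I. ln (h i / L i)) = (\<Sum>i\<in>I. ln (h i) - ln (L i))"
    proof (rule sum.cong[OF refl])
      fix i assume "i \<in> I"
      then show "ln (h i / L i) = ln (h i) - ln (L i)" using h[of i] L[of i] by (simp add: ln_div)
    qed
    then show ?thesis by (simp add: sum_subtractf)
  qed
  have nonneg: "0 \<le> (\<Sum>i\<in>I. (h i / L i - 1) - ln (h i / L i))"
    by (rule sum_nonneg) (rule term_le)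
  then have le: "(\<Sum>i\<in>I. ln (h i)) - real (card I) * c \<le> (\<Sum>i\<in>I. ln (L i)) - real (card I)"
    using split ratio by linarith
  have scale: "(s / card I - a) * real (card I) = s - real (card I) * a" for s a :: real
    using n by (simp add: field_simps)
  show "(\<Sum>i\<in>I. ln (h i)) / card I - c \<le> (\<Sum>i\<in>I. ln (L i)) / card I - 1"
  proof (rule mult_right_le_imp_le[OF _ n])
    show "((\<Sum>i\<in>I. ln (h i)) / card I - c) * real (card I) \<le> ((\<Sum>i\<in>I. ln (L i)) / card I - 1) * real (card I)"
      unfolding scale using le by simp
  qed
  assume "(\<Sum>i\<in>I. ln (h i)) / card I - c = (\<Sum>i\<in>I. ln (L i)) / card I - 1"
  then have "((\<Sum>i\<in>I. ln (h i)) / card I - c) * real (card I) = ((\<Sum>i\<in>I. ln (L i)) / card I - 1) * real (card I)"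
    by simp
  then have eq: "(\<Sum>i\<in>I. ln (h i)) - real (card I) * c = (\<Sum>i\<in>I. ln (L i)) - real (card I)"
    unfolding scale by simp
  then have "(\<Sum>i\<in>I. (h i / L i - 1) - ln (h i / L i)) = 0"
    using split ratio nonneg by linarith
  then have "\<forall>i\<in>I. (h i / L i - 1) - ln (h i / L i) = 0"
    using term_le by (subst (asm) sum_nonneg_eq_0_iff[OF I(1)]) auto
  then have hL: "h i = L i" if "i \<in> I" for i
    using ln_eq_minus_one[of "h i / L i"] h[OF that] L[OF that] that by simp
  moreover have "c = 1"
    using eq n by (simp add: hL)
  ultimately show "c = 1 \<and> (\<forall>i\<in>I. h i = L i)" by blast
qed

lemma k_monotone_densities_iff:
  "g \<in> k_monotone_densities k \<longleftrightarrow> g \<in> k_monotone_L1 k \<and> (LINT x|lebesgue_pos. g x) = 1"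
  by (auto simp: k_monotone_densities_def k_monotone_L1_def)

text \<open>
  By \<open>sum_ln_le\<close>, \<open>G - 1\<close> is an upper bound of \<open>psi\<close>, attained precisely at the densities with
  values \<open>L i\<close>. On densities \<open>psi\<close> and the log-likelihood differ by the constant \<open>1\<close>, so both
  problems have these maximizers; \<open>g0\<close> ensures that the bound is attained.
\<close>
lemma maximizers_iff:
  fixes n :: nat and x L :: "nat \<Rightarrow> real"
  assumes n: "1 \<le> n" and x: "\<And>i. i \<in> {1..n} \<Longrightarrow> 0 < x i" and LI: "\<And>i. i \<in> {1..n} \<Longrightarrow> 0 < L i"
    and ratio: "\<And>h. h \<in> k_monotone_L1 k \<Longrightarrow> (\<Sum>i=1..n. h (x i) / L i) \<le> real n * (LINT x|lebesgue_pos. h x)"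
    and g0: "g0 \<in> k_monotone_densities k" "\<And>i. i \<in> {1..n} \<Longrightarrow> g0 (x i) = L i"
  shows "is_mle k n x g \<longleftrightarrow> g \<in> k_monotone_densities k \<and> (\<forall>i\<in>{1..n}. g (x i) = L i)"
    and "is_arg_max (psi n x) (\<lambda>h. h \<in> k_monotone_L1 k) g
      \<longleftrightarrow> g \<in> k_monotone_densities k \<and> (\<forall>i\<in>{1..n}. g (x i) = L i)"
proof -
  let ?max = "\<lambda>g. g \<in> k_monotone_densities k \<and> (\<forall>i\<in>{1..n}. g (x i) = L i)"
  let ?l = "\<lambda>h. (\<Sum>i=1..n. ln (h (x i))) / real n" and ?I = "\<lambda>h. LINT x|lebesgue_pos. h x"
  define G where "G = (\<Sum>i=1..n. ln (L i)) / real n"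
  have ne: "{1..n} \<noteq> {}" using n by auto
  have LL: "log_lik n x h
    = (if \<forall>i\<in>{1..n}. 0 < h (x i) then ereal (?l h) else -\<infinity>)" for h
    by (rule log_lik_eq[OF n x])
  have ll0: "log_lik n x h = ereal G" if "\<forall>i\<in>{1..n}. h (x i) = L i" for h
  proof -
    have "(\<Sum>i=1..n. ln (h (x i))) = (\<Sum>i=1..n. ln (L i))" using that by (intro sum.cong) auto
    then show ?thesis using that LI by (simp only: LL G_def) simp
  qed
  have psi_bot: "psi n x h = -\<infinity>" if "\<not> (\<forall>i\<in>{1..n}. 0 < h (x i))" for h
  proof -
    have "log_lik n x h = -\<infinity>" unfolding LL using that by (rule if_not_P)
    then show ?thesis unfolding psi_def by simp
  qed
  have psi_val: "psi n x h = ereal (?l h - ?I h)"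
    if "\<forall>i\<in>{1..n}. 0 < h (x i)" for h
  proof -
    have "log_lik n x h = ereal (?l h)"
      unfolding LL using that by (rule if_P)
    then show ?thesis unfolding psi_def by (simp only: ereal_minus)
  qed
  have card: "card {1..n} = n" by simp
  have ln_le: "?l h - ?I h \<le> G - 1"
    and ln_eq: "?l h - ?I h = G - 1
      \<Longrightarrow> ?I h = 1 \<and> (\<forall>i\<in>{1..n}. h (x i) = L i)"
    if pos: "\<forall>i\<in>{1..n}. 0 < h (x i)" and h: "h \<in> k_monotone_L1 k" for h
  proof -
    have hp: "0 < h (x i)" if "i \<in> {1..n}" for i using pos that by blast
    have r: "(\<Sum>i=1..n. h (x i) / L i) \<le> real (card {1..n}) * ?I h"
      unfolding card by (rule ratio[OF h])
    note bounds = sum_ln_le[OF finite_atLeastAtMost ne hp LI r]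
    show "?l h - ?I h \<le> G - 1"
      using bounds(1) unfolding card G_def .
    assume "?l h - ?I h = G - 1"
    then show "?I h = 1 \<and> (\<forall>i\<in>{1..n}. h (x i) = L i)"
      using bounds(2) unfolding card G_def by blast
  qed
  have psi_le: "psi n x h \<le> ereal (G - 1)" if h: "h \<in> k_monotone_L1 k" for h
  proof (cases "\<forall>i\<in>{1..n}. 0 < h (x i)")
    case True
    then show ?thesis
      unfolding psi_val[OF True] ereal_less_eq using ln_le[OF True h] by simp
  next
    case False
    then show ?thesis by (subst psi_bot) simp_all
  qed
  have psi_eq: "?I h = 1 \<and> (\<forall>i\<in>{1..n}. h (x i) = L i)"
    if h: "h \<in> k_monotone_L1 k" and eq: "psi n x h = ereal (G - 1)" for h
  proof -
    have pos: "\<forall>i\<in>{1..n}. 0 < h (x i)"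
    proof (rule ccontr)
      assume "\<not> ?thesis"
      from psi_bot[OF this] show False using eq by simp
    qed
    have "?l h - ?I h = G - 1"
      using eq unfolding psi_val[OF pos] by (simp only: ereal.inject)
    then show ?thesis by (rule ln_eq[OF pos h])
  qed
  have psi_density: "psi n x h = log_lik n x h - 1" if "h \<in> k_monotone_densities k" for h
    using that by (simp add: psi_def k_monotone_densities_iff one_ereal_def)
  have ll_psi: "log_lik n x h = psi n x h + 1" if "h \<in> k_monotone_densities k" for h
    using psi_density[OF that] by (cases "log_lik n x h") (simp_all add: one_ereal_def)
  have psi_max: "psi n x h = ereal (G - 1)" if "h \<in> k_monotone_densities k" "\<forall>i\<in>{1..n}. h (x i) = L i" for h
    using psi_density[OF that(1)] ll0[OF that(2)] by (simp add: one_ereal_def)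
  have ll_le: "log_lik n x h \<le> ereal G" if "h \<in> k_monotone_densities k" for h
  proof -
    have "log_lik n x h \<le> ereal (G - 1) + 1"
      unfolding ll_psi[OF that] using psi_le[of h] that by (intro add_right_mono) (simp add: k_monotone_densities_iff)
    then show ?thesis by (simp add: one_ereal_def)
  qed
  have g0L1: "g0 \<in> k_monotone_L1 k" using g0 by (simp add: k_monotone_densities_iff)
  show "is_mle k n x g \<longleftrightarrow> ?max g" (is "?l \<longleftrightarrow> ?r")
  proof
    assume ?l
    then have g: "g \<in> k_monotone_densities k" and "\<not> log_lik n x g < log_lik n x g0"
      using g0 by (auto simp: is_mle_def is_arg_max_def)
    then have "log_lik n x g = ereal G"
      using ll0[of g0] g0 ll_le[OF g] by (intro antisym) auto
    then have "psi n x g = ereal (G - 1)" using psi_density[OF g] by (simp add: one_ereal_def)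
    then show ?r using psi_eq[of g] g by (simp add: k_monotone_densities_iff)
  next
    assume ?r
    then show ?l using ll0[of g] ll_le by (auto simp: is_mle_def is_arg_max_def not_less)
  qed
  show "is_arg_max (psi n x) (\<lambda>h. h \<in> k_monotone_L1 k) g
      \<longleftrightarrow> ?max g" (is "?l \<longleftrightarrow> ?r")
  proof
    assume ?l
    then have g: "g \<in> k_monotone_L1 k" and "\<not> psi n x g < psi n x g0"
      using g0L1 by (auto simp: is_arg_max_def)
    then have "psi n x g = ereal (G - 1)"
      using psi_max[of g0] g0 psi_le[OF g] by (intro antisym) auto
    then show ?r using psi_eq[OF g] g by (simp add: k_monotone_densities_iff)
  next
    assume ?r
    then show ?l
      using psi_max[of g] psi_le by (auto simp: is_arg_max_def not_less k_monotone_densities_iff)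
  qed
qed

lemma set_integral_mix_kernel:
  assumes \<nu>: "mixing_measure \<nu>"
  shows "(LINT t:{0<..}|\<nu>. mix_kernel k t x) = (\<integral>t. mix_kernel k t x \<partial>\<nu>)"
proof -
  note [measurable_cong] = mixing_measureD(2)[OF \<nu>]
  show ?thesis
    unfolding set_lebesgue_integral_def
    by (rule integral_cong_AE) (use mixing_measureD(3)[OF \<nu>] in \<open>auto elim!: eventually_mono\<close>)
qed

lemma mixing_df_of_measure:
  assumes \<nu>: "mixing_measure \<nu>" and one: "emeasure \<nu> UNIV = 1"
    and g: "\<And>x. 0 < x \<Longrightarrow> g x = (\<integral>t. mix_kernel k t x \<partial>\<nu>)"
  shows "mixing_df k (cdf \<nu>) g"
proof -
  note D = mixing_measureD[OF \<nu>]
  have "real_distribution \<nu>"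
    using D one by (auto simp: real_distribution_def real_distribution_axioms_def intro!: prob_spaceI)
  then interpret real_distribution \<nu> .
  have im: "interval_measure (cdf \<nu>) = \<nu>" by (rule interval_measure_cdf) fact
  have "cdf \<nu> t = 0" if "t \<le> 0" for t
  proof -
    have "emeasure \<nu> {..t} \<le> emeasure \<nu> {..0}" using that D(2) by (intro emeasure_mono) auto
    then show ?thesis using \<nu> by (simp add: cdf_def measure_def mixing_measure_def)
  qed
  then have "pos_distribution_function (cdf \<nu>)"
    unfolding pos_distribution_function_def
    using cdf_nondecreasing cdf_is_right_cont cdf_lim_at_top_prob by (auto simp: mono_def)
  then show ?thesis
    using g set_integral_mix_kernel[OF \<nu>] by (simp add: mixing_df_def im)
qed

lemma measure_of_mixing_df:
  assumes F: "mixing_df k F g"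
  shows "mixing_measure (interval_measure F)" "emeasure (interval_measure F) UNIV = 1"
    "\<And>t. F t = measure (interval_measure F) {..t}"
    "\<And>x. 0 < x \<Longrightarrow> g x = (\<integral>t. mix_kernel k t x \<partial>interval_measure F)"
proof -
  let ?\<nu> = "interval_measure F"
  have mono: "\<And>x y. x \<le> y \<Longrightarrow> F x \<le> F y" and cont: "\<And>a. continuous (at_right a) F"
    and zero: "\<And>t. t \<le> 0 \<Longrightarrow> F t = 0" and top: "(F \<longlongrightarrow> 1) at_top"
    using F by (auto simp: mixing_df_def pos_distribution_function_def mono_def)
  have bot: "(F \<longlongrightarrow> 0) at_bot"
    by (rule tendsto_eventually) (use eventually_le_at_bot[of 0] in eventually_elim, rule zero)
  interpret real_distribution ?\<nu>
    by (rule real_distribution_interval_measure[OF mono cont bot top])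
  show Ft: "F t = measure ?\<nu> {..t}" for t
    using measure_interval_measure_Iic[OF mono cont bot] by simp
  show mm: "mixing_measure ?\<nu>"
    unfolding mixing_measure_def
    using Ft[of 0] zero[of 0] finite_measure_axioms by (simp add: emeasure_eq_measure)
  show "emeasure ?\<nu> UNIV = 1" using emeasure_space_1 by simp
  fix x :: real assume "0 < x"
  then have "g x = (LINT t:{0<..}|?\<nu>. mix_kernel k t x)"
    using F by (simp add: mixing_df_def)
  also have "\<dots> = (\<integral>t. mix_kernel k t x \<partial>?\<nu>)"
    by (rule set_integral_mix_kernel[OF mm])
  finally show "g x = (\<integral>t. mix_kernel k t x \<partial>?\<nu>)" .
qed

text \<open>
  For \<open>k = 1\<close> the sum has the form \<open>S / t\<close> between neighbouring points \<open>x i\<close>. If it attained its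
  bound \<open>b > 0\<close> strictly between them, it would exceed \<open>b\<close> at the next point \<open>x j\<close> to the left.
\<close>
lemma contact_points_are_observations:
  fixes x L :: "'i \<Rightarrow> real"
  assumes I: "finite I" and x: "\<And>i. i \<in> I \<Longrightarrow> 0 < x i" and L: "\<And>i. i \<in> I \<Longrightarrow> 0 < L i" and b: "0 < b"
    and stat: "\<And>t. 0 < t \<Longrightarrow> (\<Sum>i\<in>I. mix_kernel 1 t (x i) / L i) \<le> b"
    and y: "0 < y" "(\<Sum>i\<in>I. mix_kernel 1 y (x i) / L i) = b"
  shows "\<exists>i\<in>I. y = x i"
proof (rule ccontr)
  assume neg: "\<not> ?thesis"
  define J where "J = {i \<in> I. x i \<le> y}"
  have fJ: "finite J" using I by (simp add: J_def)
  have D: "(\<Sum>i\<in>I. mix_kernel 1 t (x i) / L i) = (\<Sum>i\<in>J. 1 / L i) / t"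
    if "\<And>i. i \<in> I \<Longrightarrow> x i \<le> t \<longleftrightarrow> i \<in> J" for t
  proof -
    have K: "mix_kernel 1 t z = (if z \<le> t then 1 / t else 0)" for z
      using mix_kernel_Suc[of 0 t z] by (simp add: one_enat_def)
    have "(\<Sum>i\<in>I. mix_kernel 1 t (x i) / L i) = (\<Sum>i\<in>J. mix_kernel 1 t (x i) / L i)"
      using that I by (intro sum.mono_neutral_right) (auto simp: K J_def)
    also have "\<dots> = (\<Sum>i\<in>J. 1 / L i) / t"
      unfolding sum_divide_distrib using that by (intro sum.cong) (auto simp: K J_def mult.commute)
    finally show ?thesis .
  qed
  have Dy: "(\<Sum>i\<in>J. 1 / L i) / y = b" using D[of y] y by (simp add: J_def)
  then have "J \<noteq> {}" using b by auto
  define t where "t = Max (x ` J)"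
  have "t \<in> x ` J" unfolding t_def using fJ \<open>J \<noteq> {}\<close> by (intro Max_in) auto
  then obtain j where j: "j \<in> J" "t = x j" by blast
  then have t: "0 < t" "t < y" using x neg by (force simp: J_def)+
  have "x i \<le> t \<longleftrightarrow> i \<in> J" if "i \<in> I" for i
  proof
    assume "x i \<le> t" then show "i \<in> J" using t that by (simp add: J_def)
  next
    assume "i \<in> J" then show "x i \<le> t" unfolding t_def using fJ by (intro Max_ge) auto
  qed
  then have "(\<Sum>i\<in>J. 1 / L i) / t \<le> b" using stat[OF t(1)] D by simp
  moreover have S: "(\<Sum>i\<in>J. 1 / L i) = b * y" using Dy y by (simp add: field_simps)
  ultimately have "b * y \<le> b * t" using t by (simp add: field_simps)
  then show False using b t by simp
qed

text \<open>
  The support points are the atoms in \<open>Z\<close>; points of \<open>Z\<close> without mass have to be dropped since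
  the weights are positive.
\<close>
theorem finite_mixing_df_discrete:
  assumes F: "mixing_df k F g" and Z: "finite Z" "AE t in interval_measure F. 0 < t \<and> t \<in> Z"
  obtains m w a where "discrete_df m w a F" "\<And>x. 0 < x \<Longrightarrow> g x = (\<Sum>i=1..m. w i * mix_kernel k (a i) x)"
proof -
  let ?\<nu> = "interval_measure F"
  note M = measure_of_mixing_df[OF F]
  interpret finite_measure ?\<nu> by (rule mixing_measureD[OF M(1)])
  define S where "S = {z \<in> Z. 0 < z \<and> 0 < measure ?\<nu> {z}}"
  have fS: "finite S" using Z by (simp add: S_def)
  have sum_S: "(\<Sum>z\<in>Z. measure ?\<nu> {z} * f z) = (\<Sum>z\<in>S. measure ?\<nu> {z} * f z)" for f
  proof (rule sum.mono_neutral_right)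
    have "measure ?\<nu> {z} = 0" if "z \<in> Z - S" for z
    proof (cases "0 < z")
      case True
      then show ?thesis using that by (auto simp: S_def zero_less_measure_iff)
    next
      case False
      have "AE t in ?\<nu>. t \<notin> {z}" using Z(2) by eventually_elim (use False in auto)
      then show ?thesis by (subst (asm) AE_iff_measurable[where N="{z}"]) (auto simp: measure_def)
    qed
    then show "\<forall>z\<in>Z - S. measure ?\<nu> {z} * f z = 0" by simp
  qed (use Z in \<open>auto simp: S_def\<close>)
  have int: "(\<integral>t. f t \<partial>?\<nu>) = (\<Sum>z\<in>S. measure ?\<nu> {z} * f z)" if "f \<in> borel_measurable borel" for f
  proof -
    have "AE t in ?\<nu>. t \<in> Z" using Z(2) by eventually_elim simp
    from finitely_supported_integral[OF M(1) that Z(1) this] show ?thesis by (simp only: sum_S)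
  qed
  obtain a where a: "bij_betw a {1..card S} S"
    using ex_bij_betw_nat_finite_1[OF fS] by blast
  define w where "w i = measure ?\<nu> {a i}" for i
  have reindex: "(\<Sum>z\<in>S. measure ?\<nu> {z} * f z) = (\<Sum>i=1..card S. w i * f (a i))" for f
    unfolding w_def by (rule sum.reindex_bij_betw[OF a, symmetric])
  have aS: "a i \<in> S" if "i \<in> {1..card S}" for i using a that by (auto simp: bij_betw_def)
  have "(\<Sum>i=1..card S. w i) = 1"
  proof -
    have "(\<Sum>i=1..card S. w i) = (\<integral>t. 1 \<partial>?\<nu>)" using int[of "\<lambda>_. 1"] reindex[of "\<lambda>_. 1"] by simp
    also have "\<dots> = 1" using M(2) by (simp add: measure_def)
    finally show ?thesis .
  qed
  moreover have "F t = (\<Sum>i=1..card S. w i * of_bool (a i \<le> t))" for t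
  proof -
    have "F t = (\<integral>s. indicator {..t} s \<partial>?\<nu>)" using M(3)[of t] by simp
    also have "\<dots> = (\<Sum>i=1..card S. w i * indicator {..t} (a i))"
      by (subst int) (simp_all only: reindex borel_measurable_indicator atMost_borel)
    also have "\<dots> = (\<Sum>i=1..card S. w i * of_bool (a i \<le> t))"
      by (intro sum.cong) (auto simp: indicator_def)
    finally show ?thesis .
  qed
  ultimately have "discrete_df (card S) w a F"
    using a aS by (auto simp: discrete_df_def bij_betw_def S_def w_def)
  moreover have "g x = (\<Sum>i=1..card S. w i * mix_kernel k (a i) x)" if "0 < x" for x
    unfolding M(4)[OF that] by (subst int) (measurable, simp only: reindex)
  ultimately show ?thesis by (rule that)
qed

text \<open>
  The maximum is attained by a stationary mixture, which is finite because its mixing measure lives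
  on the finite contact set \<open>Z\<close>. The other claims only use that a maximizer takes the values
  \<open>L i\<close> at the observations.
\<close>
theorem mle_of_observations:
  fixes x :: "nat \<Rightarrow> real" and k :: enat and n :: nat
  assumes k: "1 \<le> k" and n: "1 \<le> n" and x: "\<And>i. i \<in> {1..n} \<Longrightarrow> 0 < x i"
  shows "\<exists>g. is_mle k n x g"
    and "is_mle k n x g \<longleftrightarrow> is_arg_max (psi n x) (\<lambda>h. h \<in> k_monotone_L1 k) g"
    and "is_mle k n x g \<Longrightarrow> \<exists>F. mixing_df k F g"
    and "is_mle k n x g \<Longrightarrow> mixing_df k F g \<Longrightarrow>
      \<exists>m w a. discrete_df m w a F \<and> (\<forall>y>0. g y = (\<Sum>i=1..m. w i * mix_kernel k (a i) y))"
proof -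
  define I where "I = {1..n}"
  have I: "finite I" "I \<noteq> {}" "card I = n" using n by (auto simp: I_def)
  have xI: "\<And>i. i \<in> I \<Longrightarrow> 0 < x i" using x by (simp add: I_def)
  obtain N L where N: "mixing_measure N" "emeasure N UNIV \<le> 1"
    and L: "\<And>i. i \<in> I \<Longrightarrow> 0 < L i" and NL: "\<And>i. i \<in> I \<Longrightarrow> L i \<le> (\<integral>t. mix_kernel k t (x i) \<partial>N)"
    and stat: "\<And>t. 0 < t \<Longrightarrow> (\<Sum>i\<in>I. mix_kernel k t (x i) / L i) \<le> real (card I)"
    using stationary_mixture_exists[where x=x, OF k I(1) xI] by blast
  define Z where "Z = {t. 0 < t \<and> (\<Sum>i\<in>I. mix_kernel k t (x i) / L i) = real (card I)}"
  have fZ: "finite Z"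
  proof -
    have "finite {t. 0 < t \<and> (\<Sum>i\<in>I. inverse (L i) * mix_kernel k t (x i)) = real (card I)}"
      using n I by (intro finite_contact_set k xI) (auto intro: less_imp_le L)
    then show ?thesis by (simp add: Z_def divide_inverse mult.commute)
  qed
  have Zpos: "\<And>z. z \<in> Z \<Longrightarrow> 0 < z" by (simp add: Z_def)
  have support: "emeasure \<nu> UNIV = 1" "\<And>i. i \<in> I \<Longrightarrow> (\<integral>t. mix_kernel k t (x i) \<partial>\<nu>) = L i" "AE t in \<nu>. t \<in> Z"
    if "mixing_measure \<nu>" "emeasure \<nu> UNIV \<le> 1" "\<And>i. i \<in> I \<Longrightarrow> L i \<le> (\<integral>t. mix_kernel k t (x i) \<partial>\<nu>)" for \<nu>
    using stationary_support[OF that(1) k I(1,2) xI L stat that(2,3)] unfolding Z_def mem_Collect_eq by auto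
  note supN = support[OF N NL]
  define g0 where "g0 y = (\<Sum>z\<in>Z. measure N {z} * mix_kernel k z y)" for y
  have g0_int: "g0 y = (\<integral>t. mix_kernel k t y \<partial>N)" for y
    unfolding g0_def by (rule finitely_supported_integral[OF N(1) _ fZ supN(3), symmetric]) measurable
  have g0: "g0 \<in> k_monotone_densities k"
    unfolding g0_def
  proof (rule finite_mixture_density[OF k fZ])
    have "(\<Sum>z\<in>Z. measure N {z}) = (\<integral>t. 1 \<partial>N)"
      by (subst finitely_supported_integral[OF N(1) _ fZ supN(3)]) auto
    also have "\<dots> = 1" using supN(1) by (simp add: mixing_measureD(4)[OF N(1)] measure_def)
    finally show "(\<Sum>z\<in>Z. measure N {z}) = 1" .
  qed (use Zpos in auto)
  have ratio: "(\<Sum>i=1..n. h (x i) / L i) \<le> real n * (LINT x|lebesgue_pos. h x)" if h: "h \<in> k_monotone_L1 k" for h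
  proof -
    obtain \<nu> where \<nu>: "mixing_measure \<nu>" "emeasure \<nu> UNIV = ennreal (LINT x|lebesgue_pos. h x)"
      "\<And>x. 0 < x \<Longrightarrow> h x \<le> (\<integral>t. mix_kernel k t x \<partial>\<nu>)"
      using kernel_mixture_representation[OF k h] by metis
    have "(\<Sum>i\<in>I. h (x i) / L i) \<le> (\<Sum>i\<in>I. (\<integral>t. mix_kernel k t (x i) \<partial>\<nu>) / L i)"
      using \<nu>(3) xI L by (intro sum_mono divide_right_mono) (auto intro: less_imp_le)
    also have "\<dots> \<le> real (card I) * measure \<nu> UNIV"
      by (rule integral_kernel_sum_le[OF \<nu>(1) k xI stat])
    also have "measure \<nu> UNIV = (LINT x|lebesgue_pos. h x)"
      using \<nu>(2) integral_k_monotone_L1_nonneg[OF h] by (simp add: measure_def)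
    finally have "(\<Sum>i\<in>I. h (x i) / L i) \<le> real n * (LINT x|lebesgue_pos. h x)"
      by (simp only: I(3))
    then show ?thesis by (simp only: I_def)
  qed
  have LI: "\<And>i. i \<in> {1..n} \<Longrightarrow> 0 < L i" using L by (simp add: I_def)
  have g0L: "\<And>i. i \<in> {1..n} \<Longrightarrow> g0 (x i) = L i" using supN(2) by (simp add: g0_int I_def)
  have iff: "is_mle k n x g \<longleftrightarrow> g \<in> k_monotone_densities k \<and> (\<forall>i\<in>{1..n}. g (x i) = L i)"
    "is_arg_max (psi n x) (\<lambda>h. h \<in> k_monotone_L1 k) g
      \<longleftrightarrow> g \<in> k_monotone_densities k \<and> (\<forall>i\<in>{1..n}. g (x i) = L i)" for g
    by (rule maximizers_iff(1)[OF n x LI ratio g0 g0L], assumption+)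
       (rule maximizers_iff(2)[OF n x LI ratio g0 g0L], assumption+)
  show "\<exists>g. is_mle k n x g" unfolding iff(1) using g0 g0L by blast
  show "is_mle k n x g \<longleftrightarrow> is_arg_max (psi n x) (\<lambda>h. h \<in> k_monotone_L1 k) g"
    unfolding iff ..
  assume mle: "is_mle k n x g"
  then have g: "g \<in> k_monotone_L1 k" "(LINT x|lebesgue_pos. g x) = 1" and gL: "\<And>i. i \<in> I \<Longrightarrow> g (x i) = L i"
    unfolding iff(1) k_monotone_densities_iff I_def by blast+
  show "\<exists>F. mixing_df k F g"
  proof -
    obtain \<nu> where \<nu>: "mixing_measure \<nu>" "emeasure \<nu> UNIV = ennreal (LINT x|lebesgue_pos. g x)"
      "\<And>x. 0 < x \<Longrightarrow> g x \<le> (\<integral>t. mix_kernel k t x \<partial>\<nu>)"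
      "\<And>x. 0 < x \<Longrightarrow> k \<noteq> 1 \<or> emeasure \<nu> {x} = 0 \<Longrightarrow> g x = (\<integral>t. mix_kernel k t x \<partial>\<nu>)"
      using kernel_mixture_representation[OF k g(1)] by metis
    have one: "emeasure \<nu> UNIV = 1" using \<nu>(2) g(2) by simp
    have ge: "L i \<le> (\<integral>t. mix_kernel k t (x i) \<partial>\<nu>)" if "i \<in> I" for i
      using \<nu>(3)[OF xI[OF that]] gL[OF that] by simp
    have le1: "emeasure \<nu> UNIV \<le> 1" by (simp add: one)
    have \<nu>_obs: "(\<integral>t. mix_kernel k t (x i) \<partial>\<nu>) = L i" if "i \<in> I" for i
      by (rule support(2)[OF \<nu>(1) le1 ge that])
    have \<nu>_Z: "AE t in \<nu>. t \<in> Z"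
      by (rule support(3)[OF \<nu>(1) le1 ge])
    have "g y = (\<integral>t. mix_kernel k t y \<partial>\<nu>)" if y: "0 < y" for y
    \<comment> \<open>At a jump of \<open>g\<close>, possible only for \<open>k = 1\<close>, the point \<open>y\<close> is an observation, and there \<open>g\<close> agrees with the mixture.\<close>
    proof (cases "k \<noteq> 1 \<or> emeasure \<nu> {y} = 0")
      case True
      then show ?thesis by (rule \<nu>(4)[OF y])
    next
      case False
      have "y \<in> Z"
      proof (rule ccontr)
        assume "y \<notin> Z"
        have "AE t in \<nu>. t \<notin> {y}" using \<nu>_Z by eventually_elim (use \<open>y \<notin> Z\<close> in auto)
        then have "emeasure \<nu> {y} = 0"
          by (subst (asm) AE_iff_measurable[where N="{y}"]) (auto simp: mixing_measureD[OF \<nu>(1)])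
        then show False using False by simp
      qed
      have k1: "k = 1" using False by simp
      have "\<exists>i\<in>I. y = x i"
      proof (rule contact_points_are_observations[where L=L and b="real (card I)", OF I(1) xI L])
        show "0 < real (card I)" using n I(3) by simp
        show "(\<Sum>i\<in>I. mix_kernel 1 t (x i) / L i) \<le> real (card I)" if "0 < t" for t
          using stat[OF that] by (simp only: k1)
        show "(\<Sum>i\<in>I. mix_kernel 1 y (x i) / L i) = real (card I)"
          using \<open>y \<in> Z\<close> by (simp only: Z_def mem_Collect_eq k1)
      qed (use y in auto)
      then obtain i where "i \<in> I" "y = x i" by blast
      then show ?thesis using gL \<nu>_obs by simp
    qed
    then have "mixing_df k (cdf \<nu>) g" by (rule mixing_df_of_measure[OF \<nu>(1) one])
    then show ?thesis by blast
  qed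
  assume F: "mixing_df k F g"
  note M = measure_of_mixing_df[OF F]
  have "AE t in interval_measure F. t \<in> Z"
    by (rule support(3)[OF M(1)]) (use M(2,4) xI gL in auto)
  then have "AE t in interval_measure F. 0 < t \<and> t \<in> Z"
    by eventually_elim (auto dest: Zpos)
  from finite_mixing_df_discrete[OF F fZ this]
  show "\<exists>m w a. discrete_df m w a F \<and> (\<forall>y>0. g y = (\<Sum>i=1..m. w i * mix_kernel k (a i) y))"
    by metis
qed

theorem lemma2p5:
  fixes M :: "'w measure" and X :: "nat \<Rightarrow> 'w \<Rightarrow> real"
    and g0 :: "real \<Rightarrow> real" and k :: enat and n :: nat and \<omega> :: 'w
  assumes "prob_space M"
    and "1 \<le> k" and "1 \<le> n"
    and "g0 \<in> k_monotone_densities k"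
    and "prob_space.indep_vars M (\<lambda>_. lebesgue_pos) X {1..n}"
    and "\<And>i. i \<in> {1..n} \<Longrightarrow> distributed M lebesgue_pos (X i) (\<lambda>x. ennreal (g0 x))"
    and "\<omega> \<in> space M"
  shows "(\<exists>g. is_mle k n (\<lambda>i. X i \<omega>) g) \<and>
    (\<forall>g. is_mle k n (\<lambda>i. X i \<omega>) g \<longleftrightarrow>
         is_arg_max (psi n (\<lambda>i. X i \<omega>)) (\<lambda>h. h \<in> k_monotone_L1 k) g) \<and>
    (\<forall>g. is_mle k n (\<lambda>i. X i \<omega>) g \<longrightarrow>
         (\<exists>F. mixing_df k F g) \<and>
         (\<forall>F. mixing_df k F g \<longrightarrow>
            (\<exists>m w a. discrete_df m w a F \<and>
               (case k of
                  enat j \<Rightarrow> \<forall>x>0. g x =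
                    (\<Sum>i=1..m. w i * (real j * trunc_pow (a i - x) (j - 1) / a i ^ j))
                | \<infinity> \<Rightarrow> \<forall>x>0. g x = (\<Sum>i=1..m. w i / a i * exp (- x / a i))))))"
proof -
  have pos: "0 < X i \<omega>" if "i \<in> {1..n}" for i
  proof -
    have "X i \<in> measurable M lebesgue_pos" using assms(6)[OF that] by (rule distributed_measurable)
    from measurable_space[OF this assms(7)] show ?thesis by (simp add: space_lebesgue_pos)
  qed
  have form: "case k of
      enat j \<Rightarrow> \<forall>x>0. g x = (\<Sum>i=1..m. w i * (real j * trunc_pow (a i - x) (j - 1) / a i ^ j))
    | \<infinity> \<Rightarrow> \<forall>x>0. g x = (\<Sum>i=1..m. w i / a i * exp (- x / a i))"
    if "\<forall>y>0. g y = (\<Sum>i=1..m. w i * mix_kernel k (a i) y)" for g m w a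
  proof (cases k)
    case (enat j)
    show ?thesis using that unfolding enat mix_kernel_def enat.case .
  next
    case infinity
    have "w i / a i * exp (- y / a i) = w i * mix_kernel k (a i) y" for i y
      by (simp add: infinity mix_kernel_def)
    with that show ?thesis by (simp add: infinity)
  qed
  show ?thesis
  proof (intro conjI allI impI)
    show "\<exists>g. is_mle k n (\<lambda>i. X i \<omega>) g" by (rule mle_of_observations(1)[OF assms(2,3) pos])
  next
    fix g
    show "is_mle k n (\<lambda>i. X i \<omega>) g \<longleftrightarrow>
      is_arg_max (psi n (\<lambda>i. X i \<omega>)) (\<lambda>h. h \<in> k_monotone_L1 k) g" by (rule mle_of_observations(2)[OF assms(2,3) pos])
  next
    fix g assume g: "is_mle k n (\<lambda>i. X i \<omega>) g"
    show "\<exists>F. mixing_df k F g" by (rule mle_of_observations(3)[OF assms(2,3) pos g])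
  next
    fix g F assume mle: "is_mle k n (\<lambda>i. X i \<omega>) g" and F: "mixing_df k F g"
    have "\<exists>m w a. discrete_df m w a F \<and> (\<forall>y>0. g y = (\<Sum>i=1..m. w i * mix_kernel k (a i) y))"
      by (rule mle_of_observations(4)[OF assms(2,3) pos mle F])
    then obtain m w a where "discrete_df m w a F"
      and g: "\<forall>y>0. g y = (\<Sum>i=1..m. w i * mix_kernel k (a i) y)" by (elim exE conjE)
    with form[OF g] show "\<exists>m w a. discrete_df m w a F \<and> (case k of
        enat j \<Rightarrow> \<forall>x>0. g x = (\<Sum>i=1..m. w i * (real j * trunc_pow (a i - x) (j - 1) / a i ^ j))
      | \<infinity> \<Rightarrow> \<forall>x>0. g x = (\<Sum>i=1..m. w i / a i * exp (- x / a i)))"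
      by (intro exI conjI)
  qed
qed

end
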